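(* In the Finsleroid-regular space with metric function $K(x,y)$, assume $c=\mathrm{const}$. Put $$N^k_n=\left[\left(\frac1{c^2}b-Uc^2B_1\right)n^k+n\left(U-\frac1{c^2}\right)b^k\right]p_n-l^k\,\partial^*_nK-K\,m^k\,\partial^*_n\theta-a^k{}_{nj}y^j,$$ with $$B_1=\frac1{c^2}b+gq,\qquad p_n=c\,n^h\nabla_n\tilde b_h,\qquad U=C_1\frac1c\sqrt{\frac q\nu},\qquad C_1=-\frac1c .$$ Then, with $d_n=\partial/\partial x^n+N^k_n\,\partial/\partial y^k$, $$d_nK=0,\qquad d_n\theta=-C_1p_n,\qquad y_k\frac{\partial^2N^k_n}{\partial y^m\,\partial y^i}=0,$$ and the coefficients have the representation $$N^k_n=-l^k\,\frac{\partial K}{\partial x^n}-K\,m^k\left(\frac{\partial\theta}{\partial x^n}+C_1p_n\right).$$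
   Context: Setting. $M$ is a 2-dimensional $C^\infty$ manifold (local coordinates $x^i$, fibre coordinates $y^i$) with a Riemannian metric $a_{ij}(x)$, Christoffel symbols $a^k{}_{nj}$, Riemannian covariant derivative $\nabla_n$, and two smooth covector fields $\tilde b_i(x),n_i(x)$ orthonormal with respect to $a_{ij}$, positively oriented ($\tilde b_1n_2-\tilde b_2n_1>0$). Indices of $\tilde b_i,n_i$ are raised with $a^{ij}$. $c\in(0,1)$ and $g=g(x)\in(-2,2)$ are (smooth) scalars. Put $b_i=c\,\tilde b_i$, $b^i=a^{ij}b_j$, $b=b_iy^i$, $n=n_iy^i$, $S=\sqrt{a_{ij}y^iy^j}$, $q=\sqrt{S^2-b^2}=\sqrt{\frac{1-c^2}{c^2}b^2+n^2}$ (nonzero for $y\neq0$), $h=\sqrt{1-g^2/4}$, $G=g/h$, $B=b^2+gbq+q^2$, $L=q+\frac g2b$, $\nu=q+(1-c^2)gb>0$. The Finsleroid-regular metric function is $K=\sqrt B\,e^{-\frac12Gf}$, where $f=-\arctan\frac G2+\arctan\frac{L}{hb}$ if $b\ge0$ and $f=\pi-\arctan\frac G2+\arctan\frac{L}{hb}$ if $b\le0$ (with the limiting value $f=\frac\pi2-\arctan\frac G2$ at $b=0$). Put $l^k=y^k/K$, $y_k=K\,\partial K/\partial y^k$, $g_{ij}=\partial y_i/\partial y^j$, $g^{ij}$ its inverse, $T=\frac1c\sqrt{\frac{\nu}{q}}\,\frac{K^2}{B}$, $m_i=\frac1KT\,(bn_i-nb_i)$, $m^i=g^{ij}m_j$.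 Angle function: $\theta$ is a branch, near the point considered, of the solution of $K\,\partial\theta/\partial y^i=m_i$ normalized by $\theta(x,b(x))=0$, i.e. $\theta(x,y)=\int_\gamma\frac1Km_i\,dy^i$ along a path $\gamma$ in $T_xM\setminus\{0\}$ from $b(x)=(b^i(x))$ to $y$ (homotopy class chosen continuously in $(x,y)$). Both $K$ and $\theta$ are functions of $g,c,b,n$ only: $K=\mathcal K(g,c,b,n)$ and $\theta=\Theta(g,c,b,n)$, e.g. in the region $b>0$, $\theta=\frac1c\int_0^{n/b}\frac{\sqrt{1+(1-c^2)g/w}}{1+gw+w^2}\,d\tilde w$ with $w=\sqrt{\tilde w^2+\frac{1-c^2}{c^2}}$. The operator $\partial^*_n$ is $\partial^*_n=\frac{\partial g}{\partial x^n}\frac{\partial}{\partial g}$, where $\partial/\partial g$ is taken at fixed $c,b,n$. Repeated indices (running over $1,2$) are summed. *)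

theory Defs
  imports "HOL-Analysis.Analysis"
begin

text \<open>
  Everything is expressed in one coordinate chart of the two-dimensional manifold: a point is its
  coordinate vector \<^term>\<open>x :: real^2\<close>, ranging over an open set, and a tangent vector is its component
  vector \<^term>\<open>y :: real^2\<close>. For a covector \<open>w\<close> the contraction \<open>w\<^sub>i y\<^sup>i\<close> is the inner product of the
  component vectors.
\<close>

subsection \<open>Coordinate derivatives and smoothness\<close>

definition pd :: "2 \<Rightarrow> (real^2 \<Rightarrow> real) \<Rightarrow> real^2 \<Rightarrow> real" where
  "pd i f x = deriv (\<lambda>t. f (x + t *\<^sub>R axis i 1)) 0"

text \<open>\<open>C\<^sup>k\<close> on a set; meant for open sets.\<close>

fun Ck_on :: "nat \<Rightarrow> (real^2) set \<Rightarrow> (real^2 \<Rightarrow> real) \<Rightarrow> bool" where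
  "Ck_on 0 X f \<longleftrightarrow> continuous_on X f"
| "Ck_on (Suc k) X f \<longleftrightarrow> f differentiable_on X \<and> (\<forall>i. Ck_on k X (pd i f))"

definition smooth_on :: "(real^2) set \<Rightarrow> (real^2 \<Rightarrow> real) \<Rightarrow> bool" where
  "smooth_on X f \<longleftrightarrow> (\<forall>k. Ck_on k X f)"

subsection \<open>The data of a Finsleroid-regular space\<close>

record finsleroid =
  metric :: "real^2 \<Rightarrow> real^2^2"  \<comment> \<open>\<open>a\<^sub>i\<^sub>j\<close>\<close>
  btil :: "real^2 \<Rightarrow> real^2"  \<comment> \<open>the unit covector field written \<open>b\<close> with a tilde\<close>
  ncov :: "real^2 \<Rightarrow> real^2"  \<comment> \<open>\<open>n\<^sub>i\<close>\<close>
  cfun :: "real^2 \<Rightarrow> real"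
  gfun :: "real^2 \<Rightarrow> real"

definition raise :: "finsleroid \<Rightarrow> real^2 \<Rightarrow> real^2 \<Rightarrow> real^2" where
  "raise F x w = matrix_inv (metric F x) *v w"

definition finsleroid_on :: "(real^2) set \<Rightarrow> finsleroid \<Rightarrow> bool" where
  "finsleroid_on X F \<longleftrightarrow>
     open X \<and>
     (\<forall>i j. smooth_on X (\<lambda>x. metric F x $ i $ j)) \<and>
     (\<forall>i. smooth_on X (\<lambda>x. btil F x $ i)) \<and>
     (\<forall>i. smooth_on X (\<lambda>x. ncov F x $ i)) \<and>
     smooth_on X (cfun F) \<and>
     smooth_on X (gfun F) \<and>
     (\<forall>x\<in>X.
        transpose (metric F x) = metric F x \<and>
        (\<forall>v. v \<noteq> 0 \<longrightarrow> v \<bullet> (metric F x *v v) > 0) \<and>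
        raise F x (btil F x) \<bullet> btil F x = 1 \<and>
        raise F x (ncov F x) \<bullet> ncov F x = 1 \<and>
        raise F x (btil F x) \<bullet> ncov F x = 0 \<and>
        btil F x $ 1 * ncov F x $ 2 - btil F x $ 2 * ncov F x $ 1 > 0 \<and>
        0 < cfun F x \<and> cfun F x < 1 \<and>
        -2 < gfun F x \<and> gfun F x < 2)"

text \<open>Riemannian geometry of \<open>a\<^sub>i\<^sub>j\<close>: \<open>christoffel F x k n j\<close> has the upper index \<open>k\<close>, and
  \<open>nabla F w x n h\<close> is \<open>\<nabla>\<^sub>n w\<^sub>h\<close>.\<close>

definition christoffel :: "finsleroid \<Rightarrow> real^2 \<Rightarrow> 2 \<Rightarrow> 2 \<Rightarrow> 2 \<Rightarrow> real" where
  "christoffel F x k n j =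
     (\<Sum>l\<in>UNIV. matrix_inv (metric F x) $ k $ l *
        (pd n (\<lambda>x. metric F x $ l $ j) x + pd j (\<lambda>x. metric F x $ l $ n) x
         - pd l (\<lambda>x. metric F x $ n $ j) x)) / 2"

definition nabla :: "finsleroid \<Rightarrow> (real^2 \<Rightarrow> real^2) \<Rightarrow> real^2 \<Rightarrow> 2 \<Rightarrow> 2 \<Rightarrow> real" where
  "nabla F w x n h = pd n (\<lambda>x. w x $ h) x - (\<Sum>k\<in>UNIV. christoffel F x k n h * w x $ k)"

subsection \<open>The metric function\<close>

definition bcov :: "finsleroid \<Rightarrow> real^2 \<Rightarrow> real^2" where
  "bcov F x = cfun F x *\<^sub>R btil F x"

definition bup :: "finsleroid \<Rightarrow> real^2 \<Rightarrow> real^2" where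
  "bup F x = raise F x (bcov F x)"

definition nup :: "finsleroid \<Rightarrow> real^2 \<Rightarrow> real^2" where
  "nup F x = raise F x (ncov F x)"

definition bval :: "finsleroid \<Rightarrow> real^2 \<Rightarrow> real^2 \<Rightarrow> real" where
  "bval F x y = bcov F x \<bullet> y"

definition nval :: "finsleroid \<Rightarrow> real^2 \<Rightarrow> real^2 \<Rightarrow> real" where
  "nval F x y = ncov F x \<bullet> y"

definition Sval :: "finsleroid \<Rightarrow> real^2 \<Rightarrow> real^2 \<Rightarrow> real" where
  "Sval F x y = sqrt (y \<bullet> (metric F x *v y))"

definition qval :: "finsleroid \<Rightarrow> real^2 \<Rightarrow> real^2 \<Rightarrow> real" where
  "qval F x y = sqrt ((Sval F x y)\<^sup>2 - (bval F x y)\<^sup>2)"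

definition hval :: "finsleroid \<Rightarrow> real^2 \<Rightarrow> real" where
  "hval F x = sqrt (1 - (gfun F x)\<^sup>2 / 4)"

definition Gval :: "finsleroid \<Rightarrow> real^2 \<Rightarrow> real" where
  "Gval F x = gfun F x / hval F x"

definition Bval :: "finsleroid \<Rightarrow> real^2 \<Rightarrow> real^2 \<Rightarrow> real" where
  "Bval F x y = (bval F x y)\<^sup>2 + gfun F x * bval F x y * qval F x y + (qval F x y)\<^sup>2"

definition Lval :: "finsleroid \<Rightarrow> real^2 \<Rightarrow> real^2 \<Rightarrow> real" where
  "Lval F x y = qval F x y + gfun F x / 2 * bval F x y"

definition nuval :: "finsleroid \<Rightarrow> real^2 \<Rightarrow> real^2 \<Rightarrow> real" where
  "nuval F x y = qval F x y + (1 - (cfun F x)\<^sup>2) * gfun F x * bval F x y"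

definition fval :: "finsleroid \<Rightarrow> real^2 \<Rightarrow> real^2 \<Rightarrow> real" where
  "fval F x y =
     (if bval F x y > 0
        then - arctan (Gval F x / 2) + arctan (Lval F x y / (hval F x * bval F x y))
      else if bval F x y < 0
        then pi - arctan (Gval F x / 2) + arctan (Lval F x y / (hval F x * bval F x y))
      else pi / 2 - arctan (Gval F x / 2))"

definition Kval :: "finsleroid \<Rightarrow> real^2 \<Rightarrow> real^2 \<Rightarrow> real" where
  "Kval F x y = sqrt (Bval F x y) * exp (- (1/2) * Gval F x * fval F x y)"

definition lup :: "finsleroid \<Rightarrow> real^2 \<Rightarrow> real^2 \<Rightarrow> real^2" where
  "lup F x y = y /\<^sub>R Kval F x y"

definition ylow :: "finsleroid \<Rightarrow> real^2 \<Rightarrow> real^2 \<Rightarrow> real^2" where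
  "ylow F x y = (\<chi> k. Kval F x y * pd k (Kval F x) y)"

definition gten :: "finsleroid \<Rightarrow> real^2 \<Rightarrow> real^2 \<Rightarrow> real^2^2" where
  "gten F x y = (\<chi> i j. pd j (\<lambda>y. ylow F x y $ i) y)"

definition Tval :: "finsleroid \<Rightarrow> real^2 \<Rightarrow> real^2 \<Rightarrow> real" where
  "Tval F x y =
     1 / cfun F x * sqrt (nuval F x y / qval F x y) * ((Kval F x y)\<^sup>2 / Bval F x y)"

definition mlow :: "finsleroid \<Rightarrow> real^2 \<Rightarrow> real^2 \<Rightarrow> real^2" where
  "mlow F x y =
     (1 / Kval F x y * Tval F x y) *\<^sub>R (bval F x y *\<^sub>R ncov F x - nval F x y *\<^sub>R bcov F x)"

definition mup :: "finsleroid \<Rightarrow> real^2 \<Rightarrow> real^2 \<Rightarrow> real^2" where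
  "mup F x y = matrix_inv (gten F x y) *v mlow F x y"

subsection \<open>The angle function\<close>

text \<open>
  A branch of the angle function on \<open>W\<close> is selected by a family of paths: \<open>\<gamma> x y\<close> is a piecewise
  \<open>C\<^sup>1\<close> path from \<open>b\<^sup>i(x)\<close> to \<open>y\<close> in the punctured tangent space. Only its homotopy class is required
  to vary continuously, that is, it is represented by a family \<open>H x y\<close> continuous in all variables.
\<close>

definition branch_paths ::
  "(real^2) set \<Rightarrow> finsleroid \<Rightarrow> ((real^2) \<times> (real^2)) set \<Rightarrow> (real^2 \<Rightarrow> real^2 \<Rightarrow> real \<Rightarrow> real^2) \<Rightarrow> bool"
where
  "branch_paths X F W \<gamma> \<longleftrightarrow>
     open W \<and> W \<subseteq> X \<times> (- {0}) \<and>
     (\<forall>(x, y)\<in>W. valid_path (\<gamma> x y) \<and> path_image (\<gamma> x y) \<subseteq> - {0} \<and>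
        pathstart (\<gamma> x y) = bup F x \<and> pathfinish (\<gamma> x y) = y) \<and>
     (\<exists>H. continuous_on (W \<times> {0..1}) (\<lambda>((x, y), t). H x y t) \<and>
        (\<forall>(x, y)\<in>W. homotopic_paths (- {0}) (\<gamma> x y) (H x y)))"

text \<open>\<open>\<theta>(x, y)\<close> is the line integral of \<open>(1/K) m\<^sub>i dy\<^sup>i\<close> along \<open>\<gamma> x y\<close>.\<close>

definition theta ::
  "(real^2 \<Rightarrow> real^2 \<Rightarrow> real \<Rightarrow> real^2) \<Rightarrow> finsleroid \<Rightarrow> real^2 \<Rightarrow> real^2 \<Rightarrow> real"
where
  "theta \<gamma> F x y =
     integral {0..1} (\<lambda>t. (mlow F x (\<gamma> x y t) /\<^sub>R Kval F x (\<gamma> x y t))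
                          \<bullet> vector_derivative (\<gamma> x y) (at t within {0..1}))"

text \<open>
  \<open>\<partial>\<^sup>*\<^sub>n\<close>: the derivative in \<open>g\<close> is taken by replacing the field \<open>g\<close> by a constant \<open>s\<close> and
  differentiating in \<open>s\<close> at \<open>s = g(x)\<close>. The point, the vector and all other fields stay put, hence so do
  \<open>c\<close>, \<open>b\<close> and \<open>n\<close>. For the angle function the path stays put as well: its initial point \<open>b\<^sup>i(x)\<close> does
  not involve \<open>g\<close>, so the branch is the same for every \<open>s\<close>.
\<close>

definition dstar ::
  "2 \<Rightarrow> (finsleroid \<Rightarrow> real^2 \<Rightarrow> real^2 \<Rightarrow> real) \<Rightarrow> finsleroid \<Rightarrow> real^2 \<Rightarrow> real^2 \<Rightarrow> real"
where
  "dstar n \<Phi> F x y =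
     pd n (gfun F) x * deriv (\<lambda>s. \<Phi> (F\<lparr>gfun := (\<lambda>_. s)\<rparr>) x y) (gfun F x)"

subsection \<open>The connection coefficients\<close>

definition B1 :: "finsleroid \<Rightarrow> real^2 \<Rightarrow> real^2 \<Rightarrow> real" where
  "B1 F x y = 1 / (cfun F x)\<^sup>2 * bval F x y + gfun F x * qval F x y"

definition pcov :: "finsleroid \<Rightarrow> real^2 \<Rightarrow> 2 \<Rightarrow> real" where
  "pcov F x n = cfun F x * (\<Sum>h\<in>UNIV. nup F x $ h * nabla F (btil F) x n h)"

definition C1 :: "finsleroid \<Rightarrow> real^2 \<Rightarrow> real" where
  "C1 F x = - 1 / cfun F x"

definition Uval :: "finsleroid \<Rightarrow> real^2 \<Rightarrow> real^2 \<Rightarrow> real" where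
  "Uval F x y = C1 F x * (1 / cfun F x) * sqrt (qval F x y / nuval F x y)"

text \<open>\<open>Ncoef \<gamma> F x y k n\<close> is \<open>N\<^sup>k\<^sub>n(x, y)\<close>.\<close>

definition Ncoef ::
  "(real^2 \<Rightarrow> real^2 \<Rightarrow> real \<Rightarrow> real^2) \<Rightarrow> finsleroid \<Rightarrow> real^2 \<Rightarrow> real^2 \<Rightarrow> 2 \<Rightarrow> 2 \<Rightarrow> real"
where
  "Ncoef \<gamma> F x y k n =
     ((1 / (cfun F x)\<^sup>2 * bval F x y - Uval F x y * (cfun F x)\<^sup>2 * B1 F x y) * nup F x $ k
      + nval F x y * (Uval F x y - 1 / (cfun F x)\<^sup>2) * bup F x $ k) * pcov F x n
     - lup F x y $ k * dstar n Kval F x y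
     - Kval F x y * mup F x y $ k * dstar n (theta \<gamma>) F x y
     - (\<Sum>j\<in>UNIV. christoffel F x k n j * y $ j)"

definition dN ::
  "(real^2 \<Rightarrow> real^2 \<Rightarrow> real \<Rightarrow> real^2) \<Rightarrow> finsleroid \<Rightarrow> 2 \<Rightarrow> (real^2 \<Rightarrow> real^2 \<Rightarrow> real)
     \<Rightarrow> real^2 \<Rightarrow> real^2 \<Rightarrow> real"
where
  "dN \<gamma> F n \<phi> x y =
     pd n (\<lambda>x. \<phi> x y) x + (\<Sum>k\<in>UNIV. Ncoef \<gamma> F x y k n * pd k (\<lambda>y. \<phi> x y) y)"

end

theory Submission
  imports Defs "HOL-Complex_Analysis.Riemann_Mapping"
begin

text \<open>
  In two dimensions every fibre is a plane, and the orthonormal coframe \<open>(b-tilde, n)\<close> turns it into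
  the complex plane: \<open>z = b-tilde(y) + i n(y) = r e\<^bsup>i\<phi>\<^esup>\<close>. In these polar coordinates the two scalar
  functions of the geometry separate. With \<open>g = g(x)\<close> and the constant \<open>c\<close>,
  \<open>K = r exp(ln \<rho>(g, \<phi>))\<close> and \<open>\<theta> = \<Psi>(g, \<phi>)\<close>, where \<open>\<lambda> = \<partial>\<^sub>\<phi> ln \<rho>\<close> and \<open>\<Phi> = \<partial>\<^sub>\<phi> \<Psi>\<close> are elementary.
  The angle \<open>\<phi>\<close> has to be the lifted one, measured along the given path; its branch is fixed by a
  homotopy class that varies continuously, so near a given \<open>(x, y)\<close> it is a principal argument up to
  an additive constant (\<open>theta_local\<close>).

  The unit radial and angular covectors \<open>e, e'\<close> with dual vectors \<open>u, u'\<close> then give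
  \<open>dK = \<rho> (e + \<lambda> e')\<close>, \<open>K d\<theta> = m = \<rho> \<Phi> e'\<close> and, from the Riccati equation \<open>\<lambda>' = \<Phi>\<^sup>2 - 1 - \<lambda>\<^sup>2\<close>
  (\<open>DERIV_lam\<close>), \<open>g\<^sub>i\<^sub>j = l\<^sub>i l\<^sub>j + m\<^sub>i m\<^sub>j\<close>; hence \<open>K m\<^sup>k = (r / \<Phi>) (u' - \<lambda> u)\<close> (\<open>Kval_mup_polar\<close>).

  Moving the base point, the coframe rotates with angular speed \<open>p\<^sub>n / c\<close> relative to parallel transport
  (\<open>nabla_frame\<close>), so \<open>r\<close> and \<open>\<phi>\<close> change by \<open>e(\<Gamma>)\<close> and \<open>- p\<^sub>n / c + e'(\<Gamma>) / r\<close> with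
  \<open>\<Gamma>\<^sup>k = a\<^sup>k\<^sub>n\<^sub>j y\<^sup>j\<close> (\<open>DERIV_polar_base\<close>). The coefficients take the form
  \<open>N = r ((p\<^sub>n / c) u' - (\<partial>\<^sup>*\<^sub>n ln \<rho>) u - ((C\<^sub>1 p\<^sub>n + \<partial>\<^sup>*\<^sub>n \<Psi>) / \<Phi>) (u' - \<lambda> u)) - \<Gamma>\<close> (\<open>Ncoef_polar\<close>), and the two
  transport equations and the representation of \<open>N\<close> are read off in the bases \<open>e, e'\<close> and \<open>u, u'\<close>.

  For the condition on second derivatives, a function \<open>r w(\<phi>)\<close> has second derivatives
  \<open>(w + w'') e'\<^sub>i e'\<^sub>m / r\<close>, so the claim reduces to one scalar identity for functions of \<open>\<phi>\<close>
  (\<open>contraction_identity\<close>). It follows from the Riccati equation and its derivative with respect to \<open>g\<close>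
  (\<open>DERIV_lam_s\<close>).
\<close>

section \<open>Antiderivatives that depend on a parameter\<close>

text \<open>
  The signed integral from \<open>0\<close> to \<open>x\<close>; the lifted angle may be negative, where \<open>integral {0..x}\<close> is \<open>0\<close>.
\<close>

definition antider :: "(real \<Rightarrow> real) \<Rightarrow> real \<Rightarrow> real" where
  "antider f x = integral {0..x} f - integral {x..0} f"

lemma antider_eq_integral:
  assumes "continuous_on UNIV f" "A \<le> 0" "A \<le> x"
  shows "antider f x = integral {A..x} f - integral {A..0} f"
proof -
  have int: "f integrable_on {a..b}" for a b
    using assms(1) continuous_on_subset integrable_continuous_real by blast
  show ?thesis
  proof (cases "0 \<le> x")
    case True
    then have "integral {A..0} f + integral {0..x} f = integral {A..x} f" "integral {x..0} f = 0"
      using assms int by (auto intro!: Henstock_Kurzweil_Integration.integral_combine simp: le_less)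
    then show ?thesis by (simp add: antider_def)
  next
    case False
    then have "integral {A..x} f + integral {x..0} f = integral {A..0} f" "integral {0..x} f = 0"
      using assms int by (auto intro!: Henstock_Kurzweil_Integration.integral_combine)
    then show ?thesis by (simp add: antider_def)
  qed
qed

lemma DERIV_antider:
  assumes "continuous_on UNIV f"
  shows "(antider f has_real_derivative f x) (at x)"
proof -
  \<comment> \<open>a base point to the left of both \<open>0\<close> and \<open>x\<close>, so that a two-sided neighbourhood of \<open>x\<close> is covered\<close>
  define A where "A = min 0 x - 1"
  have "((\<lambda>u. integral {A..u} f) has_real_derivative f x) (at x within {A..x+1})"
    by (rule integral_has_real_derivative)
       (use assms continuous_on_subset in \<open>auto simp: A_def\<close>)
  then have "((\<lambda>u. integral {A..u} f) has_real_derivative f x) (at x)"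
    by (subst (asm) at_within_Icc_at) (auto simp: A_def)
  then have "((\<lambda>u. integral {A..u} f - integral {A..0} f) has_real_derivative f x) (at x)"
    by (auto intro!: derivative_eq_intros)
  then show ?thesis
    by (rule has_field_derivative_transform_within_open[where S="{A<..}"])
       (auto simp: A_def intro!: antider_eq_integral[OF assms, symmetric])
qed

lemma antider_unique:
  assumes "continuous_on UNIV f" "\<And>x. (P has_real_derivative f x) (at x)"
  shows "antider f x = P x - P 0"
proof -
  have "\<forall>u. ((\<lambda>u. antider f u - P u) has_real_derivative 0) (at u)"
    using DERIV_antider[OF assms(1)] assms(2) by (auto intro!: derivative_eq_intros)
  from DERIV_isconst_all[OF this, of x 0] show ?thesis by (simp add: antider_def)
qed

lemma DERIV_antider_parameter:
  fixes L Ls :: "real \<Rightarrow> real \<Rightarrow> real"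
  assumes S: "open S" "convex S" "s \<in> S"
    and L: "\<And>s t. s \<in> S \<Longrightarrow> ((\<lambda>s. L s t) has_real_derivative Ls s t) (at s)"
    and cL: "\<And>s. s \<in> S \<Longrightarrow> continuous_on UNIV (L s)"
    and cLs: "continuous_on (S \<times> UNIV) (\<lambda>(s, t). Ls s t)"
  shows "((\<lambda>s. antider (L s) x) has_real_derivative antider (Ls s) x) (at s)"
proof -
  have "((\<lambda>s. integral (cbox a b) (L s)) has_real_derivative integral (cbox a b) (Ls s)) (at s within S)"
    for a b
  proof (rule leibniz_rule_field_derivative[OF _ _ _ S(3,2)])
    show "L s integrable_on cbox a b" if "s \<in> S" for s
      using cL[OF that] by (metis continuous_on_subset integrable_continuous top_greatest)
    show "continuous_on (S \<times> cbox a b) (\<lambda>(s, t). Ls s t)"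
      by (rule continuous_on_subset[OF cLs]) auto
  qed (use L in \<open>auto intro: has_field_derivative_at_within\<close>)
  then have "((\<lambda>s. integral {a..b} (L s)) has_real_derivative integral {a..b} (Ls s)) (at s)" for a b
    using at_within_open[OF S(3,1)] by simp
  then show ?thesis
    unfolding antider_def by (intro DERIV_diff)
qed

text \<open>
  The total derivative along a curve in the \<open>(parameter, angle)\<close> plane. The partial derivative in the
  angle is jointly continuous, so existence of the other one at the single point suffices.
\<close>

lemma DERIV_antider_total:
  fixes L Ls :: "real \<Rightarrow> real \<Rightarrow> real"
  assumes S: "open S" "convex S" "\<sigma> t \<in> S"
    and L: "\<And>s t. s \<in> S \<Longrightarrow> ((\<lambda>s. L s t) has_real_derivative Ls s t) (at s)"
    and cL: "continuous_on (S \<times> UNIV) (\<lambda>(s, t). L s t)"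
    and cLs: "continuous_on (S \<times> UNIV) (\<lambda>(s, t). Ls s t)"
    and \<sigma>: "(\<sigma> has_real_derivative \<sigma>') (at t)" and \<tau>: "(\<tau> has_real_derivative \<tau>') (at t)"
  shows "((\<lambda>t. antider (L (\<sigma> t)) (\<tau> t)) has_real_derivative
           antider (Ls (\<sigma> t)) (\<tau> t) * \<sigma>' + L (\<sigma> t) (\<tau> t) * \<tau>') (at t)"
proof -
  have cL1: "continuous_on UNIV (L s)" if "s \<in> S" for s
  proof -
    have "continuous_on UNIV (\<lambda>t. (s, t))" by (intro continuous_intros)
    from continuous_on_compose2[OF cL this] that show ?thesis by auto
  qed
  have opn: "open (S \<times> (UNIV::real set))" using S by (simp add: open_Times)
  have "((\<lambda>(s, x). antider (L s) x) has_derivative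
          (\<lambda>(ds, dx). antider (Ls (\<sigma> t)) (\<tau> t) * ds + blinfun_mult_right (L (\<sigma> t) (\<tau> t)) dx))
          (at (\<sigma> t, \<tau> t) within S \<times> UNIV)"
  proof (rule has_derivative_partialsI[where fy="\<lambda>s x. blinfun_mult_right (L s x)"])
    show "((\<lambda>s. antider (L s) (\<tau> t)) has_derivative (\<lambda>ds. antider (Ls (\<sigma> t)) (\<tau> t) * ds)) (at (\<sigma> t) within S)"
      using DERIV_antider_parameter[OF S L cL1 cLs, of "\<tau> t"]
      by (auto simp: has_field_derivative_def intro: has_derivative_at_withinI)
    show "(antider (L s) has_derivative blinfun_apply (blinfun_mult_right (L s x))) (at x within UNIV)"
      if "s \<in> S" for s x
      using DERIV_antider[OF cL1[OF that], of x] by (simp add: has_field_derivative_def)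
    show "continuous (at (\<sigma> t, \<tau> t) within S \<times> UNIV) (\<lambda>(s, x). blinfun_mult_right (L s x))"
      using cL S unfolding continuous_on_eq_continuous_within
      by (auto simp: case_prod_unfold intro!: bounded_linear.continuous[OF bounded_linear_blinfun_mult_right])
  qed auto
  then have *: "((\<lambda>(s, x). antider (L s) x) has_derivative
          (\<lambda>(ds, dx). antider (Ls (\<sigma> t)) (\<tau> t) * ds + L (\<sigma> t) (\<tau> t) * dx)) (at (\<sigma> t, \<tau> t))"
    using at_within_open[OF _ opn, of "(\<sigma> t, \<tau> t)"] S by (simp add: case_prod_unfold)
  have "((\<lambda>t. (\<sigma> t, \<tau> t)) has_derivative (\<lambda>dt. (\<sigma>' * dt, \<tau>' * dt))) (at t)"
    using \<sigma> \<tau> by (auto simp: has_field_derivative_def intro!: has_derivative_Pair)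
  from has_derivative_compose[OF this *]
  have "((\<lambda>t. antider (L (\<sigma> t)) (\<tau> t)) has_derivative
          (\<lambda>dt. antider (Ls (\<sigma> t)) (\<tau> t) * (\<sigma>' * dt) + L (\<sigma> t) (\<tau> t) * (\<tau>' * dt))) (at t)"
    by simp
  then show ?thesis
    unfolding has_field_derivative_def by (rule has_derivative_eq_rhs) (simp add: fun_eq_iff algebra_simps)
qed

section \<open>The Finsler functions on the unit circle\<close>

text \<open>
  The values of \<open>q\<close>, \<open>B\<close> and \<open>\<nu>\<close> at \<open>r = 1\<close>: there \<open>b = c cos \<phi>\<close> and \<open>n = sin \<phi>\<close>, so that
  \<open>b\<^sup>2 + q\<^sup>2 = 1\<close>. The argument \<open>s\<close> is the value of the scalar \<open>g\<close>.
\<close>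

definition unit_q :: "real \<Rightarrow> real \<Rightarrow> real" where
  "unit_q c \<phi> = sqrt (1 - c\<^sup>2 * (cos \<phi>)\<^sup>2)"

definition unit_B :: "real \<Rightarrow> real \<Rightarrow> real \<Rightarrow> real" where
  "unit_B c s \<phi> = 1 + s * c * cos \<phi> * unit_q c \<phi>"

definition unit_nu :: "real \<Rightarrow> real \<Rightarrow> real \<Rightarrow> real" where
  "unit_nu c s \<phi> = unit_q c \<phi> + (1 - c\<^sup>2) * s * c * cos \<phi>"

text \<open>
  The logarithmic derivative of \<open>K\<close> in the angle; it comes from \<open>d ln K = (B\<^sub>1 db + n dn) / B\<close>.
\<close>

definition lam :: "real \<Rightarrow> real \<Rightarrow> real \<Rightarrow> real" where
  "lam c s \<phi> = - (c * s * sin \<phi> * unit_q c \<phi> / unit_B c s \<phi>)"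

definition lam_s :: "real \<Rightarrow> real \<Rightarrow> real \<Rightarrow> real" where
  "lam_s c s \<phi> = - (c * sin \<phi> * unit_q c \<phi> / (unit_B c s \<phi>)\<^sup>2)"

text \<open>
  The density of the angle form: \<open>(1/K) m\<^sub>i dy\<^sup>i = \<Phi> d\<phi>\<close>.
\<close>

definition Phi :: "real \<Rightarrow> real \<Rightarrow> real \<Rightarrow> real" where
  "Phi c s \<phi> = sqrt (unit_nu c s \<phi> / unit_q c \<phi>) / unit_B c s \<phi>"

definition dlnPhi_s :: "real \<Rightarrow> real \<Rightarrow> real \<Rightarrow> real" where
  "dlnPhi_s c s \<phi> = (1 - c\<^sup>2) * c * cos \<phi> / (2 * unit_nu c s \<phi>) - c * cos \<phi> * unit_q c \<phi> / unit_B c s \<phi>"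

definition unit_q' :: "real \<Rightarrow> real \<Rightarrow> real" where
  "unit_q' c \<phi> = c\<^sup>2 * cos \<phi> * sin \<phi> / unit_q c \<phi>"

definition unit_B' :: "real \<Rightarrow> real \<Rightarrow> real \<Rightarrow> real" where
  "unit_B' c s \<phi> = s * c * (cos \<phi> * unit_q' c \<phi> - sin \<phi> * unit_q c \<phi>)"

definition unit_nu' :: "real \<Rightarrow> real \<Rightarrow> real \<Rightarrow> real" where
  "unit_nu' c s \<phi> = unit_q' c \<phi> - (1 - c\<^sup>2) * s * c * sin \<phi>"

definition dlnPhi :: "real \<Rightarrow> real \<Rightarrow> real \<Rightarrow> real" where
  "dlnPhi c s \<phi> = unit_nu' c s \<phi> / (2 * unit_nu c s \<phi>) - unit_q' c \<phi> / (2 * unit_q c \<phi>) - unit_B' c s \<phi> / unit_B c s \<phi>"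

lemma c_cos_less:
  assumes "0 < c" "c < 1" shows "c\<^sup>2 * (cos \<phi>)\<^sup>2 < (1::real)"
proof -
  have "c\<^sup>2 * (cos \<phi>)\<^sup>2 \<le> c\<^sup>2 * 1"
    by (intro mult_left_mono) (auto simp: abs_square_le_1)
  also have "\<dots> < 1" using assms by (simp add: power_less_one_iff)
  finally show ?thesis .
qed

lemma unit_q_pos: "0 < c \<Longrightarrow> c < 1 \<Longrightarrow> 0 < unit_q c \<phi>"
  using c_cos_less[of c \<phi>] by (simp add: unit_q_def)

lemma unit_q_sq: "0 < c \<Longrightarrow> c < 1 \<Longrightarrow> (unit_q c \<phi>)\<^sup>2 = 1 - c\<^sup>2 * (cos \<phi>)\<^sup>2"
  using c_cos_less[of c \<phi>] by (simp add: unit_q_def)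

text \<open>
  The numbers \<open>c cos \<phi>\<close> and \<open>q\<close> are the legs of a right triangle with hypotenuse \<open>1\<close>.
\<close>

lemma c_cos_unit_q_le:
  assumes "0 < c" "c < 1" shows "2 * (\<bar>c * cos \<phi>\<bar> * unit_q c \<phi>) \<le> 1"
proof -
  have "0 \<le> (\<bar>c * cos \<phi>\<bar> - unit_q c \<phi>)\<^sup>2" by simp
  also have "\<dots> = 1 - 2 * (\<bar>c * cos \<phi>\<bar> * unit_q c \<phi>)"
    unfolding power2_diff using unit_q_sq[OF assms, of \<phi>] by (simp add: power_mult_distrib)
  finally show ?thesis by simp
qed

lemma unit_B_pos:
  assumes "0 < c" "c < 1" "\<bar>s\<bar> < 2" shows "0 < unit_B c s \<phi>"
proof -
  have "\<bar>s * c * cos \<phi> * unit_q c \<phi>\<bar> = \<bar>s\<bar> * (\<bar>c * cos \<phi>\<bar> * unit_q c \<phi>)"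
    using unit_q_pos[OF assms(1,2), of \<phi>] by (simp add: abs_mult)
  also have "\<dots> \<le> \<bar>s\<bar> * (1 / 2)"
    using c_cos_unit_q_le[OF assms(1,2), of \<phi>] by (intro mult_left_mono) auto
  also have "\<dots> < 1" using assms by simp
  finally show ?thesis unfolding unit_B_def by linarith
qed

text \<open>
  Since \<open>1 - c\<^sup>2 \<le> q\<^sup>2\<close>, the second summand of \<open>\<nu>\<close> is at most \<open>\<bar>s\<bar> q\<^sup>2 \<bar>c cos \<phi>\<bar> \<le> \<bar>s\<bar> q / 2 < q\<close>.
\<close>

lemma unit_nu_pos:
  assumes "0 < c" "c < 1" "\<bar>s\<bar> < 2" shows "0 < unit_nu c s \<phi>"
proof -
  have q: "0 < unit_q c \<phi>" by (rule unit_q_pos[OF assms(1,2)])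
  have c1: "0 \<le> 1 - c\<^sup>2" using assms by (simp add: power_le_one)
  have "c\<^sup>2 * (cos \<phi>)\<^sup>2 \<le> c\<^sup>2 * 1"
    by (intro mult_left_mono) (auto simp: abs_square_le_1)
  then have le: "1 - c\<^sup>2 \<le> (unit_q c \<phi>)\<^sup>2" by (simp add: unit_q_sq[OF assms(1,2)])
  have "\<bar>(1 - c\<^sup>2) * s * c * cos \<phi>\<bar> = (1 - c\<^sup>2) * (\<bar>s\<bar> * \<bar>c * cos \<phi>\<bar>)"
    using c1 by (simp add: abs_mult)
  also have "\<dots> \<le> (unit_q c \<phi>)\<^sup>2 * (\<bar>s\<bar> * \<bar>c * cos \<phi>\<bar>)"
    using le by (intro mult_right_mono) auto
  also have "\<dots> = unit_q c \<phi> * \<bar>s\<bar> * (\<bar>c * cos \<phi>\<bar> * unit_q c \<phi>)" by (simp add: power2_eq_square)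
  also have "\<dots> \<le> unit_q c \<phi> * \<bar>s\<bar> * (1 / 2)"
    using c_cos_unit_q_le[OF assms(1,2), of \<phi>] q by (intro mult_left_mono) auto
  also have "\<dots> < unit_q c \<phi> * 1" using q assms by (simp add: mult_less_cancel_left)
  finally show ?thesis unfolding unit_nu_def by linarith
qed

lemma Phi_pos: "0 < c \<Longrightarrow> c < 1 \<Longrightarrow> \<bar>s\<bar> < 2 \<Longrightarrow> 0 < Phi c s \<phi>"
  by (simp add: Phi_def unit_nu_pos unit_q_pos unit_B_pos)

lemma Phi_sq:
  assumes "0 < c" "c < 1" "\<bar>s\<bar> < 2"
  shows "(Phi c s \<phi>)\<^sup>2 = unit_nu c s \<phi> / (unit_q c \<phi> * (unit_B c s \<phi>)\<^sup>2)"
  using unit_nu_pos[OF assms, of \<phi>] unit_q_pos[OF assms(1,2), of \<phi>]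
  by (simp add: Phi_def power_divide)

lemma DERIV_unit_q:
  assumes "0 < c" "c < 1"
  shows "(unit_q c has_real_derivative unit_q' c \<phi>) (at \<phi>)"
  unfolding unit_q_def[abs_def] unit_q'_def using c_cos_less[OF assms, of \<phi>]
  by (auto intro!: derivative_eq_intros simp: unit_q_def divide_simps)

lemma DERIV_unit_B:
  assumes "0 < c" "c < 1"
  shows "(unit_B c s has_real_derivative unit_B' c s \<phi>) (at \<phi>)"
  unfolding unit_B_def[abs_def] unit_B'_def
  by (auto intro!: derivative_eq_intros DERIV_unit_q[OF assms] simp: algebra_simps)

lemma DERIV_unit_nu:
  assumes "0 < c" "c < 1"
  shows "(unit_nu c s has_real_derivative unit_nu' c s \<phi>) (at \<phi>)"
  unfolding unit_nu_def[abs_def] unit_nu'_def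
  by (auto intro!: derivative_eq_intros DERIV_unit_q[OF assms] simp: algebra_simps)

lemma DERIV_Phi:
  assumes "0 < c" "c < 1" "\<bar>s\<bar> < 2"
  shows "(Phi c s has_real_derivative Phi c s \<phi> * dlnPhi c s \<phi>) (at \<phi>)"
proof -
  note pos = unit_nu_pos[OF assms, of \<phi>] unit_q_pos[OF assms(1,2), of \<phi>] unit_B_pos[OF assms, of \<phi>]
  define r where "r = sqrt (unit_nu c s \<phi> / unit_q c \<phi>)"
  have r: "r > 0" "r * r = unit_nu c s \<phi> / unit_q c \<phi>" using pos by (auto simp: r_def)
  then have n: "unit_nu c s \<phi> = r * r * unit_q c \<phi>" using pos by (simp add: field_simps)
  have "(Phi c s has_real_derivative
      (inverse r / 2 * ((unit_nu' c s \<phi> * unit_q c \<phi> - unit_nu c s \<phi> * unit_q' c \<phi>) / (unit_q c \<phi> * unit_q c \<phi>)) * unit_B c s \<phi>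
        - r * unit_B' c s \<phi>) / (unit_B c s \<phi> * unit_B c s \<phi>)) (at \<phi>)"
    unfolding Phi_def[abs_def] r_def using pos
    by (auto intro!: derivative_eq_intros DERIV_unit_B DERIV_unit_nu DERIV_unit_q assms simp: divide_less_0_iff)
  moreover have "(inverse r / 2 * ((unit_nu' c s \<phi> * unit_q c \<phi> - unit_nu c s \<phi> * unit_q' c \<phi>) / (unit_q c \<phi> * unit_q c \<phi>)) * unit_B c s \<phi>
        - r * unit_B' c s \<phi>) / (unit_B c s \<phi> * unit_B c s \<phi>) = Phi c s \<phi> * dlnPhi c s \<phi>"
    unfolding Phi_def r_def[symmetric] dlnPhi_def unfolding n using r(1) pos(2,3) by (simp add: field_simps)
  ultimately show ?thesis by simp
qed

lemma DERIV_Phi_parameter: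
  assumes "0 < c" "c < 1" "\<bar>s\<bar> < 2"
  shows "((\<lambda>s. Phi c s \<phi>) has_real_derivative Phi c s \<phi> * dlnPhi_s c s \<phi>) (at s)"
proof -
  note pos = unit_nu_pos[OF assms, of \<phi>] unit_q_pos[OF assms(1,2), of \<phi>] unit_B_pos[OF assms, of \<phi>]
  define r where "r = sqrt (unit_nu c s \<phi> / unit_q c \<phi>)"
  have r: "r > 0" "r * r = unit_nu c s \<phi> / unit_q c \<phi>" using pos by (auto simp: r_def)
  then have n: "unit_nu c s \<phi> = r * r * unit_q c \<phi>" using pos by (simp add: field_simps)
  have dn: "((\<lambda>s. unit_nu c s \<phi>) has_real_derivative (1 - c\<^sup>2) * c * cos \<phi>) (at s)"
    unfolding unit_nu_def by (auto intro!: derivative_eq_intros)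
  have dB: "((\<lambda>s. unit_B c s \<phi>) has_real_derivative c * cos \<phi> * unit_q c \<phi>) (at s)"
    unfolding unit_B_def by (auto intro!: derivative_eq_intros)
  have "((\<lambda>s. Phi c s \<phi>) has_real_derivative
      (inverse r / 2 * ((1 - c\<^sup>2) * c * cos \<phi> / unit_q c \<phi>) * unit_B c s \<phi>
        - r * (c * cos \<phi> * unit_q c \<phi>)) / (unit_B c s \<phi> * unit_B c s \<phi>)) (at s)"
    unfolding Phi_def r_def using pos
    by (auto intro!: derivative_eq_intros dn dB simp: divide_less_0_iff)
  moreover have "(inverse r / 2 * ((1 - c\<^sup>2) * c * cos \<phi> / unit_q c \<phi>) * unit_B c s \<phi>
        - r * (c * cos \<phi> * unit_q c \<phi>)) / (unit_B c s \<phi> * unit_B c s \<phi>) = Phi c s \<phi> * dlnPhi_s c s \<phi>"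
    unfolding Phi_def r_def[symmetric] dlnPhi_s_def unfolding n using r(1) pos(2,3) by (simp add: field_simps)
  ultimately show ?thesis by simp
qed

lemma DERIV_lam_parameter:
  assumes "0 < c" "c < 1" "\<bar>s\<bar> < 2"
  shows "((\<lambda>s. lam c s \<phi>) has_real_derivative lam_s c s \<phi>) (at s)"
proof -
  note pos = unit_B_pos[OF assms, of \<phi>]
  have dB: "((\<lambda>s. unit_B c s \<phi>) has_real_derivative c * cos \<phi> * unit_q c \<phi>) (at s)"
    unfolding unit_B_def by (auto intro!: derivative_eq_intros)
  have "((\<lambda>s. lam c s \<phi>) has_real_derivative
      - ((c * sin \<phi> * unit_q c \<phi> * unit_B c s \<phi> - c * s * sin \<phi> * unit_q c \<phi> * (c * cos \<phi> * unit_q c \<phi>)) / (unit_B c s \<phi> * unit_B c s \<phi>))) (at s)"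
    unfolding lam_def using pos by (auto intro!: derivative_eq_intros dB)
  moreover have "c * sin \<phi> * unit_q c \<phi> * unit_B c s \<phi> - c * s * sin \<phi> * unit_q c \<phi> * (c * cos \<phi> * unit_q c \<phi>)
     = c * sin \<phi> * unit_q c \<phi>"
    by (simp add: unit_B_def algebra_simps)
  ultimately show ?thesis by (simp add: lam_s_def power2_eq_square)
qed

text \<open>
  The Riccati equation. It says that \<open>\<rho>'' + \<rho> = \<rho> \<Phi>\<^sup>2\<close> for \<open>\<lambda> = \<rho>' / \<rho>\<close>, which is the polar form of
  \<open>K \<partial>\<^sub>i \<partial>\<^sub>j K = m\<^sub>i m\<^sub>j\<close>.
\<close>

lemma DERIV_lam:
  assumes "0 < c" "c < 1" "\<bar>s\<bar> < 2"
  shows "(lam c s has_real_derivative (Phi c s \<phi>)\<^sup>2 - 1 - (lam c s \<phi>)\<^sup>2) (at \<phi>)"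
proof -
  note pos = unit_nu_pos[OF assms, of \<phi>] unit_q_pos[OF assms(1,2), of \<phi>] unit_B_pos[OF assms, of \<phi>]
  define q C s' B where "q = unit_q c \<phi>" and "C = cos \<phi>" and "s' = sin \<phi>" and "B = unit_B c s \<phi>"
  have q2: "q * q = 1 - c * c * (C * C)" using unit_q_sq[OF assms(1,2), of \<phi>] by (simp add: q_def C_def power2_eq_square)
  have s2: "s' * s' = 1 - C * C" unfolding s'_def C_def using sin_cos_squared_add3[of \<phi>] by (simp add: algebra_simps)
  have Bd: "B = 1 + s * c * C * q" by (simp add: B_def unit_B_def q_def C_def)
  have pos': "q > 0" "B > 0" using pos by (auto simp: q_def B_def)
  have "(lam c s has_real_derivative
     - (((c * s * C * q + c * s * s' * unit_q' c \<phi>) * B - c * s * s' * q * unit_B' c s \<phi>) / (B * B))) (at \<phi>)"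
    unfolding lam_def[abs_def] q_def C_def s'_def B_def using pos
    by (auto intro!: derivative_eq_intros DERIV_unit_q DERIV_unit_B assms simp: algebra_simps)
  moreover have "- (((c * s * C * q + c * s * s' * unit_q' c \<phi>) * B - c * s * s' * q * unit_B' c s \<phi>) / (B * B))
     = (Phi c s \<phi>)\<^sup>2 - 1 - (lam c s \<phi>)\<^sup>2"
  proof -
    have *: "- ((c * s * C * q * q + c * s * s' * (c * c * C * s')) * B
              - c * s * s' * q * (s * c * (C * (c * c * C * s') - s' * q * q)))
        = (q + (1 - c*c) * s * c * C) - q * (B * B) - q * ((c * s * s' * q) * (c * s * s' * q))"
      unfolding Bd using q2 s2 by algebra
    have "q * (- (((c * s * C * q + c * s * s' * unit_q' c \<phi>) * B - c * s * s' * q * unit_B' c s \<phi>)))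
        = - ((c * s * C * q * q + c * s * s' * (c * c * C * s')) * B
              - c * s * s' * q * (s * c * (C * (c * c * C * s') - s' * q * q)))"
      unfolding unit_q'_def unit_B'_def q_def[symmetric] C_def[symmetric] s'_def[symmetric]
      using pos' by (simp add: field_simps power2_eq_square)
    also note *
    also have "(q + (1 - c*c) * s * c * C) - q * (B * B) - q * ((c * s * s' * q) * (c * s * s' * q))
       = q * ((B * B) * ((Phi c s \<phi>)\<^sup>2 - 1 - (lam c s \<phi>)\<^sup>2))"
      unfolding Phi_sq[OF assms] lam_def unit_nu_def q_def[symmetric] C_def[symmetric] s'_def[symmetric] B_def[symmetric]
      using pos' by (simp add: field_simps power2_eq_square)
    finally have "- ((c * s * C * q + c * s * s' * unit_q' c \<phi>) * B - c * s * s' * q * unit_B' c s \<phi>)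
       = (B * B) * ((Phi c s \<phi>)\<^sup>2 - 1 - (lam c s \<phi>)\<^sup>2)" using pos' by simp
    then show ?thesis using pos' by (simp add: minus_divide_left)
  qed
  ultimately show ?thesis by simp
qed

text \<open>
  The derivative of the Riccati equation with respect to \<open>s\<close>, checked on the closed form of \<open>lam_s\<close>, which
  avoids exchanging the order of differentiation.
\<close>

lemma DERIV_lam_s:
  assumes "0 < c" "c < 1" "\<bar>s\<bar> < 2"
  shows "(lam_s c s has_real_derivative
           2 * Phi c s \<phi> * (Phi c s \<phi> * dlnPhi_s c s \<phi>) - 2 * lam c s \<phi> * lam_s c s \<phi>) (at \<phi>)"
proof -
  note pos = unit_nu_pos[OF assms, of \<phi>] unit_q_pos[OF assms(1,2), of \<phi>] unit_B_pos[OF assms, of \<phi>]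
  define q C s' B where "q = unit_q c \<phi>" and "C = cos \<phi>" and "s' = sin \<phi>" and "B = unit_B c s \<phi>"
  define n where "n = unit_nu c s \<phi>"
  have q2: "q * q = 1 - c * c * (C * C)" using unit_q_sq[OF assms(1,2), of \<phi>] by (simp add: q_def C_def power2_eq_square)
  have s2: "s' * s' = 1 - C * C" unfolding s'_def C_def using sin_cos_squared_add3[of \<phi>] by (simp add: algebra_simps)
  have Bd: "B = 1 + s * c * C * q" by (simp add: B_def unit_B_def q_def C_def)
  have nd: "n = q + (1 - c * c) * s * c * C" by (simp add: n_def unit_nu_def q_def C_def power2_eq_square)
  have pos': "q > 0" "B > 0" "n > 0" using pos by (auto simp: q_def B_def n_def)
  have "(lam_s c s has_real_derivative
     - (((c * C * q + c * s' * unit_q' c \<phi>) * (B * B) - c * s' * q * (2 * B * unit_B' c s \<phi>)) / ((B * B) * (B * B)))) (at \<phi>)"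
    unfolding lam_s_def[abs_def] q_def C_def s'_def B_def using pos
    by (auto intro!: derivative_eq_intros DERIV_unit_q DERIV_unit_B assms simp: algebra_simps power2_eq_square)
  moreover have "- (((c * C * q + c * s' * unit_q' c \<phi>) * (B * B) - c * s' * q * (2 * B * unit_B' c s \<phi>)) / ((B * B) * (B * B)))
     = 2 * Phi c s \<phi> * (Phi c s \<phi> * dlnPhi_s c s \<phi>) - 2 * lam c s \<phi> * lam_s c s \<phi>"
  proof -
    have *: "- ((c * C * q * q + c * s' * (c * c * C * s')) * B
              - c * s' * q * (2 * (s * c * (C * (c * c * C * s') - s' * q * q))))
        = ((1 - c * c) * c * C * B - 2 * (c * C) * q * n) - 2 * q * (c * s * s' * q) * (c * s' * q)"
      unfolding Bd nd using q2 s2 by algebra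
    have "q * B * (- (((c * C * q + c * s' * unit_q' c \<phi>) * (B * B) - c * s' * q * (2 * B * unit_B' c s \<phi>))))
        = B * B * (- ((c * C * q * q + c * s' * (c * c * C * s')) * B
              - c * s' * q * (2 * (s * c * (C * (c * c * C * s') - s' * q * q)))))"
      unfolding unit_q'_def unit_B'_def q_def[symmetric] C_def[symmetric] s'_def[symmetric]
      using pos' by (simp add: field_simps power2_eq_square)
    also note *
    also have "B * B * (((1 - c * c) * c * C * B - 2 * (c * C) * q * n) - 2 * q * (c * s * s' * q) * (c * s' * q))
       = q * B * ((B * B * (B * B)) * (2 * (Phi c s \<phi>)\<^sup>2 * dlnPhi_s c s \<phi> - 2 * lam c s \<phi> * lam_s c s \<phi>))"
      unfolding Phi_sq[OF assms] lam_def lam_s_def dlnPhi_s_def q_def[symmetric] C_def[symmetric] s'_def[symmetric] B_def[symmetric] n_def[symmetric]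
      using pos' by (simp add: field_simps power2_eq_square)
    finally have "B * (- ((c * C * q + c * s' * unit_q' c \<phi>) * (B * B) - c * s' * q * (2 * B * unit_B' c s \<phi>)))
       = B * ((B * B * (B * B)) * (2 * (Phi c s \<phi>)\<^sup>2 * dlnPhi_s c s \<phi> - 2 * lam c s \<phi> * lam_s c s \<phi>))"
      using pos' by (simp only: mult.assoc mult_cancel_left) simp
    then have "- ((c * C * q + c * s' * unit_q' c \<phi>) * (B * B) - c * s' * q * (2 * B * unit_B' c s \<phi>))
       = (B * B * (B * B)) * (2 * (Phi c s \<phi>)\<^sup>2 * dlnPhi_s c s \<phi> - 2 * lam c s \<phi> * lam_s c s \<phi>)"
      using pos' by (simp only: mult_cancel_left) simp
    then show ?thesis using pos' by (simp add: minus_divide_left power2_eq_square mult.assoc)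
  qed
  ultimately show ?thesis by simp
qed

text \<open>
  In polar form \<open>f = \<pi>/2 - arctan ((b/q + g/2) / h)\<close> on both half planes, see \<open>arctan_branch_formula\<close>. The
  variable \<open>b/q\<close> is smooth in \<open>\<phi>\<close> because \<open>q > 0\<close>, so this expression is smooth across \<open>b = 0\<close>.
\<close>

definition h_of :: "real \<Rightarrow> real" where "h_of s = sqrt (1 - s\<^sup>2 / 4)"

definition lnrho :: "real \<Rightarrow> real \<Rightarrow> real \<Rightarrow> real" where
  "lnrho c s \<phi> = ln (unit_B c s \<phi>) / 2
     - s / h_of s / 2 * (pi / 2 - arctan ((c * cos \<phi> / unit_q c \<phi> + s / 2) / h_of s))"

lemma h_of_pos: "\<bar>s\<bar> < 2 \<Longrightarrow> 0 < h_of s"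
  by (simp add: h_of_def abs_square_less_1[of "s/2", simplified power_divide, simplified])

lemma h_of_sq: "\<bar>s\<bar> < 2 \<Longrightarrow> h_of s * h_of s = 1 - s * s / 4"
  using h_of_pos[of s] by (simp add: h_of_def power2_eq_square)

lemma DERIV_lnrho:
  assumes "0 < c" "c < 1" "\<bar>s\<bar> < 2"
  shows "(lnrho c s has_real_derivative lam c s \<phi>) (at \<phi>)"
proof -
  note pos = unit_q_pos[OF assms(1,2), of \<phi>] unit_B_pos[OF assms, of \<phi>] h_of_pos[OF assms(3)]
  define q C s' B h where "q = unit_q c \<phi>" and "C = cos \<phi>" and "s' = sin \<phi>" and "B = unit_B c s \<phi>" and "h = h_of s"
  have q2: "q * q = 1 - c * c * (C * C)" using unit_q_sq[OF assms(1,2), of \<phi>] by (simp add: q_def C_def power2_eq_square)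
  have s2: "s' * s' = 1 - C * C" unfolding s'_def C_def using sin_cos_squared_add3[of \<phi>] by (simp add: algebra_simps)
  have Bd: "B = 1 + s * c * C * q" by (simp add: B_def unit_B_def q_def C_def)
  have h2: "h * h = 1 - s * s / 4" using h_of_sq assms by (simp add: h_def)
  have pos': "q > 0" "B > 0" "h > 0" using pos by (auto simp: q_def B_def h_def)
  define X where "X = (c * C / q + s / 2) / h"
  have X2: "(1 + X\<^sup>2) * (h * h * (q * q)) = B"
  proof -
    have "(1 + X\<^sup>2) * (h * h * (q * q)) = h * h * (q * q) + (c * C + s / 2 * q) * (c * C + s / 2 * q)"
    proof -
      have Xhq: "X * (h * q) = c * C + s / 2 * q"
      proof -
        have "X * (h * q) = (c * C / q + s / 2) * q" using pos' by (simp add: X_def)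
        then show ?thesis using pos' by (simp add: distrib_right)
      qed
      show ?thesis unfolding Xhq[symmetric] by (simp add: power2_eq_square algebra_simps)
    qed
    also have "\<dots> = (1 - s * s / 4) * (q * q) + c * C * (c * C) + s * c * C * q + s * s / 4 * (q * q)"
      unfolding h2 by (simp add: algebra_simps)
    also have "\<dots> = B" unfolding Bd by (simp add: q2 algebra_simps)
    finally show ?thesis .
  qed
  have inv: "inverse (1 + X\<^sup>2) = h * h * (q * q) / B"
  proof -
    have "1 + X\<^sup>2 \<noteq> 0" by (smt (verit) zero_le_power2)
    then show ?thesis unfolding X2[symmetric] using pos' by (simp add: inverse_eq_divide)
  qed
  have dX: "((\<lambda>\<phi>. (c * cos \<phi> / unit_q c \<phi> + s / 2) / h) has_real_derivative
      ((- (c * s') * q - c * C * unit_q' c \<phi>) / (q * q)) / h) (at \<phi>)"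
  proof -
    have "((\<lambda>\<phi>. c * cos \<phi>) has_real_derivative - (c * s')) (at \<phi>)"
      by (auto intro!: derivative_eq_intros simp: s'_def)
    from DERIV_divide[OF this DERIV_unit_q[OF assms(1,2)]] pos
    have "((\<lambda>\<phi>. c * cos \<phi> / unit_q c \<phi>) has_real_derivative
        (- (c * s') * q - c * C * unit_q' c \<phi>) / (q * q)) (at \<phi>)"
      by (simp add: q_def C_def)
    from DERIV_cdivide[OF DERIV_add[OF this DERIV_const[of "s / 2"]], of h] show ?thesis by simp
  qed
  have X_eq: "(c * cos \<phi> / unit_q c \<phi> + s / 2) / h = X" by (simp add: X_def C_def q_def)
  have da: "((\<lambda>\<phi>. arctan ((c * cos \<phi> / unit_q c \<phi> + s / 2) / h)) has_real_derivative
      inverse (1 + X\<^sup>2) * (((- (c * s') * q - c * C * unit_q' c \<phi>) / (q * q)) / h)) (at \<phi>)"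
    using DERIV_chain2[OF DERIV_arctan dX] unfolding X_eq .
  have dl: "((\<lambda>\<phi>. ln (unit_B c s \<phi>)) has_real_derivative inverse B * unit_B' c s \<phi>) (at \<phi>)"
    using DERIV_chain2[OF DERIV_ln DERIV_unit_B] pos assms by (simp add: B_def divide_inverse)
  have "(lnrho c s has_real_derivative
      inverse B * unit_B' c s \<phi> / 2
        - s / h / 2 * (0 - inverse (1 + X\<^sup>2) * (((- (c * s') * q - c * C * unit_q' c \<phi>) / (q * q)) / h))) (at \<phi>)"
    unfolding lnrho_def[abs_def] h_def[symmetric]
    by (intro DERIV_diff DERIV_cdivide DERIV_cmult DERIV_const da dl)
  moreover have "inverse B * unit_B' c s \<phi> / 2
        - s / h / 2 * (0 - inverse (1 + X\<^sup>2) * (((- (c * s') * q - c * C * unit_q' c \<phi>) / (q * q)) / h))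
      = lam c s \<phi>"
  proof -
    have unit_B'_eq: "unit_B' c s \<phi> = s * c * s' * (c * c * (C * C) - q * q) / q"
      using pos' by (simp add: unit_B'_def unit_q'_def field_simps power2_eq_square
        C_def[symmetric] s'_def[symmetric] q_def[symmetric])
    have num: "- (c * s') * q - c * C * unit_q' c \<phi> = - (c * s' / q)"
    proof -
      have "- (c * s') * q - c * C * unit_q' c \<phi> = - (c * s' * (q * q + c * c * (C * C)) / q)"
        using pos' by (simp add: unit_q'_def field_simps power2_eq_square
          C_def[symmetric] s'_def[symmetric] q_def[symmetric])
      then show ?thesis by (simp add: q2)
    qed
    have "inverse B * unit_B' c s \<phi> / 2
        - s / h / 2 * (0 - inverse (1 + X\<^sup>2) * (((- (c * s') * q - c * C * unit_q' c \<phi>) / (q * q)) / h))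
      = s * c * s' * (c * c * (C * C) - q * q - 1) / (2 * q * B)"
      unfolding inv unit_B'_eq num using pos' by (simp add: divide_simps) (simp add: algebra_simps)
    also have "\<dots> = s * c * s' * (- 2 * (q * q)) / (2 * q * B)" by (simp add: q2)
    also have "\<dots> = lam c s \<phi>"
      unfolding lam_def C_def[symmetric] s'_def[symmetric] q_def[symmetric] B_def[symmetric]
      using pos' by simp
    finally show ?thesis .
  qed
  ultimately show ?thesis by simp
qed

lemma continuous_on_unit_q [continuous_intros]:
  fixes S :: "'a::t2_space set"
  shows "continuous_on S f \<Longrightarrow> continuous_on S (\<lambda>x. unit_q c (f x))"
  unfolding unit_q_def by (intro continuous_intros)

lemma continuous_on_profiles:
  assumes "0 < c" "c < 1"
  shows "continuous_on ({-2<..<2} \<times> UNIV) (\<lambda>(s, \<phi>). lam c s \<phi>)"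
    and "continuous_on ({-2<..<2} \<times> UNIV) (\<lambda>(s, \<phi>). lam_s c s \<phi>)"
    and "continuous_on ({-2<..<2} \<times> UNIV) (\<lambda>(s, \<phi>). Phi c s \<phi>)"
    and "continuous_on ({-2<..<2} \<times> UNIV) (\<lambda>(s, \<phi>). Phi c s \<phi> * dlnPhi_s c s \<phi>)"
proof -
  have B: "1 + fst p * c * cos (snd p) * unit_q c (snd p) \<noteq> 0" if "p \<in> {-2<..<2} \<times> UNIV" for p
    using unit_B_pos[OF assms, of "fst p" "snd p"] that by (auto simp: unit_B_def abs_less_iff)
  have q: "unit_q c x \<noteq> 0" for x using unit_q_pos[OF assms, of x] by simp
  have nu: "unit_q c (snd p) + (1 - c\<^sup>2) * fst p * c * cos (snd p) \<noteq> 0" if "p \<in> {-2<..<2} \<times> UNIV" for p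
    using unit_nu_pos[OF assms, of "fst p" "snd p"] that by (auto simp: unit_nu_def abs_less_iff)
  have nu': "2 * unit_q c y + 2 * ((1 - c\<^sup>2) * x * c * cos y) \<noteq> 0" if "-2 < x" "x < 2" for x y
    using unit_nu_pos[OF assms, of x y] that by (auto simp: unit_nu_def abs_less_iff)
  show "continuous_on ({-2<..<2} \<times> UNIV) (\<lambda>(s, \<phi>). lam c s \<phi>)"
       "continuous_on ({-2<..<2} \<times> UNIV) (\<lambda>(s, \<phi>). lam_s c s \<phi>)"
       "continuous_on ({-2<..<2} \<times> UNIV) (\<lambda>(s, \<phi>). Phi c s \<phi>)"
       "continuous_on ({-2<..<2} \<times> UNIV) (\<lambda>(s, \<phi>). Phi c s \<phi> * dlnPhi_s c s \<phi>)"
    unfolding lam_def lam_s_def Phi_def dlnPhi_s_def unit_B_def unit_nu_def case_prod_unfold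
    using B q nu nu' by (auto intro!: continuous_intros)
qed

lemma continuous_on_profile:
  assumes "continuous_on ({-2<..<2} \<times> UNIV) (\<lambda>(s, \<phi>). L s \<phi>)" "\<bar>s\<bar> < (2::real)"
  shows "continuous_on UNIV (L s)"
proof -
  have "continuous_on UNIV (\<lambda>t. (s, t))" by (intro continuous_intros)
  moreover have "range (Pair s) \<subseteq> {-2<..<2} \<times> UNIV" using assms(2) by auto
  ultimately show ?thesis using continuous_on_compose2[OF assms(1)] by fastforce
qed

text \<open>
  Functions of \<open>(s, \<phi>)\<close>: the angle \<open>\<theta>\<close>, its derivative in \<open>s\<close>, and the derivative of \<open>ln \<rho>\<close> in \<open>s\<close>. The last
  one is split into its value at \<open>\<phi> = 0\<close> and an integral of \<open>lam_s\<close>, so that its derivative in \<open>\<phi>\<close> is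
  evident.
\<close>

definition Psi :: "real \<Rightarrow> real \<Rightarrow> real \<Rightarrow> real" where
  "Psi c s = antider (Phi c s)"

definition Psi_s :: "real \<Rightarrow> real \<Rightarrow> real \<Rightarrow> real" where
  "Psi_s c s = antider (\<lambda>\<phi>. Phi c s \<phi> * dlnPhi_s c s \<phi>)"

definition lnrho_s :: "real \<Rightarrow> real \<Rightarrow> real \<Rightarrow> real" where
  "lnrho_s c s \<phi> = deriv (\<lambda>s. lnrho c s 0) s + antider (lam_s c s) \<phi>"

lemma DERIV_Psi: "0 < c \<Longrightarrow> c < 1 \<Longrightarrow> \<bar>s\<bar> < 2 \<Longrightarrow> (Psi c s has_real_derivative Phi c s \<phi>) (at \<phi>)"
  unfolding Psi_def by (intro DERIV_antider continuous_on_profile continuous_on_profiles)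

lemma DERIV_Psi_s:
  "0 < c \<Longrightarrow> c < 1 \<Longrightarrow> \<bar>s\<bar> < 2 \<Longrightarrow> (Psi_s c s has_real_derivative Phi c s \<phi> * dlnPhi_s c s \<phi>) (at \<phi>)"
  unfolding Psi_s_def
  by (rule DERIV_antider[OF continuous_on_profile[OF continuous_on_profiles(4)]]) auto

lemma DERIV_lnrho_s:
  "0 < c \<Longrightarrow> c < 1 \<Longrightarrow> \<bar>s\<bar> < 2 \<Longrightarrow> (lnrho_s c s has_real_derivative lam_s c s \<phi>) (at \<phi>)"
  unfolding lnrho_s_def[abs_def]
  by (auto intro!: derivative_eq_intros DERIV_antider continuous_on_profile continuous_on_profiles)

lemma DERIV_Psi_total:
  assumes "0 < c" "c < 1" "\<bar>\<sigma> t\<bar> < 2"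
    and "(\<sigma> has_real_derivative \<sigma>') (at t)" "(\<tau> has_real_derivative \<tau>') (at t)"
  shows "((\<lambda>t. Psi c (\<sigma> t) (\<tau> t)) has_real_derivative
           Psi_s c (\<sigma> t) (\<tau> t) * \<sigma>' + Phi c (\<sigma> t) (\<tau> t) * \<tau>') (at t)"
  unfolding Psi_def Psi_s_def
  by (rule DERIV_antider_total[where S="{-2<..<2}"])
     (use assms in \<open>auto intro!: continuous_on_profiles DERIV_Phi_parameter simp: abs_less_iff\<close>)

lemma DERIV_lnrho_total:
  assumes c: "0 < c" "c < 1" and s: "\<bar>\<sigma> t\<bar> < 2"
    and \<sigma>: "(\<sigma> has_real_derivative \<sigma>') (at t)" and \<tau>: "(\<tau> has_real_derivative \<tau>') (at t)"
  shows "((\<lambda>t. lnrho c (\<sigma> t) (\<tau> t)) has_real_derivative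
           lnrho_s c (\<sigma> t) (\<tau> t) * \<sigma>' + lam c (\<sigma> t) (\<tau> t) * \<tau>') (at t)"
proof -
  have split: "lnrho c s \<phi> = lnrho c s 0 + antider (lam c s) \<phi>" if "\<bar>s\<bar> < 2" for s \<phi>
    using antider_unique[OF continuous_on_profile[OF continuous_on_profiles(1)[OF c]] DERIV_lnrho[OF c that], of \<phi>] that
    by simp
  have "(\<lambda>s. lnrho c s 0) field_differentiable at (\<sigma> t)"
  proof -
    note pos = unit_B_pos[OF c s, of 0] h_of_pos[OF s]
    have dB: "((\<lambda>s. unit_B c s 0) has_real_derivative c * unit_q c 0) (at (\<sigma> t))"
      unfolding unit_B_def by (auto intro!: derivative_eq_intros)
    have dh: "(h_of has_real_derivative inverse (h_of (\<sigma> t)) / 2 * (- (\<sigma> t) / 2)) (at (\<sigma> t))"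
      unfolding h_of_def[abs_def] using pos(2)
      by (auto intro!: derivative_eq_intros simp: h_of_def)
    have "\<exists>D. ((\<lambda>s. lnrho c s 0) has_real_derivative D) (at (\<sigma> t))"
      unfolding lnrho_def
      by (rule exI) (rule dB dh derivative_eq_intros refl | (use pos in \<open>simp; fail\<close>))+
    then show ?thesis by (simp add: field_differentiable_def)
  qed
  then have d0: "((\<lambda>s. lnrho c s 0) has_real_derivative deriv (\<lambda>s. lnrho c s 0) (\<sigma> t)) (at (\<sigma> t))"
    by (simp add: DERIV_deriv_iff_field_differentiable)
  have d1: "((\<lambda>t. lnrho c (\<sigma> t) 0) has_real_derivative deriv (\<lambda>s. lnrho c s 0) (\<sigma> t) * \<sigma>') (at t)"
    using DERIV_chain2[OF d0 \<sigma>] .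
  have d2: "((\<lambda>t. antider (lam c (\<sigma> t)) (\<tau> t)) has_real_derivative
        antider (lam_s c (\<sigma> t)) (\<tau> t) * \<sigma>' + lam c (\<sigma> t) (\<tau> t) * \<tau>') (at t)"
    by (rule DERIV_antider_total[where S="{-2<..<2}"])
       (use assms in \<open>auto intro!: continuous_on_profiles DERIV_lam_parameter simp: abs_less_iff\<close>)
  have "\<forall>\<^sub>F t in nhds t. \<bar>\<sigma> t\<bar> < 2"
  proof -
    have "isCont \<sigma> t" using \<sigma> by (rule DERIV_isCont)
    then have "((\<lambda>t. \<bar>\<sigma> t\<bar>) \<longlongrightarrow> \<bar>\<sigma> t\<bar>) (nhds t)"
      by (intro tendsto_intros) (simp add: isCont_def tendsto_at_iff_tendsto_nhds)
    from order_tendstoD(2)[OF this s] show ?thesis .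
  qed
  then have ev: "\<forall>\<^sub>F t in nhds t. lnrho c (\<sigma> t) (\<tau> t) = lnrho c (\<sigma> t) 0 + antider (lam c (\<sigma> t)) (\<tau> t)"
    by eventually_elim (rule split)
  show ?thesis
    by (subst DERIV_cong_ev[OF refl ev refl])
       (auto intro!: derivative_eq_intros d1 d2 simp: lnrho_s_def algebra_simps)
qed

text \<open>
  With \<open>\<delta> = arctan X - arctan Y\<close> the quotient on the left is \<open>cot \<delta> = tan (\<plusminus>\<pi>/2 - \<delta>)\<close>; the sign of \<open>b\<close>
  decides in which interval \<open>\<delta>\<close> lies. The two values differ by \<open>\<pi>\<close>, which is the jump compensated in the
  definition of \<open>f\<close>.
\<close>

lemma arctan_branch_formula:
  fixes b q s :: real
  assumes "q > 0" "\<bar>s\<bar> < 2" "b \<noteq> 0"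
  defines "X \<equiv> (b / q + s / 2) / h_of s" and "Y \<equiv> s / h_of s / 2"
  shows "arctan ((q + s / 2 * b) / (h_of s * b))
       = (if b > 0 then pi / 2 else - (pi / 2)) - arctan X + arctan Y"
proof -
  note h = h_of_pos[OF assms(2)] h_of_sq[OF assms(2)]
  define \<delta> where "\<delta> = arctan X - arctan Y"
  have sa: "sin (arctan x) = x * cos (arctan x)" for x :: real
    by (simp add: sin_arctan cos_arctan)
  have sd: "sin \<delta> = cos (arctan X) * cos (arctan Y) * (X - Y)"
    unfolding \<delta>_def sin_diff sa by (simp add: algebra_simps)
  have cd: "cos \<delta> = cos (arctan X) * cos (arctan Y) * (1 + X * Y)"
    unfolding \<delta>_def cos_diff sa by (simp add: algebra_simps)
  have XY: "X - Y = b / q / h_of s" using h by (simp add: X_def Y_def field_simps)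
  have "1 + X * Y = (h_of s * h_of s + (b / q + s / 2) * (s / 2)) / (h_of s * h_of s)"
  proof -
    have "Z / h_of s * (s / h_of s / 2) = Z * (s / 2) / (h_of s * h_of s)" for Z by simp
    moreover have "1 = h_of s * h_of s / (h_of s * h_of s)" using h(1) by simp
    ultimately show ?thesis unfolding X_def Y_def by (metis add_divide_distrib)
  qed
  then have XY1: "1 + X * Y = (1 + b / q * (s / 2)) / (h_of s * h_of s)"
    by (simp add: h(2) algebra_simps)
  have pos: "cos (arctan X) > 0" "cos (arctan Y) > 0"
    by (rule cos_gt_zero_pi; use arctan_lbound arctan_ubound in force)+
  have ratio: "cos \<delta> / sin \<delta> = (q + s / 2 * b) / (h_of s * b)"
  proof -
    have "cos \<delta> / sin \<delta> = (1 + X * Y) / (X - Y)"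
      unfolding sd cd using pos by simp
    also have "\<dots> = (q + s / 2 * b) / (h_of s * b)"
      unfolding XY XY1 using h(1) assms(1,3) by (simp add: divide_simps)
    finally show ?thesis .
  qed
  have bnd: "- (pi/2) < arctan X" "arctan X < pi/2" "- (pi/2) < arctan Y" "arctan Y < pi/2"
    using arctan_lbound arctan_ubound by auto
  show ?thesis
  proof (cases "b > 0")
    case True
    then have "Y < X" using XY h assms(1) by (metis diff_gt_0_iff_gt divide_pos_pos)
    then have "arctan Y < arctan X" by (simp add: arctan_less_iff)
    then have "- (pi / 2) < pi / 2 - \<delta>" "pi / 2 - \<delta> < pi / 2"
      using bnd unfolding \<delta>_def by linarith+
    moreover have "tan (pi / 2 - \<delta>) = (q + s / 2 * b) / (h_of s * b)"
      by (simp add: tan_def sin_diff cos_diff ratio)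
    ultimately have "arctan ((q + s / 2 * b) / (h_of s * b)) = pi / 2 - \<delta>"
      by (rule arctan_unique)
    then show ?thesis using True by (simp add: \<delta>_def)
  next
    case False
    with \<open>b \<noteq> 0\<close> have "b < 0" by simp
    then have "X < Y" using XY h assms(1)
      by (metis diff_less_0_iff_less divide_neg_pos)
    then have "arctan X < arctan Y" by (simp add: arctan_less_iff)
    then have "- (pi / 2) < - (pi / 2) - \<delta>" "- (pi / 2) - \<delta> < pi / 2"
      using bnd unfolding \<delta>_def by linarith+
    moreover have "tan (- (pi / 2) - \<delta>) = (q + s / 2 * b) / (h_of s * b)"
      by (simp add: tan_def sin_diff cos_diff ratio)
    ultimately have "arctan ((q + s / 2 * b) / (h_of s * b)) = - (pi / 2) - \<delta>"
      by (rule arctan_unique)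
    then show ?thesis using False by (simp add: \<delta>_def)
  qed
qed

section \<open>The adapted frame and polar values\<close>

text \<open>
  The part of \<open>finsleroid_on\<close> that concerns a single point. It is stable under replacing the field \<open>g\<close> by a
  constant, as the operator \<open>\<partial>\<^sup>*\<close> demands.
\<close>

definition frame_at :: "finsleroid \<Rightarrow> real^2 \<Rightarrow> bool" where
  "frame_at F x \<longleftrightarrow>
     transpose (metric F x) = metric F x \<and>
     (\<forall>v. v \<noteq> 0 \<longrightarrow> v \<bullet> (metric F x *v v) > 0) \<and>
     raise F x (btil F x) \<bullet> btil F x = 1 \<and>
     raise F x (ncov F x) \<bullet> ncov F x = 1 \<and>
     raise F x (btil F x) \<bullet> ncov F x = 0 \<and>
     btil F x $ 1 * ncov F x $ 2 - btil F x $ 2 * ncov F x $ 1 > 0 \<and>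
     0 < cfun F x \<and> cfun F x < 1 \<and> \<bar>gfun F x\<bar> < 2"

lemma finsleroid_on_frame: "finsleroid_on X F \<Longrightarrow> x \<in> X \<Longrightarrow> frame_at F x"
  by (auto simp: finsleroid_on_def frame_at_def)

definition btup :: "finsleroid \<Rightarrow> real^2 \<Rightarrow> real^2" where
  "btup F x = raise F x (btil F x)"

definition frame_coord :: "finsleroid \<Rightarrow> real^2 \<Rightarrow> real^2 \<Rightarrow> complex" where
  "frame_coord F x y = Complex (btil F x \<bullet> y) (ncov F x \<bullet> y)"

lemma eq_0_if_orthogonal_to_basis:
  fixes a b v :: "real^2"
  assumes "a $ 1 * b $ 2 - a $ 2 * b $ 1 \<noteq> 0" "a \<bullet> v = 0" "b \<bullet> v = 0"
  shows "v = 0"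
proof -
  have e: "a $ 1 * v $ 1 + a $ 2 * v $ 2 = 0" "b $ 1 * v $ 1 + b $ 2 * v $ 2 = 0"
    using assms(2,3) by (simp_all add: inner_vec_def sum_2)
  have "(a $ 1 * b $ 2 - a $ 2 * b $ 1) * v $ 1
      = b $ 2 * (a $ 1 * v $ 1 + a $ 2 * v $ 2) - a $ 2 * (b $ 1 * v $ 1 + b $ 2 * v $ 2)"
    by (simp add: algebra_simps)
  then have v1: "v $ 1 = 0" using e assms(1) by simp
  have "(a $ 1 * b $ 2 - a $ 2 * b $ 1) * v $ 2
      = a $ 1 * (b $ 1 * v $ 1 + b $ 2 * v $ 2) - b $ 1 * (a $ 1 * v $ 1 + a $ 2 * v $ 2)"
    by (simp add: algebra_simps)
  then have v2: "v $ 2 = 0" using e assms(1) by simp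
  show ?thesis using v1 v2 by (simp add: vec_eq_iff forall_2)
qed

lemma matrix_mult_matrix_inv:
  fixes A :: "real^'n^'n"
  assumes "invertible A" shows "A ** matrix_inv A = mat 1" "matrix_inv A ** A = mat 1"
  using someI_ex[OF assms[unfolded invertible_def]] by (simp_all add: matrix_inv_def)

lemma metric_inverse:
  assumes "frame_at F x"
  shows "metric F x ** matrix_inv (metric F x) = mat 1"
proof -
  have "metric F x *v v = 0 \<Longrightarrow> v = 0" for v
    using assms unfolding frame_at_def by (metis inner_zero_right less_irrefl)
  then have "invertible (metric F x)"
    by (simp add: invertible_left_inverse matrix_left_invertible_ker)
  then show ?thesis by (rule matrix_mult_matrix_inv)
qed

lemma frame_metric_raise:
  assumes "frame_at F x" shows "metric F x *v raise F x w = w"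
  by (simp add: raise_def matrix_vector_mul_assoc metric_inverse[OF assms])

lemma metric_sym:
  assumes "frame_at F x" shows "v \<bullet> (metric F x *v w) = w \<bullet> (metric F x *v v)"
  using assms unfolding frame_at_def by (metis dot_lmul_matrix inner_commute transpose_matrix_vector)

lemma frame_dual:
  assumes "frame_at F x"
  shows "btil F x \<bullet> btup F x = 1" "ncov F x \<bullet> nup F x = 1"
    "ncov F x \<bullet> btup F x = 0" "btil F x \<bullet> nup F x = 0"
proof -
  show "btil F x \<bullet> btup F x = 1" "ncov F x \<bullet> nup F x = 1" "ncov F x \<bullet> btup F x = 0"
    using assms by (simp_all add: frame_at_def btup_def nup_def inner_commute)
  then show "btil F x \<bullet> nup F x = 0"
    using metric_sym[OF assms, of "nup F x" "btup F x"] frame_metric_raise[OF assms]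
    by (simp add: btup_def nup_def inner_commute)
qed

lemma frame_decomp:
  assumes "frame_at F x"
  shows "y = (btil F x \<bullet> y) *\<^sub>R btup F x + (ncov F x \<bullet> y) *\<^sub>R nup F x"
proof -
  have "y - ((btil F x \<bullet> y) *\<^sub>R btup F x + (ncov F x \<bullet> y) *\<^sub>R nup F x) = 0"
    by (rule eq_0_if_orthogonal_to_basis[of "btil F x" "ncov F x"])
       (use assms in \<open>auto simp: frame_at_def inner_diff_right inner_add_right frame_dual[OF assms]\<close>)
  then show ?thesis by simp
qed

text \<open>
  Orthonormality of the coframe means \<open>a\<^sub>i\<^sub>j = b-tilde\<^sub>i b-tilde\<^sub>j + n\<^sub>i n\<^sub>j\<close>.
\<close>

lemma frame_metric:
  assumes "frame_at F x"
  shows "metric F x *v y = (btil F x \<bullet> y) *\<^sub>R btil F x + (ncov F x \<bullet> y) *\<^sub>R ncov F x"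
  by (subst (1) frame_decomp[OF assms, of y])
     (simp add: matrix_vector_right_distrib matrix_vector_mult_scaleR btup_def nup_def frame_metric_raise[OF assms])

lemma frame_coord_nonzero:
  assumes "frame_at F x" "y \<noteq> 0" shows "frame_coord F x y \<noteq> 0"
  using assms eq_0_if_orthogonal_to_basis[of "btil F x" "ncov F x" y]
  by (auto simp: frame_coord_def complex_eq_iff frame_at_def)

text \<open>
  The differentials \<open>dr\<close> and \<open>r d\<phi>\<close> of the polar coordinates, followed by the dual vectors.
\<close>

definition ecov :: "finsleroid \<Rightarrow> real^2 \<Rightarrow> real \<Rightarrow> real^2" where
  "ecov F x \<phi> = cos \<phi> *\<^sub>R btil F x + sin \<phi> *\<^sub>R ncov F x"

definition ecov' :: "finsleroid \<Rightarrow> real^2 \<Rightarrow> real \<Rightarrow> real^2" where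
  "ecov' F x \<phi> = cos \<phi> *\<^sub>R ncov F x - sin \<phi> *\<^sub>R btil F x"

definition eup :: "finsleroid \<Rightarrow> real^2 \<Rightarrow> real \<Rightarrow> real^2" where
  "eup F x \<phi> = cos \<phi> *\<^sub>R btup F x + sin \<phi> *\<^sub>R nup F x"

definition eup' :: "finsleroid \<Rightarrow> real^2 \<Rightarrow> real \<Rightarrow> real^2" where
  "eup' F x \<phi> = cos \<phi> *\<^sub>R nup F x - sin \<phi> *\<^sub>R btup F x"

lemma e_dual:
  assumes "frame_at F x"
  shows "ecov F x \<phi> \<bullet> eup F x \<phi> = 1" "ecov' F x \<phi> \<bullet> eup' F x \<phi> = 1"
    "ecov F x \<phi> \<bullet> eup' F x \<phi> = 0" "ecov' F x \<phi> \<bullet> eup F x \<phi> = 0"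
  using sin_cos_squared_add3[of \<phi>]
  by (simp_all add: ecov_def ecov'_def eup_def eup'_def inner_diff_right inner_add_right
      inner_diff_left inner_add_left frame_dual[OF assms] algebra_simps)

lemma e_decomp:
  assumes "frame_at F x"
  shows "y = (ecov F x \<phi> \<bullet> y) *\<^sub>R eup F x \<phi> + (ecov' F x \<phi> \<bullet> y) *\<^sub>R eup' F x \<phi>"
proof -
  have gen: "(C * b + S * n) *\<^sub>R (C *\<^sub>R B + S *\<^sub>R N) + (C * n - S * b) *\<^sub>R (C *\<^sub>R N - S *\<^sub>R B)
      = ((C * C + S * S) * b) *\<^sub>R B + ((C * C + S * S) * n) *\<^sub>R N" for C S b n :: real and B N :: "real^2"
    by (simp add: algebra_simps)
  show ?thesis
    unfolding ecov_def ecov'_def eup_def eup'_def inner_add_left inner_diff_left inner_scaleR_left gen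
    using frame_decomp[OF assms, of y] by simp
qed

lemma frame_coord_polar_iff: "frame_coord F x y = of_real r * cis \<phi> \<longleftrightarrow> btil F x \<bullet> y = r * cos \<phi> \<and> ncov F x \<bullet> y = r * sin \<phi>"
  by (auto simp: frame_coord_def complex_eq_iff)

lemma fundamental_values_polar:
  assumes "frame_at F x" "frame_coord F x y = of_real r * cis \<phi>" "r > 0"
  shows "y = r *\<^sub>R eup F x \<phi>"
    "bval F x y = r * (cfun F x * cos \<phi>)"
    "nval F x y = r * sin \<phi>"
    "qval F x y = r * unit_q (cfun F x) \<phi>"
    "Bval F x y = r\<^sup>2 * unit_B (cfun F x) (gfun F x) \<phi>"
    "nuval F x y = r * unit_nu (cfun F x) (gfun F x) \<phi>"
proof -
  have c: "0 < cfun F x" "cfun F x < 1" using assms(1) by (auto simp: frame_at_def)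
  have bn: "btil F x \<bullet> y = r * cos \<phi>" "ncov F x \<bullet> y = r * sin \<phi>"
    using assms(2) frame_coord_polar_iff by auto
  show "y = r *\<^sub>R eup F x \<phi>"
    using frame_decomp[OF assms(1), of y] by (simp add: bn eup_def scaleR_add_right)
  show b: "bval F x y = r * (cfun F x * cos \<phi>)" and n: "nval F x y = r * sin \<phi>"
    by (simp_all add: bval_def nval_def bcov_def bn)
  have "y \<bullet> (metric F x *v y) = (btil F x \<bullet> y)\<^sup>2 + (ncov F x \<bullet> y)\<^sup>2"
    unfolding frame_metric[OF assms(1)] by (simp add: inner_add_right inner_commute power2_eq_square)
  also have "\<dots> = r\<^sup>2 * ((sin \<phi>)\<^sup>2 + (cos \<phi>)\<^sup>2)" unfolding bn power_mult_distrib distrib_left by (rule add.commute)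
  also have "\<dots> = r\<^sup>2" by simp
  finally have S: "(Sval F x y)\<^sup>2 = r\<^sup>2" by (simp add: Sval_def)
  have "(Sval F x y)\<^sup>2 - (bval F x y)\<^sup>2 = r\<^sup>2 * (1 - (cfun F x)\<^sup>2 * (cos \<phi>)\<^sup>2)"
    unfolding S b by (simp add: algebra_simps power_mult_distrib)
  then show q: "qval F x y = r * unit_q (cfun F x) \<phi>"
    using assms(3) by (simp add: qval_def unit_q_def real_sqrt_mult)
  show "Bval F x y = r\<^sup>2 * unit_B (cfun F x) (gfun F x) \<phi>"
    unfolding Bval_def b q power_mult_distrib unit_q_sq[OF c] unit_B_def
    by (simp add: algebra_simps power2_eq_square)
  show "nuval F x y = r * unit_nu (cfun F x) (gfun F x) \<phi>"
    unfolding nuval_def b q unit_nu_def by (simp add: algebra_simps)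
qed

lemma Kval_polar:
  assumes "frame_at F x" "frame_coord F x y = of_real r * cis \<phi>" "r > 0"
  shows "Kval F x y = r * exp (lnrho (cfun F x) (gfun F x) \<phi>)"
proof -
  define c s where "c = cfun F x" and "s = gfun F x"
  have c: "0 < c" "c < 1" and s: "\<bar>s\<bar> < 2" using assms(1) by (auto simp: frame_at_def c_def s_def)
  note vals = fundamental_values_polar[OF assms, folded c_def s_def]
  note q = unit_q_pos[OF c, of \<phi>] and B = unit_B_pos[OF c s, of \<phi>] and h = h_of_pos[OF s]
  have h_eq: "hval F x = h_of s" by (simp add: hval_def h_of_def s_def)
  have f: "fval F x y = pi / 2 - arctan ((c * cos \<phi> / unit_q c \<phi> + s / 2) / h_of s)"
  proof (cases "bval F x y = 0")
    case True
    then have "c * cos \<phi> = 0" using vals(2) assms(3) by simp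
    then have "(c * cos \<phi> / unit_q c \<phi> + s / 2) / h_of s = s / h_of s / 2"
      unfolding \<open>c * cos \<phi> = 0\<close> by simp
    then show ?thesis using True by (simp add: fval_def Gval_def h_eq s_def[symmetric])
  next
    case False
    have ratio: "bval F x y / qval F x y = c * cos \<phi> / unit_q c \<phi>" using vals(2,4) assms(3) by simp
    have "qval F x y > 0" using vals(4) q assms(3) by simp
    from arctan_branch_formula[OF this s False]
    show ?thesis using False
      by (simp add: fval_def Gval_def h_eq s_def[symmetric] Lval_def ratio)
  qed
  define f where "f = fval F x y"
  have "exp (ln (unit_B c s \<phi>) / 2) = sqrt (unit_B c s \<phi>)"
    using B by (simp add: ln_sqrt[symmetric] del: ln_sqrt)
  then have B': "sqrt (Bval F x y) = r * exp (ln (unit_B c s \<phi>) / 2)"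
    using vals(5) assms(3) by (simp add: real_sqrt_mult)
  have ln: "lnrho c s \<phi> = ln (unit_B c s \<phi>) / 2 + - (1 / 2) * (s / h_of s) * f"
    unfolding lnrho_def f[symmetric] f_def by simp
  show ?thesis
    unfolding c_def[symmetric] s_def[symmetric] ln exp_add
    unfolding Kval_def B' Gval_def h_eq f_def s_def by (rule mult.assoc)
qed

lemma mlow_polar:
  assumes "frame_at F x" "frame_coord F x y = of_real r * cis \<phi>" "r > 0"
  shows "mlow F x y = (exp (lnrho (cfun F x) (gfun F x) \<phi>) * Phi (cfun F x) (gfun F x) \<phi>) *\<^sub>R ecov' F x \<phi>"
proof -
  define c s where "c = cfun F x" and "s = gfun F x"
  have c: "0 < c" "c < 1" and s: "\<bar>s\<bar> < 2" using assms(1) by (auto simp: frame_at_def c_def s_def)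
  note vals = fundamental_values_polar[OF assms, folded c_def s_def]
  note q = unit_q_pos[OF c, of \<phi>] and B = unit_B_pos[OF c s, of \<phi>]
  define \<rho> where "\<rho> = exp (lnrho c s \<phi>)"
  have K: "Kval F x y = r * \<rho>" using Kval_polar[OF assms] by (simp add: \<rho>_def c_def s_def)
  have \<rho>: "\<rho> > 0" by (simp add: \<rho>_def)
  have 1: "bval F x y *\<^sub>R ncov F x - nval F x y *\<^sub>R bcov F x = (r * c) *\<^sub>R ecov' F x \<phi>"
    by (simp add: vals(2,3) bcov_def ecov'_def c_def[symmetric] algebra_simps)
  have 2: "1 / Kval F x y * Tval F x y * (r * c) = \<rho> * Phi c s \<phi>"
    unfolding Tval_def K Phi_def vals(4-6) c_def[symmetric] using c \<rho> assms(3) B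
    by (simp add: field_simps power2_eq_square)
  show ?thesis
    unfolding mlow_def 1 scaleR_scaleR 2 by (simp add: \<rho>_def c_def s_def)
qed

section \<open>Continuous logarithms and the lifted angle\<close>

text \<open>
  The argument of \<open>z\<close> that is close to \<open>\<phi>\<^sub>0\<close>: smooth on the half plane around the direction \<open>\<phi>\<^sub>0\<close>, whatever
  multiple of \<open>2\<pi>\<close> the angle \<open>\<phi>\<^sub>0\<close> carries.
\<close>

definition lifted_arg :: "real \<Rightarrow> complex \<Rightarrow> real" where
  "lifted_arg \<phi>\<^sub>0 z = \<phi>\<^sub>0 + Im (Ln (z * cis (- \<phi>\<^sub>0)))"

lemma lifted_arg_polar:
  assumes "z \<noteq> 0" shows "z = of_real (cmod z) * cis (lifted_arg \<phi>\<^sub>0 z)"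
proof -
  define w where "w = z * cis (- \<phi>\<^sub>0)"
  have w: "w \<noteq> 0" "cmod w = cmod z" using assms by (simp_all add: w_def norm_mult)
  have "w = exp (Ln w)" using w by simp
  also have "\<dots> = of_real (cmod z) * cis (Im (Ln w))" using w assms by (simp add: exp_eq_polar)
  finally have "w * cis \<phi>\<^sub>0 = of_real (cmod z) * (cis (Im (Ln w)) * cis \<phi>\<^sub>0)" by simp
  moreover have "w * cis \<phi>\<^sub>0 = z" by (simp add: w_def mult.assoc cis_mult)
  ultimately show ?thesis by (simp add: cis_mult lifted_arg_def w_def add.commute)
qed

lemma has_vector_derivative_ln_curve:
  fixes z :: "real \<Rightarrow> complex"
  assumes "(z has_vector_derivative z') (at t)" "Re (z t * k) > 0"
  shows "((\<lambda>t. Ln (z t * k)) has_vector_derivative z' / z t) (at t)"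
proof -
  have nz: "z t * k \<noteq> 0" using assms(2) by auto
  have "z t * k \<notin> \<real>\<^sub>\<le>\<^sub>0" using assms(2) by (simp only: complex_nonpos_Reals_iff) linarith
  from field_vector_diff_chain_at[OF has_vector_derivative_mult_left[OF assms(1), of k] has_field_derivative_Ln[OF this]]
  show ?thesis using nz by (simp add: o_def field_simps)
qed

lemma DERIV_Im: "(f has_vector_derivative d) (at t) \<Longrightarrow> ((\<lambda>t. Im (f t)) has_real_derivative Im d) (at t)"
  unfolding has_real_derivative_iff_has_vector_derivative
  by (rule bounded_linear.has_vector_derivative[OF bounded_linear_Im])

lemma DERIV_Re: "(f has_vector_derivative d) (at t) \<Longrightarrow> ((\<lambda>t. Re (f t)) has_real_derivative Re d) (at t)"
  unfolding has_real_derivative_iff_has_vector_derivative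
  by (rule bounded_linear.has_vector_derivative[OF bounded_linear_Re])

lemma eventually_Re_pos:
  fixes z :: "real \<Rightarrow> complex"
  assumes "(z has_vector_derivative z') (at t)" "Re (z t * k) > 0"
  shows "\<forall>\<^sub>F t in nhds t. Re (z t * k) > 0"
proof -
  have "((\<lambda>t. z t) \<longlongrightarrow> z t) (nhds t)"
    using assms(1) has_vector_derivative_continuous isCont_def tendsto_at_iff_tendsto_nhds by blast
  then have "((\<lambda>t. Re (z t * k)) \<longlongrightarrow> Re (z t * k)) (nhds t)" by (intro tendsto_intros)
  from order_tendstoD(1)[OF this assms(2)] show ?thesis .
qed

lemma DERIV_lifted_arg:
  assumes "(z has_vector_derivative z') (at t)" "Re (z t * cis (- \<phi>\<^sub>0)) > 0"
  shows "((\<lambda>t. lifted_arg \<phi>\<^sub>0 (z t)) has_real_derivative Im (z' / z t)) (at t)"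
  unfolding lifted_arg_def
  using DERIV_add[OF DERIV_const DERIV_Im[OF has_vector_derivative_ln_curve[OF assms]]] by simp

lemma DERIV_cmod:
  fixes z :: "real \<Rightarrow> complex"
  assumes "(z has_vector_derivative z') (at t)" "Re (z t * cis k) > 0"
  shows "((\<lambda>t. cmod (z t)) has_real_derivative cmod (z t) * Re (z' / z t)) (at t)"
proof -
  have nz: "z t \<noteq> 0" using assms(2) by auto
  have "((\<lambda>t. exp (Re (Ln (z t * cis k)))) has_real_derivative
      exp (Re (Ln (z t * cis k))) * Re (z' / z t)) (at t)"
    by (intro DERIV_chain2[OF DERIV_exp] DERIV_Re has_vector_derivative_ln_curve assms)
  moreover have "\<forall>\<^sub>F t in nhds t. cmod (z t) = exp (Re (Ln (z t * cis k)))"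
    using eventually_Re_pos[OF assms]
  proof eventually_elim
    case (elim t)
    then have "z t \<noteq> 0" by auto
    then show ?case by (simp add: norm_mult)
  qed
  ultimately show ?thesis
    using nz by (subst DERIV_cong_ev[OF refl _ refl]) (auto simp: norm_mult)
qed

lemma div_polar:
  assumes "z = of_real r * cis \<phi>" "r > 0"
  shows "w / z = of_real (1 / r) * (w * cis (- \<phi>))"
proof -
  have "of_real (1 / r) * (w * cis (- \<phi>)) * z = w * (cis (- \<phi>) * cis \<phi>)"
    unfolding assms(1) using assms(2) by (simp add: field_simps del: cis_mult)
  then have "of_real (1 / r) * (w * cis (- \<phi>)) * z = w" by (simp add: cis_mult)
  moreover have "z \<noteq> 0" using assms by simp
  ultimately show ?thesis by (metis nonzero_eq_divide_eq)
qed

lemma frame_coord_rotate: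
  "Im (frame_coord F x v * cis (- \<phi>)) = ecov' F x \<phi> \<bullet> v" "Re (frame_coord F x v * cis (- \<phi>)) = ecov F x \<phi> \<bullet> v"
  by (simp_all add: frame_coord_def ecov_def ecov'_def inner_add_left inner_diff_left algebra_simps)

lemma Im_div_polar:
  assumes "z = of_real r * cis \<phi>" "r > 0"
  shows "Im (frame_coord F x v / z) = (ecov' F x \<phi> \<bullet> v) / r"
proof -
  have "Im (of_real a * w) = a * Im w" for a w by simp
  then show ?thesis unfolding div_polar[OF assms] frame_coord_rotate[symmetric] by simp
qed

lemma Re_div_polar:
  assumes "z = of_real r * cis \<phi>" "r > 0"
  shows "Re (frame_coord F x v / z) = (ecov F x \<phi> \<bullet> v) / r"
proof -
  have "Re (of_real a * w) = a * Re w" for a w by simp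
  from this[of "1 / r" "frame_coord F x v * cis (- \<phi>)"] show ?thesis
    unfolding div_polar[OF assms] frame_coord_rotate by simp
qed

text \<open>
  Two continuous logarithms of one path differ by a continuous function with values in \<open>2\<pi>i\<int>\<close>.
\<close>

lemma continuous_log_increment:
  fixes q1 q2 :: "real \<Rightarrow> complex"
  assumes "continuous_on {0..1} q1" "continuous_on {0..1} q2"
    and "\<And>t. t \<in> {0..1} \<Longrightarrow> exp (q1 t) = exp (q2 t)"
  shows "q1 1 - q1 0 = q2 1 - q2 0"
proof -
  have "(\<lambda>t. q1 t - q2 t) constant_on {0..1}"
  proof (rule continuous_discrete_range_constant)
    show "continuous_on {0..1} (\<lambda>t. q1 t - q2 t)" by (intro continuous_intros assms)
    fix t :: real assume t: "t \<in> {0..1}"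
    have ex: "exp (q1 t - q2 t) = 1" if "t \<in> {0..1}" for t
      using assms(3)[OF that] by (simp add: exp_diff)
    show "\<exists>e>0. \<forall>u. u \<in> {0..1} \<and> q1 u - q2 u \<noteq> q1 t - q2 t \<longrightarrow> e \<le> cmod (q1 u - q2 u - (q1 t - q2 t))"
    proof (intro exI[of _ "2 * pi"] conjI allI impI)
      fix u :: real assume u: "u \<in> {0..1} \<and> q1 u - q2 u \<noteq> q1 t - q2 t"
      define d where "d = q1 u - q2 u - (q1 t - q2 t)"
      have "exp d = 1" unfolding d_def exp_diff[of "q1 u - q2 u"] using ex[OF t] ex[of u] u by simp
      then obtain n :: int where n: "Re d = 0" "Im d = of_int (2 * n) * pi"
        unfolding exp_eq_1 by blast
      have "d \<noteq> 0" using u by (simp add: d_def)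
      then have "n \<noteq> 0" using n by (auto simp: complex_eq_iff)
      then have "1 \<le> \<bar>real_of_int n\<bar>" by linarith
      then have "2 * pi * 1 \<le> 2 * pi * \<bar>real_of_int n\<bar>" by (intro mult_left_mono) auto
      then have "2 * pi \<le> \<bar>Im d\<bar>" using n by (simp add: abs_mult)
      then show "2 * pi \<le> cmod (q1 u - q2 u - (q1 t - q2 t))"
        using abs_Im_le_cmod[of d] by (simp add: d_def)
    qed simp
  qed simp
  then obtain k where "\<And>t. t \<in> {0..1} \<Longrightarrow> q1 t - q2 t = k" unfolding constant_on_def by blast
  from this[of 0] this[of 1] show ?thesis by (simp add: algebra_simps)
qed

text \<open>
  The increment of a continuous logarithm is \<open>2\<pi>i\<close> times the winding number of the (open) path, which is
  invariant under homotopies with fixed end points.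
\<close>

lemma log_increment_homotopic:
  fixes p1 p2 q1 q2 :: "real \<Rightarrow> complex"
  assumes "homotopic_paths (-{0}) p1 p2"
    and q1: "continuous_on {0..1} q1" "\<And>t. t \<in> {0..1} \<Longrightarrow> p1 t = exp (q1 t)"
    and q2: "continuous_on {0..1} q2" "\<And>t. t \<in> {0..1} \<Longrightarrow> p2 t = exp (q2 t)"
  shows "q1 1 - q1 0 = q2 1 - q2 0"
proof -
  have wn: "q 1 - q 0 = 2 * of_real pi * \<i> * winding_number p 0"
    if p: "path p" "0 \<notin> path_image p"
      and q: "continuous_on {0..1} q" "\<And>t. t \<in> {0..1} \<Longrightarrow> p t = exp (q t)" for p q
  proof -
    obtain q' where q': "path q'" "pathfinish q' - pathstart q' = 2 * of_real pi * \<i> * winding_number p 0"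
      "\<And>t. t \<in> {0..1} \<Longrightarrow> p t = 0 + exp (q' t)"
      using winding_number_as_continuous_log[OF p] by blast
    have "q 1 - q 0 = q' 1 - q' 0"
      by (rule continuous_log_increment) (use q q' in \<open>auto simp: path_def\<close>)
    then show ?thesis using q'(2) by (simp add: pathfinish_def pathstart_def)
  qed
  have "path p1" "path p2" "0 \<notin> path_image p1" "0 \<notin> path_image p2"
    using homotopic_paths_imp_path[OF assms(1)] homotopic_paths_imp_subset[OF assms(1)] by auto
  then show ?thesis
    using wn[of p1 q1] wn[of p2 q2] q1 q2 winding_number_homotopic_paths[OF assms(1)] by simp
qed

lemma bounded_linear_frame_coord: "bounded_linear (frame_coord F x)"
  unfolding frame_coord_def[abs_def] Complex_eq
  using bounded_linear_add[OF
      bounded_linear_compose[OF bounded_linear_of_real bounded_linear_inner_right]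
      bounded_linear_compose[OF bounded_linear_mult_right
        bounded_linear_compose[OF bounded_linear_of_real bounded_linear_inner_right]]] .

text \<open>
  Near \<open>t\<close> a continuous logarithm \<open>q\<close> of \<open>z\<close> stays within \<open>\<pi>\<close> of \<open>q t\<close>, so it equals
  \<open>q t + Ln (z s / z t)\<close> there.
\<close>

lemma has_vector_derivative_log_path:
  fixes z q :: "real \<Rightarrow> complex"
  assumes z: "(z has_vector_derivative z') (at t)" and t: "t \<in> {0<..<1}"
    and q: "continuous_on {0..1} q" "\<And>t. t \<in> {0..1} \<Longrightarrow> z t = exp (q t)"
  shows "(q has_vector_derivative z' / z t) (at t)"
proof -
  have nz: "z t \<noteq> 0" using q(2)[of t] t by auto
  have d: "((\<lambda>s. q t + Ln (z s * inverse (z t))) has_vector_derivative z' / z t) (at t)"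
    using has_vector_derivative_add[OF has_vector_derivative_const has_vector_derivative_ln_curve[OF z, of "inverse (z t)"]] nz
    by simp
  have "isCont q t" using continuous_on_interior[OF q(1), of t] t by simp
  then have "((\<lambda>s. \<bar>Im (q s - q t)\<bar>) \<longlongrightarrow> \<bar>Im (q t - q t)\<bar>) (nhds t)"
    by (intro tendsto_intros) (simp add: isCont_def tendsto_at_iff_tendsto_nhds)
  then have "\<forall>\<^sub>F s in nhds t. \<bar>Im (q s - q t)\<bar> < pi" by (rule order_tendstoD) simp
  moreover have "\<forall>\<^sub>F s in nhds t. s \<in> {0<..<1}" using t by (intro eventually_nhds_in_open) auto
  ultimately have ev: "\<forall>\<^sub>F s in nhds t. q s = q t + Ln (z s * inverse (z t))"
  proof eventually_elim
    case (elim s)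
    have "z s * inverse (z t) = exp (q s - q t)"
      using q(2)[of s] q(2)[of t] elim t by (simp add: exp_diff divide_inverse)
    moreover have "Ln (exp (q s - q t)) = q s - q t"
      by (rule Ln_exp) (use elim in auto)
    ultimately show ?case by simp
  qed
  then obtain U where U: "open U" "t \<in> U" "\<And>s. s \<in> U \<Longrightarrow> q t + Ln (z s * inverse (z t)) = q s"
    unfolding eventually_nhds by metis
  show ?thesis
    by (rule has_vector_derivative_transform_within_open[OF d U])
qed

text \<open>
  The integrand is \<open>\<Phi>(\<phi>) \<phi>'\<close> for the angle \<open>\<phi> = Im q\<close> along the path, so the integral depends on the
  final angle only. The path may leave any sector and turn around the origin.
\<close>

lemma theta_integral_log:
  assumes fr: "frame_at F x" and p: "valid_path p" "path_image p \<subseteq> -{0}"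
    and q: "continuous_on {0..1} q" "\<And>t. t \<in> {0..1} \<Longrightarrow> frame_coord F x (p t) = exp (q t)" and q0: "Im (q 0) = 0"
  shows "integral {0..1} (\<lambda>t. (mlow F x (p t) /\<^sub>R Kval F x (p t)) \<bullet> vector_derivative p (at t within {0..1}))
           = Psi (cfun F x) (gfun F x) (Im (q 1))"
proof -
  define c s where "c = cfun F x" and "s = gfun F x"
  have c: "0 < c" "c < 1" and s: "\<bar>s\<bar> < 2" using fr by (auto simp: frame_at_def c_def s_def)
  obtain S D where S: "finite S" and D: "\<And>t. t \<in> {0..1} - S \<Longrightarrow> (p has_vector_derivative D t) (at t)"
    using p(1) unfolding valid_path_def piecewise_C1_differentiable_on_def C1_differentiable_on_def by blast
  have "((\<lambda>t. Phi c s (Im (q t)) * Im (frame_coord F x (D t) / frame_coord F x (p t))) has_integral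
      (Psi c s (Im (q 1)) - Psi c s (Im (q 0)))) {0..1}"
  proof (rule fundamental_theorem_of_calculus_interior_strong[OF S,
        where f="\<lambda>t. Psi c s (Im (q t))"])
    fix t :: real assume t: "t \<in> {0<..<1} - S"
    have "((\<lambda>t. frame_coord F x (p t)) has_vector_derivative frame_coord F x (D t)) (at t)"
      by (rule bounded_linear.has_vector_derivative[OF bounded_linear_frame_coord D]) (use t in auto)
    from has_vector_derivative_log_path[OF this _ q] t
    have "((\<lambda>t. Im (q t)) has_real_derivative Im (frame_coord F x (D t) / frame_coord F x (p t))) (at t)"
      by (auto intro: DERIV_Im)
    from DERIV_chain2[OF DERIV_Psi[OF c s] this]
    show "((\<lambda>t. Psi c s (Im (q t))) has_vector_derivative
        Phi c s (Im (q t)) * Im (frame_coord F x (D t) / frame_coord F x (p t))) (at t)"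
      by (simp add: has_real_derivative_iff_has_vector_derivative)
  next
    have "continuous_on UNIV (Psi c s)"
      using DERIV_Psi[OF c s] by (meson DERIV_isCont continuous_at_imp_continuous_on)
    then show "continuous_on {0..1} (\<lambda>t. Psi c s (Im (q t)))"
      by (rule continuous_on_compose2) (auto intro!: continuous_intros q)
  qed simp
  then have "((\<lambda>t. (mlow F x (p t) /\<^sub>R Kval F x (p t)) \<bullet> vector_derivative p (at t within {0..1})) has_integral
      (Psi c s (Im (q 1)) - Psi c s (Im (q 0)))) {0..1}"
  proof (rule has_integral_spike_finite[OF S, rotated])
    fix t :: real assume t: "t \<in> {0..1} - S"
    have vd: "vector_derivative p (at t within {0..1}) = D t"
      by (rule vector_derivative_at_within_ivl[OF D[OF t]]) (use t in auto)
    define r \<phi> where "r = exp (Re (q t))" and "\<phi> = Im (q t)"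
    have z: "frame_coord F x (p t) = of_real r * cis \<phi>" "r > 0"
      using q(2)[of t] t by (auto simp: r_def \<phi>_def exp_eq_polar)
    have "inverse (r * exp (lnrho c s \<phi>)) * (exp (lnrho c s \<phi>) * Phi c s \<phi> * X) = Phi c s \<phi> * (X / r)" for X
      by (simp add: field_simps)
    from this[of "ecov' F x \<phi> \<bullet> D t"] show "(mlow F x (p t) /\<^sub>R Kval F x (p t)) \<bullet> vector_derivative p (at t within {0..1})
        = Phi c s (Im (q t)) * Im (frame_coord F x (D t) / frame_coord F x (p t))"
      unfolding vd Im_div_polar[OF z] mlow_polar[OF fr z] Kval_polar[OF fr z]
      by (simp add: c_def s_def \<phi>_def[symmetric] mult.assoc)
  qed
  moreover have "Psi c s 0 = 0" by (simp add: Psi_def antider_def)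
  ultimately show ?thesis using q0 by (simp add: c_def s_def integral_unique)
qed

lemma gfun_update_simps [simp]:
  "raise (F\<lparr>gfun := g'\<rparr>) = raise F" "frame_coord (F\<lparr>gfun := g'\<rparr>) = frame_coord F"
  "bup (F\<lparr>gfun := g'\<rparr>) = bup F"
  by (simp_all add: raise_def bup_def frame_coord_def bcov_def fun_eq_iff)

lemma frame_at_gfun_update: "frame_at F x \<Longrightarrow> \<bar>g' x\<bar> < 2 \<Longrightarrow> frame_at (F\<lparr>gfun := g'\<rparr>) x"
  by (simp add: frame_at_def)

lemma frame_coord_bup:
  assumes "frame_at F x" shows "frame_coord F x (bup F x) = of_real (cfun F x)"
proof -
  have "bup F x = cfun F x *\<^sub>R btup F x"
    by (simp add: bup_def bcov_def btup_def raise_def matrix_vector_mult_scaleR)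
  then show ?thesis by (simp add: frame_coord_def frame_dual[OF assms] complex_eq_iff)
qed

lemma finsleroid_on_continuous:
  assumes "finsleroid_on X F"
  shows "continuous_on X (btil F)" "continuous_on X (ncov F)"
proof -
  have c: "continuous_on X (\<lambda>x. btil F x $ i)" "continuous_on X (\<lambda>x. ncov F x $ i)" for i
    using assms Ck_on.simps(1) unfolding finsleroid_on_def smooth_on_def by metis+
  show "continuous_on X (btil F)" "continuous_on X (ncov F)"
  proof -
    have "continuous_on X (\<lambda>x. \<chi> i. btil F x $ i)" by (rule continuous_on_vec_lambda) (rule c)
    then show "continuous_on X (btil F)" by simp
    have "continuous_on X (\<lambda>x. \<chi> i. ncov F x $ i)" by (rule continuous_on_vec_lambda) (rule c)
    then show "continuous_on X (ncov F)" by simp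
  qed
qed

text \<open>
  If the paths \<open>H x y\<close> of the continuous family are uniformly close to \<open>H x0 y0\<close>, their quotient stays in
  the right half plane, and its principal logarithm added to a logarithm along \<open>H x0 y0\<close> is a logarithm
  along \<open>H x y\<close>. At the initial point this quotient is a positive real number, because \<open>b\<^sup>i(x)\<close> has the
  coordinate \<open>c(x) > 0\<close>; hence the final angle along \<open>\<gamma> x y\<close> is \<open>lifted_arg\<close> at \<open>y\<close>. The same sector serves
  every choice of the field \<open>g\<close>, which is what the derivative \<open>\<partial>\<^sup>*\<close> of \<open>\<theta>\<close> needs.
\<close>

lemma theta_local:
  assumes fin: "finsleroid_on X F" and br: "branch_paths X F W \<gamma>" and in_W: "(x0, y0) \<in> W"
  obtains \<phi>\<^sub>0 V where "open V" "(x0, y0) \<in> V" "V \<subseteq> W"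
    and "\<And>x y. (x, y) \<in> V \<Longrightarrow> Re (frame_coord F x y * cis (- \<phi>\<^sub>0)) > 0"
    and "\<And>x y g'. (x, y) \<in> V \<Longrightarrow> \<bar>g' x\<bar> < 2 \<Longrightarrow>
           theta \<gamma> (F\<lparr>gfun := g'\<rparr>) x y = Psi (cfun F x) (g' x) (lifted_arg \<phi>\<^sub>0 (frame_coord F x y))"
proof -
  have W: "open W" "W \<subseteq> X \<times> - {0}"
    and \<gamma>: "\<And>x y. (x, y) \<in> W \<Longrightarrow> valid_path (\<gamma> x y) \<and> path_image (\<gamma> x y) \<subseteq> - {0} \<and>
        pathstart (\<gamma> x y) = bup F x \<and> pathfinish (\<gamma> x y) = y"
    using br by (auto simp: branch_paths_def)
  obtain H where H: "continuous_on (W \<times> {0..1}) (\<lambda>((x, y), t). H x y t)"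
    and hom: "\<And>x y. (x, y) \<in> W \<Longrightarrow> homotopic_paths (- {0}) (\<gamma> x y) (H x y)"
    using br unfolding branch_paths_def by blast
  have fr: "frame_at F x" if "(x, y) \<in> W" for x y
    using finsleroid_on_frame[OF fin, of x] that W(2) by auto
  define Z where "Z = (\<lambda>w t. frame_coord F (fst w) (H (fst w) (snd w) t))"
  have hz: "homotopic_paths (- {0}) (frame_coord F x \<circ> \<gamma> x y) (frame_coord F x \<circ> H x y)" if "(x, y) \<in> W" for x y
    by (rule homotopic_paths_continuous_image[OF hom[OF that]])
       (use frame_coord_nonzero[OF fr[OF that]] bounded_linear_frame_coord[of F x] in \<open>auto intro: linear_continuous_on\<close>)
  have Zeq: "Z (x, y) t = (frame_coord F x \<circ> H x y) t" for x y t by (simp add: Z_def)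
  have Znz: "Z w t \<noteq> 0" if "w \<in> W" "t \<in> {0..1}" for w t
    using homotopic_paths_imp_subset[OF hz[of "fst w" "snd w"]] that by (auto simp: Z_def path_image_def)
  have Z0: "Z (x, y) 0 = of_real (cfun F x)" and Z1: "Z (x, y) 1 = frame_coord F x y" if "(x, y) \<in> W" for x y
    using homotopic_paths_imp_pathstart[OF hom[OF that]] homotopic_paths_imp_pathfinish[OF hom[OF that]]
      \<gamma>[OF that] frame_coord_bup[OF fr[OF that]] by (auto simp: Z_def pathstart_def pathfinish_def)
  have cZ: "continuous_on (W \<times> {0..1}) (\<lambda>(w, t). Z w t)"
  proof -
    have c1: "continuous_on (W \<times> {0..1::real}) (\<lambda>p. btil F (fst (fst p)))"
      "continuous_on (W \<times> {0..1::real}) (\<lambda>p. ncov F (fst (fst p)))"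
      by (rule continuous_on_compose2[OF finsleroid_on_continuous(1)[OF fin]]
            continuous_on_compose2[OF finsleroid_on_continuous(2)[OF fin]],
          use W(2) in \<open>auto intro!: continuous_intros\<close>)+
    have c2: "continuous_on (W \<times> {0..1}) (\<lambda>p. H (fst (fst p)) (snd (fst p)) (snd p))"
      using H by (simp add: case_prod_unfold)
    show ?thesis
      unfolding Z_def frame_coord_def Complex_eq case_prod_unfold by (intro continuous_intros c1 c2)
  qed
  obtain e where e: "e > 0" "cball (x0, y0) e \<subseteq> W"
    using W(1) in_W open_contains_cball by blast
  have cZ0: "continuous_on {0..1} (Z (x0, y0))"
  proof -
    have "continuous_on {0..1} (\<lambda>t. ((x0, y0), t))" by (intro continuous_intros)
    from continuous_on_compose2[OF cZ this] in_W show ?thesis by auto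
  qed
  have "\<exists>m>0. \<forall>t\<in>{0..1}. m \<le> cmod (Z (x0, y0) t)"
  proof -
    have "continuous_on {0..1} (\<lambda>t. cmod (Z (x0, y0) t))" by (intro continuous_intros cZ0)
    from continuous_attains_inf[OF _ _ this]
    obtain u where "u \<in> {0..1}" "\<forall>t\<in>{0..1}. cmod (Z (x0, y0) u) \<le> cmod (Z (x0, y0) t)" by auto
    then show ?thesis using Znz[OF in_W] by (intro exI[of _ "cmod (Z (x0, y0) u)"]) auto
  qed
  then obtain m where m: "m > 0" "\<And>t. t \<in> {0..1} \<Longrightarrow> m \<le> cmod (Z (x0, y0) t)" by blast
  have "uniformly_continuous_on (cball (x0, y0) e \<times> {0..1}) (\<lambda>(w, t). Z w t)"
    by (rule compact_uniformly_continuous)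
       (use e in \<open>auto intro!: continuous_on_subset[OF cZ] compact_Times\<close>)
  then obtain d where d: "d > 0" "\<And>p p'. p \<in> cball (x0, y0) e \<times> {0..1} \<Longrightarrow> p' \<in> cball (x0, y0) e \<times> {0..1} \<Longrightarrow>
      dist p' p < d \<Longrightarrow> dist (case p' of (w, t) \<Rightarrow> Z w t) (case p of (w, t) \<Rightarrow> Z w t) < m"
    unfolding uniformly_continuous_on_def using m(1) by meson
  define V where "V = ball (x0, y0) (min d e)"
  have VW: "V \<subseteq> W" using e by (auto simp: V_def)
  have close: "cmod (Z w t - Z (x0, y0) t) < m" if "w \<in> V" "t \<in> {0..1}" for w t
    using d(2)[of "((x0, y0), t)" "(w, t)"] that e(1)
    by (auto simp: V_def dist_norm norm_minus_commute norm_Pair)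
  define R where "R = (\<lambda>w t. Z w t / Z (x0, y0) t)"
  have R: "Re (R w t) > 0" if "w \<in> V" "t \<in> {0..1}" for w t
  proof -
    have nz: "Z (x0, y0) t \<noteq> 0" using Znz in_W that by blast
    have "cmod (R w t - 1) = cmod (Z w t - Z (x0, y0) t) / cmod (Z (x0, y0) t)"
      unfolding R_def norm_divide[symmetric] using nz by (simp add: diff_divide_distrib)
    also have "\<dots> < 1" using close[OF that] m(2)[OF that(2)] nz by (simp add: divide_less_eq)
    finally have "\<bar>Re (R w t - 1)\<bar> < 1" using abs_Re_le_cmod[of "R w t - 1"] by linarith
    then show ?thesis by simp
  qed
  have pZ0: "path (Z (x0, y0))" using cZ0 by (simp add: path_def)
  have nZ0: "0 \<notin> path_image (Z (x0, y0))" using Znz[OF in_W] by (auto simp: path_image_def)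
  obtain q0 where q0: "path q0" "\<And>t. t \<in> {0..1} \<Longrightarrow> Z (x0, y0) t = 0 + exp (q0 t)"
    using winding_number_as_continuous_log[OF pZ0 nZ0] by metis
  define \<phi>\<^sub>0 where "\<phi>\<^sub>0 = Im (q0 1 - q0 0)"
  have c0: "cfun F x > 0" if "(x, y) \<in> W" for x y using fr[OF that] by (simp add: frame_at_def)
  have z0: "frame_coord F x0 y0 = of_real (cfun F x0 * exp (Re (q0 1 - q0 0))) * cis \<phi>\<^sub>0"
  proof -
    have "frame_coord F x0 y0 = exp (q0 0) * exp (q0 1 - q0 0)"
      using q0(2)[of 1] Z1[OF in_W] by (simp add: exp_add[symmetric])
    also have "exp (q0 0) = of_real (cfun F x0)" using q0(2)[of 0] Z0[OF in_W] by simp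
    also have "exp (q0 1 - q0 0) = of_real (exp (Re (q0 1 - q0 0))) * cis \<phi>\<^sub>0"
      unfolding \<phi>\<^sub>0_def by (rule exp_eq_polar)
    finally show ?thesis by simp
  qed
  define k where "k = cfun F x0 * exp (Re (q0 1 - q0 0))"
  have k: "k > 0" using c0[OF in_W] by (simp add: k_def)
  have R1: "frame_coord F x y * cis (- \<phi>\<^sub>0) = of_real k * R (x, y) 1" if "(x, y) \<in> V" for x y
  proof -
    have "R (x, y) 1 = frame_coord F x y / (of_real k * cis \<phi>\<^sub>0)"
      using that VW by (auto simp: R_def Z1 in_W z0 k_def)
    also have "\<dots> = of_real (1 / k) * (frame_coord F x y * cis (- \<phi>\<^sub>0))" using div_polar[OF refl k] .
    finally show ?thesis using k by simp
  qed
  show ?thesis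
  proof (rule that[of V \<phi>\<^sub>0])
    show "open V" "(x0, y0) \<in> V" "V \<subseteq> W" using VW d(1) e(1) by (auto simp: V_def)
    fix x y assume xy: "(x, y) \<in> V"
    then have xyW: "(x, y) \<in> W" using VW by blast
    show "Re (frame_coord F x y * cis (- \<phi>\<^sub>0)) > 0" unfolding R1[OF xy] using R[OF xy, of 1] k by simp
    fix g' :: "real^2 \<Rightarrow> real" assume g': "\<bar>g' x\<bar> < 2"
    define p where "p = frame_coord F x \<circ> \<gamma> x y"
    have pp: "path p" "0 \<notin> path_image p"
      using homotopic_paths_imp_path[OF hz[OF xyW]] homotopic_paths_imp_subset[OF hz[OF xyW]]
      by (auto simp: p_def)
    obtain q where q: "path q" "\<And>t. t \<in> {0..1} \<Longrightarrow> p t = 0 + exp (q t)"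
      using winding_number_as_continuous_log[OF pp] by metis
    define qH where "qH = (\<lambda>t. q0 t + Ln (R (x, y) t))"
    have qH: "continuous_on {0..1} qH"
    proof -
      have "continuous_on {0..1} (\<lambda>t. ((x, y), t))" by (intro continuous_intros)
      from continuous_on_compose2[OF cZ this] xyW have "continuous_on {0..1} (Z (x, y))" by auto
      then show ?thesis
        unfolding qH_def R_def
        by (intro continuous_intros cZ0 q0(1)[unfolded path_def])
           (use R[OF xy] Znz[OF in_W] in \<open>auto simp: R_def complex_nonpos_Reals_iff not_le\<close>)
    qed
    have qHe: "(frame_coord F x \<circ> H x y) t = exp (qH t)" if "t \<in> {0..1}" for t
    proof -
      have "R (x, y) t \<noteq> 0" using R[OF xy that] by auto
      then show ?thesis
        unfolding qH_def exp_add Zeq[symmetric] using q0(2)[OF that] Znz[OF in_W that]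
        by (simp add: R_def)
    qed
    have incr: "q 1 - q 0 = qH 1 - qH 0"
      by (rule log_increment_homotopic[OF hz[OF xyW]])
         (use q qH qHe in \<open>auto simp: path_def p_def\<close>)
    have "Im (Ln (R (x, y) 0)) = 0"
    proof -
      have "R (x, y) 0 = of_real (cfun F x / cfun F x0)"
        using xyW in_W by (simp add: R_def Z0)
      then show ?thesis using c0[OF xyW] c0[OF in_W] by (simp add: Ln_of_real del: of_real_divide)
    qed
    moreover have "Im (Ln (R (x, y) 1)) = Im (Ln (frame_coord F x y * cis (- \<phi>\<^sub>0)))"
    proof -
      have "R (x, y) 1 \<noteq> 0" using R[OF xy, of 1] by auto
      then show ?thesis unfolding R1[OF xy] using k by (simp add: Ln_times_of_real)
    qed
    ultimately have lifted_arg: "Im (q 1 - q 0) = lifted_arg \<phi>\<^sub>0 (frame_coord F x y)"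
      unfolding incr by (simp add: qH_def lifted_arg_def \<phi>\<^sub>0_def)
    have p0: "p 0 = of_real (cfun F x)"
      using \<gamma>[OF xyW] frame_coord_bup[OF fr[OF xyW]] by (simp add: p_def pathstart_def)
    \<comment> \<open>the logarithm that is real at the initial point, i.e. starts with the angle \<open>0\<close>\<close>
    define q' where "q' = (\<lambda>t. q t - q 0 + of_real (ln (cfun F x)))"
    have "integral {0..1} (\<lambda>t. (mlow (F\<lparr>gfun := g'\<rparr>) x (\<gamma> x y t) /\<^sub>R Kval (F\<lparr>gfun := g'\<rparr>) x (\<gamma> x y t))
          \<bullet> vector_derivative (\<gamma> x y) (at t within {0..1}))
        = Psi (cfun (F\<lparr>gfun := g'\<rparr>) x) (gfun (F\<lparr>gfun := g'\<rparr>) x) (Im (q' 1))"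
    proof (rule theta_integral_log)
      show "frame_at (F\<lparr>gfun := g'\<rparr>) x" by (rule frame_at_gfun_update[where g'=g', OF fr[OF xyW] g'])
      show "continuous_on {0..1} q'" unfolding q'_def using q(1) by (intro continuous_intros) (simp add: path_def)
      show "frame_coord (F\<lparr>gfun := g'\<rparr>) x (\<gamma> x y t) = exp (q' t)" if "t \<in> {0..1}" for t
      proof -
        have "exp (q' t) = exp (q t) / exp (q 0) * of_real (cfun F x)"
          using c0[OF xyW] by (simp add: q'_def exp_add exp_diff exp_of_real)
        then show ?thesis using q(2)[OF that] q(2)[of 0] p0 c0[OF xyW] by (simp add: p_def)
      qed
    qed (use \<gamma>[OF xyW] in \<open>auto simp: q'_def\<close>)
    moreover have "Im (q' 1) = lifted_arg \<phi>\<^sub>0 (frame_coord F x y)" using lifted_arg by (simp add: q'_def)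
    ultimately show "theta \<gamma> (F\<lparr>gfun := g'\<rparr>) x y = Psi (cfun F x) (g' x) (lifted_arg \<phi>\<^sub>0 (frame_coord F x y))"
      by (simp add: theta_def)
  qed
qed

section \<open>Derivatives along the fibre\<close>

lemma pd_eqI: "((\<lambda>t. f (x + t *\<^sub>R axis i 1)) has_real_derivative D) (at 0) \<Longrightarrow> pd i f x = D"
  unfolding pd_def by (rule DERIV_imp_deriv)

lemma line_eventually_in:
  fixes x :: "real^2"
  assumes "open U" "x \<in> U" shows "\<forall>\<^sub>F t in nhds 0. x + t *\<^sub>R v \<in> U"
proof -
  have "((\<lambda>t. x + t *\<^sub>R v) \<longlongrightarrow> x + 0 *\<^sub>R v) (nhds 0)" by (intro tendsto_intros filterlim_ident)
  from topological_tendstoD[OF this assms(1)] assms(2) show ?thesis by simp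
qed

lemma pd_cong:
  assumes "open U" "x \<in> U" "\<And>x. x \<in> U \<Longrightarrow> f x = g x"
  shows "pd i f x = pd i g x"
  unfolding pd_def
  by (rule deriv_cong_ev[OF eventually_mono[OF line_eventually_in[OF assms(1,2)]] refl]) (rule assms(3))

lemma smooth_on_DERIV_line:
  assumes "smooth_on X f" "open X" "x \<in> X"
  shows "((\<lambda>t. f (x + t *\<^sub>R axis i 1)) has_real_derivative pd i f x) (at 0)"
proof -
  have "Ck_on (Suc 0) X f" using assms(1) unfolding smooth_on_def by blast
  then have "f differentiable_on X" by simp
  then have "f differentiable (at x)"
    using differentiable_on_eq_differentiable_at[OF assms(2)] assms(3) by blast
  then obtain f' where f': "(f has_derivative f') (at x)" by (auto simp: differentiable_def)
  have "((\<lambda>t. x + t *\<^sub>R axis i 1) has_derivative (\<lambda>t. t *\<^sub>R axis i 1)) (at (0::real))"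
    by (auto intro!: derivative_eq_intros)
  then have "((\<lambda>t. f (x + t *\<^sub>R axis i 1)) has_derivative (\<lambda>t. f' (t *\<^sub>R axis i 1))) (at 0)"
    by (rule has_derivative_compose) (use f' in simp)
  then have "((\<lambda>t. f (x + t *\<^sub>R axis i 1)) has_derivative (\<lambda>t. f' (axis i 1) * t)) (at 0)"
    using linear_scale[OF has_derivative_linear[OF f']] by (simp add: mult.commute)
  then have "((\<lambda>t. f (x + t *\<^sub>R axis i 1)) has_real_derivative f' (axis i 1)) (at 0)"
    by (simp add: has_field_derivative_def)
  then show ?thesis using pd_eqI by metis
qed

definition sector :: "finsleroid \<Rightarrow> real^2 \<Rightarrow> real \<Rightarrow> (real^2) set" where
  "sector F x \<phi>\<^sub>0 = {y. Re (frame_coord F x y * cis (- \<phi>\<^sub>0)) > 0}"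

lemma open_sector: "open (sector F x \<phi>\<^sub>0)"
  unfolding sector_def
  by (intro open_Collect_less continuous_intros linear_continuous_on bounded_linear_frame_coord)

lemma sector_polar:
  assumes "y \<in> sector F x \<phi>\<^sub>0"
  shows "frame_coord F x y = of_real (cmod (frame_coord F x y)) * cis (lifted_arg \<phi>\<^sub>0 (frame_coord F x y))" "cmod (frame_coord F x y) > 0"
proof -
  have "frame_coord F x y \<noteq> 0" using assms by (auto simp: sector_def)
  then show "frame_coord F x y = of_real (cmod (frame_coord F x y)) * cis (lifted_arg \<phi>\<^sub>0 (frame_coord F x y))" "cmod (frame_coord F x y) > 0"
    using lifted_arg_polar by auto
qed

lemma DERIV_polar_line:
  assumes y: "y \<in> sector F x \<phi>\<^sub>0"
  shows "((\<lambda>t. cmod (frame_coord F x (y + t *\<^sub>R v))) has_real_derivative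
            ecov F x (lifted_arg \<phi>\<^sub>0 (frame_coord F x y)) \<bullet> v) (at 0)"
    and "((\<lambda>t. lifted_arg \<phi>\<^sub>0 (frame_coord F x (y + t *\<^sub>R v))) has_real_derivative
            (ecov' F x (lifted_arg \<phi>\<^sub>0 (frame_coord F x y)) \<bullet> v) / cmod (frame_coord F x y)) (at 0)"
proof -
  note pol = sector_polar[OF y]
  have z: "((\<lambda>t. frame_coord F x (y + t *\<^sub>R v)) has_vector_derivative frame_coord F x v) (at 0)"
    by (rule bounded_linear.has_vector_derivative[OF bounded_linear_frame_coord])
       (auto intro!: derivative_eq_intros)
  have s: "Re (frame_coord F x (y + 0 *\<^sub>R v) * cis (- \<phi>\<^sub>0)) > 0" using y by (simp add: sector_def)
  show "((\<lambda>t. cmod (frame_coord F x (y + t *\<^sub>R v))) has_real_derivative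
            ecov F x (lifted_arg \<phi>\<^sub>0 (frame_coord F x y)) \<bullet> v) (at 0)"
    using DERIV_cmod[OF z s] Re_div_polar[OF pol, of F x v] pol(2) by simp
  show "((\<lambda>t. lifted_arg \<phi>\<^sub>0 (frame_coord F x (y + t *\<^sub>R v))) has_real_derivative
            (ecov' F x (lifted_arg \<phi>\<^sub>0 (frame_coord F x y)) \<bullet> v) / cmod (frame_coord F x y)) (at 0)"
    using DERIV_lifted_arg[OF z s] Im_div_polar[OF pol, of F x v] by simp
qed

lemma pd_angular:
  assumes y: "y \<in> sector F x \<phi>\<^sub>0" and w: "(w has_real_derivative w') (at (lifted_arg \<phi>\<^sub>0 (frame_coord F x y)))"
  shows "pd i (\<lambda>y. w (lifted_arg \<phi>\<^sub>0 (frame_coord F x y))) y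
           = w' * ecov' F x (lifted_arg \<phi>\<^sub>0 (frame_coord F x y)) $ i / cmod (frame_coord F x y)"
proof -
  have w: "(w has_real_derivative w') (at (lifted_arg \<phi>\<^sub>0 (frame_coord F x (y + 0 *\<^sub>R axis i 1))))" using w by simp
  show ?thesis
    using DERIV_chain2[OF w DERIV_polar_line(2)[OF y]]
    by (intro pd_eqI) (simp add: inner_axis)
qed

lemma pd_radial:
  assumes y: "y \<in> sector F x \<phi>\<^sub>0" and w: "(w has_real_derivative w') (at (lifted_arg \<phi>\<^sub>0 (frame_coord F x y)))"
  shows "pd i (\<lambda>y. cmod (frame_coord F x y) * w (lifted_arg \<phi>\<^sub>0 (frame_coord F x y))) y
           = ecov F x (lifted_arg \<phi>\<^sub>0 (frame_coord F x y)) $ i * w (lifted_arg \<phi>\<^sub>0 (frame_coord F x y))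
             + ecov' F x (lifted_arg \<phi>\<^sub>0 (frame_coord F x y)) $ i * w'"
proof -
  have w: "(w has_real_derivative w') (at (lifted_arg \<phi>\<^sub>0 (frame_coord F x (y + 0 *\<^sub>R axis i 1))))" using w by simp
  show ?thesis
    using DERIV_mult[OF DERIV_polar_line(1)[OF y, of "axis i 1"] DERIV_chain2[OF w DERIV_polar_line(2)[OF y]]] sector_polar(2)[OF y]
    by (intro pd_eqI) (simp add: inner_axis algebra_simps)
qed

lemma DERIV_ecov: "((\<lambda>\<phi>. ecov F x \<phi> $ i) has_real_derivative ecov' F x \<phi> $ i) (at \<phi>)"
  and DERIV_ecov': "((\<lambda>\<phi>. ecov' F x \<phi> $ i) has_real_derivative - ecov F x \<phi> $ i) (at \<phi>)"
proof -
  have eq: "ecov F x = (\<lambda>\<phi>. cos \<phi> *\<^sub>R btil F x + sin \<phi> *\<^sub>R ncov F x)"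
    "ecov' F x = (\<lambda>\<phi>. cos \<phi> *\<^sub>R ncov F x - sin \<phi> *\<^sub>R btil F x)"
    by (auto simp: ecov_def ecov'_def)
  show "((\<lambda>\<phi>. ecov F x \<phi> $ i) has_real_derivative ecov' F x \<phi> $ i) (at \<phi>)"
    "((\<lambda>\<phi>. ecov' F x \<phi> $ i) has_real_derivative - ecov F x \<phi> $ i) (at \<phi>)"
    unfolding eq vector_add_component vector_minus_component vector_scaleR_component
    by (rule derivative_eq_intros refl | simp)+
qed

lemma DERIV_eup: "((\<lambda>\<phi>. eup F x \<phi> $ i) has_real_derivative eup' F x \<phi> $ i) (at \<phi>)"
  and DERIV_eup': "((\<lambda>\<phi>. eup' F x \<phi> $ i) has_real_derivative - eup F x \<phi> $ i) (at \<phi>)"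
proof -
  have eq: "eup F x = (\<lambda>\<phi>. cos \<phi> *\<^sub>R btup F x + sin \<phi> *\<^sub>R nup F x)"
    "eup' F x = (\<lambda>\<phi>. cos \<phi> *\<^sub>R nup F x - sin \<phi> *\<^sub>R btup F x)"
    by (auto simp: eup_def eup'_def)
  show "((\<lambda>\<phi>. eup F x \<phi> $ i) has_real_derivative eup' F x \<phi> $ i) (at \<phi>)"
    "((\<lambda>\<phi>. eup' F x \<phi> $ i) has_real_derivative - eup F x \<phi> $ i) (at \<phi>)"
    unfolding eq vector_add_component vector_minus_component vector_scaleR_component
    by (rule derivative_eq_intros refl | simp)+
qed

text \<open>
  A function \<open>r w(\<phi>)\<close> has the differential \<open>w e + w' e'\<close>. Both covectors turn with \<open>\<phi>\<close>, and in the next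
  derivative the terms with \<open>w'\<close> cancel. Functions linear in \<open>y\<close> are those with \<open>w'' = - w\<close>.
\<close>

lemma pd_pd_radial:
  assumes U: "open U" "y \<in> U" "U \<subseteq> sector F x \<phi>\<^sub>0"
    and f: "\<And>y. y \<in> U \<Longrightarrow> f y = cmod (frame_coord F x y) * w (lifted_arg \<phi>\<^sub>0 (frame_coord F x y))"
    and w: "\<And>\<phi>. (w has_real_derivative w1 \<phi>) (at \<phi>)" "\<And>\<phi>. (w1 has_real_derivative w2 \<phi>) (at \<phi>)"
  shows "pd m (\<lambda>y. pd i f y) y
    = (w (lifted_arg \<phi>\<^sub>0 (frame_coord F x y)) + w2 (lifted_arg \<phi>\<^sub>0 (frame_coord F x y)))
      * (ecov' F x (lifted_arg \<phi>\<^sub>0 (frame_coord F x y)) $ i * ecov' F x (lifted_arg \<phi>\<^sub>0 (frame_coord F x y)) $ m) / cmod (frame_coord F x y)"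
proof -
  have pf: "pd i f y = ecov F x (lifted_arg \<phi>\<^sub>0 (frame_coord F x y)) $ i * w (lifted_arg \<phi>\<^sub>0 (frame_coord F x y))
             + ecov' F x (lifted_arg \<phi>\<^sub>0 (frame_coord F x y)) $ i * w1 (lifted_arg \<phi>\<^sub>0 (frame_coord F x y))" if "y \<in> U" for y
  proof -
    have "pd i f y = pd i (\<lambda>y. cmod (frame_coord F x y) * w (lifted_arg \<phi>\<^sub>0 (frame_coord F x y))) y"
      by (rule pd_cong[OF U(1) that f])
    also have "\<dots> = ecov F x (lifted_arg \<phi>\<^sub>0 (frame_coord F x y)) $ i * w (lifted_arg \<phi>\<^sub>0 (frame_coord F x y))
             + ecov' F x (lifted_arg \<phi>\<^sub>0 (frame_coord F x y)) $ i * w1 (lifted_arg \<phi>\<^sub>0 (frame_coord F x y))"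
      by (rule pd_radial[OF _ w(1)]) (use U(3) that in blast)
    finally show ?thesis .
  qed
  define \<phi> where "\<phi> = lifted_arg \<phi>\<^sub>0 (frame_coord F x y)"
  have ySec: "y \<in> sector F x \<phi>\<^sub>0" using U by blast
  have "((\<lambda>\<phi>. ecov F x \<phi> $ i * w \<phi> + ecov' F x \<phi> $ i * w1 \<phi>) has_real_derivative
      ecov' F x \<phi> $ i * (w \<phi> + w2 \<phi>)) (at \<phi>)"
    using DERIV_add[OF DERIV_mult[OF DERIV_ecov[of F x i \<phi>] w(1)] DERIV_mult[OF DERIV_ecov'[of F x i \<phi>] w(2)]]
    by (simp add: algebra_simps)
  from pd_angular[OF ySec this[unfolded \<phi>_def], of m]
  have "pd m (\<lambda>y. ecov F x (lifted_arg \<phi>\<^sub>0 (frame_coord F x y)) $ i * w (lifted_arg \<phi>\<^sub>0 (frame_coord F x y))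
             + ecov' F x (lifted_arg \<phi>\<^sub>0 (frame_coord F x y)) $ i * w1 (lifted_arg \<phi>\<^sub>0 (frame_coord F x y))) y
     = ecov' F x \<phi> $ i * (w \<phi> + w2 \<phi>) * ecov' F x \<phi> $ m / cmod (frame_coord F x y)"
    unfolding \<phi>_def .
  moreover have "pd m (\<lambda>y. pd i f y) y = pd m (\<lambda>y. ecov F x (lifted_arg \<phi>\<^sub>0 (frame_coord F x y)) $ i * w (lifted_arg \<phi>\<^sub>0 (frame_coord F x y))
             + ecov' F x (lifted_arg \<phi>\<^sub>0 (frame_coord F x y)) $ i * w1 (lifted_arg \<phi>\<^sub>0 (frame_coord F x y))) y"
    by (rule pd_cong[OF U(1,2) pf])
  ultimately show ?thesis unfolding \<phi>_def by (simp add: ac_simps)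
qed

section \<open>The Finsler tensors in polar form\<close>

lemma DERIV_rho:
  assumes "0 < c" "c < 1" "\<bar>s\<bar> < 2"
  shows "((\<lambda>\<phi>. exp (lnrho c s \<phi>)) has_real_derivative exp (lnrho c s \<phi>) * lam c s \<phi>) (at \<phi>)"
  by (rule DERIV_chain2[OF DERIV_exp DERIV_lnrho[OF assms]])

lemma Kval_sector:
  assumes "frame_at F x" "y \<in> sector F x \<phi>\<^sub>0"
  shows "Kval F x y = cmod (frame_coord F x y) * exp (lnrho (cfun F x) (gfun F x) (lifted_arg \<phi>\<^sub>0 (frame_coord F x y)))"
  by (rule Kval_polar[OF assms(1) sector_polar[OF assms(2)]])

lemma pd_Kval:
  assumes fr: "frame_at F x" and y: "y \<in> sector F x \<phi>\<^sub>0"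
  defines "\<phi> \<equiv> lifted_arg \<phi>\<^sub>0 (frame_coord F x y)"
  shows "pd k (Kval F x) y = exp (lnrho (cfun F x) (gfun F x) \<phi>)
           * (ecov F x \<phi> + lam (cfun F x) (gfun F x) \<phi> *\<^sub>R ecov' F x \<phi>) $ k"
proof -
  have cs: "0 < cfun F x" "cfun F x < 1" "\<bar>gfun F x\<bar> < 2" using fr by (auto simp: frame_at_def)
  have "pd k (Kval F x) y = pd k (\<lambda>y. cmod (frame_coord F x y) * exp (lnrho (cfun F x) (gfun F x) (lifted_arg \<phi>\<^sub>0 (frame_coord F x y)))) y"
    by (rule pd_cong[OF open_sector y Kval_sector[OF fr]])
  also have "\<dots> = ecov F x \<phi> $ k * exp (lnrho (cfun F x) (gfun F x) \<phi>)
      + ecov' F x \<phi> $ k * (exp (lnrho (cfun F x) (gfun F x) \<phi>) * lam (cfun F x) (gfun F x) \<phi>)"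
    unfolding \<phi>_def by (rule pd_radial[OF y DERIV_rho[OF cs]])
  finally show ?thesis by (simp add: algebra_simps)
qed

lemma ylow_polar:
  assumes fr: "frame_at F x" and y: "y \<in> sector F x \<phi>\<^sub>0"
  defines "\<phi> \<equiv> lifted_arg \<phi>\<^sub>0 (frame_coord F x y)" and "c \<equiv> cfun F x" and "s \<equiv> gfun F x"
  shows "ylow F x y $ k = cmod (frame_coord F x y) * ((exp (lnrho c s \<phi>))\<^sup>2 * (ecov F x \<phi> $ k + lam c s \<phi> * ecov' F x \<phi> $ k))"
  unfolding ylow_def \<phi>_def c_def s_def
  by (simp add: Kval_sector[OF fr y] pd_Kval[OF fr y] power2_eq_square)

text \<open>
  This is \<open>g\<^sub>k\<^sub>j = l\<^sub>k l\<^sub>j + m\<^sub>k m\<^sub>j\<close>; the coefficient of \<open>e'\<^sub>k e'\<^sub>j\<close> simplifies by the Riccati equation.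
\<close>

lemma gten_polar:
  assumes fr: "frame_at F x" and y: "y \<in> sector F x \<phi>\<^sub>0"
  defines "\<phi> \<equiv> lifted_arg \<phi>\<^sub>0 (frame_coord F x y)" and "c \<equiv> cfun F x" and "s \<equiv> gfun F x"
  shows "gten F x y $ k $ j = (exp (lnrho c s \<phi>))\<^sup>2 *
     ((ecov F x \<phi> $ k + lam c s \<phi> * ecov' F x \<phi> $ k) * (ecov F x \<phi> $ j + lam c s \<phi> * ecov' F x \<phi> $ j)
      + (Phi c s \<phi>)\<^sup>2 * ecov' F x \<phi> $ k * ecov' F x \<phi> $ j)"
proof -
  have cs: "0 < c" "c < 1" "\<bar>s\<bar> < 2" using fr by (auto simp: frame_at_def c_def s_def)
  define W where "W = (\<lambda>\<phi>. (exp (lnrho c s \<phi>))\<^sup>2 * (ecov F x \<phi> $ k + lam c s \<phi> * ecov' F x \<phi> $ k))"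
  define W' where "W' = 2 * exp (lnrho c s \<phi>) * (exp (lnrho c s \<phi>) * lam c s \<phi>) * (ecov F x \<phi> $ k + lam c s \<phi> * ecov' F x \<phi> $ k)
     + (exp (lnrho c s \<phi>))\<^sup>2 * (ecov' F x \<phi> $ k + (((Phi c s \<phi>)\<^sup>2 - 1 - (lam c s \<phi>)\<^sup>2) * ecov' F x \<phi> $ k - lam c s \<phi> * ecov F x \<phi> $ k))"
  have dW: "(W has_real_derivative W') (at \<phi>)"
    unfolding W_def W'_def
    by (auto intro!: derivative_eq_intros DERIV_ecov DERIV_ecov' DERIV_lnrho DERIV_lam cs
      simp: algebra_simps)
  have "gten F x y $ k $ j = pd j (\<lambda>y. ylow F x y $ k) y" by (simp add: gten_def)
  also have "\<dots> = pd j (\<lambda>y. cmod (frame_coord F x y) * W (lifted_arg \<phi>\<^sub>0 (frame_coord F x y))) y"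
    unfolding W_def c_def s_def by (rule pd_cong[OF open_sector y ylow_polar[OF fr]])
  also have "\<dots> = ecov F x \<phi> $ j * W \<phi> + ecov' F x \<phi> $ j * W'"
    unfolding \<phi>_def by (rule pd_radial[OF y dW[unfolded \<phi>_def]])
  also have "\<dots> = (exp (lnrho c s \<phi>))\<^sup>2 *
     ((ecov F x \<phi> $ k + lam c s \<phi> * ecov' F x \<phi> $ k) * (ecov F x \<phi> $ j + lam c s \<phi> * ecov' F x \<phi> $ j)
      + (Phi c s \<phi>)\<^sup>2 * ecov' F x \<phi> $ k * ecov' F x \<phi> $ j)"
    unfolding W_def W'_def by (simp add: algebra_simps power2_eq_square)
  finally show ?thesis .
qed

text \<open>
  The vector on the right is annihilated by \<open>l\<^sub>k\<close> and has pairing \<open>K\<close> with \<open>m\<^sub>k\<close>; as \<open>g\<^sub>i\<^sub>j = l\<^sub>i l\<^sub>j + m\<^sub>i m\<^sub>j\<close> is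
  positive definite, this determines it.
\<close>

lemma Kval_mup_polar:
  assumes fr: "frame_at F x" and y: "y \<in> sector F x \<phi>\<^sub>0"
  defines "\<phi> \<equiv> lifted_arg \<phi>\<^sub>0 (frame_coord F x y)" and "c \<equiv> cfun F x" and "s \<equiv> gfun F x"
  shows "Kval F x y *\<^sub>R mup F x y
    = (cmod (frame_coord F x y) / Phi c s \<phi>) *\<^sub>R (eup' F x \<phi> - lam c s \<phi> *\<^sub>R eup F x \<phi>)"
proof -
  have cs: "0 < c" "c < 1" "\<bar>s\<bar> < 2" using fr by (auto simp: frame_at_def c_def s_def)
  define \<rho> where "\<rho> = exp (lnrho c s \<phi>)"
  define P where "P = Phi c s \<phi>"
  have P: "P > 0" using Phi_pos[OF cs] by (simp add: P_def)
  have \<rho>: "\<rho> > 0" by (simp add: \<rho>_def)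
  define lc where "lc = ecov F x \<phi> + lam c s \<phi> *\<^sub>R ecov' F x \<phi>"
  define V where "V = (1 / (\<rho> * P)) *\<^sub>R (eup' F x \<phi> - lam c s \<phi> *\<^sub>R eup F x \<phi>)"
  have g: "gten F x y *v v = \<rho>\<^sup>2 *\<^sub>R ((lc \<bullet> v) *\<^sub>R lc + (P\<^sup>2 * (ecov' F x \<phi> \<bullet> v)) *\<^sub>R ecov' F x \<phi>)" for v
    unfolding vec_eq_iff matrix_vector_mult_def
    by (simp add: gten_polar[OF fr y, folded \<phi>_def c_def s_def] \<rho>_def P_def lc_def inner_vec_def sum_2 algebra_simps)
  have lV: "lc \<bullet> V = 0" "ecov' F x \<phi> \<bullet> V = 1 / (\<rho> * P)"
    by (simp_all add: V_def lc_def inner_add_left inner_diff_right e_dual[OF fr])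
  have "gten F x y *v V = (\<rho> * P) *\<^sub>R ecov' F x \<phi>"
    unfolding g lV using P \<rho> by (simp add: power2_eq_square)
  also have "\<dots> = mlow F x y"
    using mlow_polar[OF fr sector_polar[OF y]] by (simp add: \<rho>_def P_def c_def s_def \<phi>_def)
  finally have gV: "gten F x y *v V = mlow F x y" .
  have "v = 0" if "gten F x y *v v = 0" for v
  proof -
    have "v \<bullet> (gten F x y *v v) = 0" using that by simp
    then have "\<rho>\<^sup>2 * ((lc \<bullet> v)\<^sup>2 + (P * (ecov' F x \<phi> \<bullet> v))\<^sup>2) = 0"
      unfolding g by (simp add: inner_add_right inner_commute power2_eq_square algebra_simps)
    then have "lc \<bullet> v = 0" "ecov' F x \<phi> \<bullet> v = 0" using P \<rho> by (auto simp: sum_power2_eq_zero_iff)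
    then have "ecov F x \<phi> \<bullet> v = 0" "ecov' F x \<phi> \<bullet> v = 0" by (auto simp: lc_def inner_add_left)
    then show "v = 0" using e_decomp[OF fr, of v \<phi>] by simp
  qed
  then have "invertible (gten F x y)"
    by (simp add: invertible_left_inverse matrix_left_invertible_ker)
  then have "mup F x y = V"
    unfolding mup_def gV[symmetric] by (simp add: matrix_vector_mul_assoc matrix_mult_matrix_inv)
  then show ?thesis
    using P \<rho> by (simp add: V_def Kval_sector[OF fr y, folded \<phi>_def c_def s_def] \<rho>_def[symmetric] P_def)
qed

section \<open>Covariant derivatives of the frame\<close>

definition gamvec :: "finsleroid \<Rightarrow> real^2 \<Rightarrow> 2 \<Rightarrow> real^2 \<Rightarrow> real^2" where
  "gamvec F x n y = (\<chi> k. \<Sum>j\<in>UNIV. christoffel F x k n j * y $ j)"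

lemma metric_components:
  assumes "frame_at F x"
  shows "metric F x $ i $ j = btil F x $ i * btil F x $ j + ncov F x $ i * ncov F x $ j"
proof -
  have "metric F x $ i $ j = (metric F x *v axis j 1) $ i"
    by (simp add: matrix_vector_mult_basis column_def)
  also have "\<dots> = btil F x $ i * btil F x $ j + ncov F x $ i * ncov F x $ j"
    unfolding frame_metric[OF assms] by (simp add: inner_axis mult.commute)
  finally show ?thesis .
qed

lemma covector_decomp:
  assumes "frame_at F x"
  shows "w = (w \<bullet> btup F x) *\<^sub>R btil F x + (w \<bullet> nup F x) *\<^sub>R ncov F x"
proof -
  have "w \<bullet> y = ((w \<bullet> btup F x) *\<^sub>R btil F x + (w \<bullet> nup F x) *\<^sub>R ncov F x) \<bullet> y" for y
    by (subst (1) frame_decomp[OF assms, of y]) (simp add: inner_add_left inner_add_right mult.commute)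
  then show ?thesis by (metis vector_eq_rdot)
qed

context
  fixes F :: finsleroid and X :: "(real^2) set" and x :: "real^2"
  assumes fin: "finsleroid_on X F" and x: "x \<in> X"
begin

lemma DERIV_frame_line:
  "((\<lambda>t. btil F (x + t *\<^sub>R axis n 1) $ h) has_real_derivative pd n (\<lambda>x. btil F x $ h) x) (at 0)"
  "((\<lambda>t. ncov F (x + t *\<^sub>R axis n 1) $ h) has_real_derivative pd n (\<lambda>x. ncov F x $ h) x) (at 0)"
  "((\<lambda>t. gfun F (x + t *\<^sub>R axis n 1)) has_real_derivative pd n (gfun F) x) (at 0)"
  using fin x by (auto simp: finsleroid_on_def intro!: smooth_on_DERIV_line)

lemma frame_at_x: "frame_at F x" by (rule finsleroid_on_frame[OF fin x])

lemma pd_metric: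
  "pd n (\<lambda>x. metric F x $ i $ j) x
    = pd n (\<lambda>x. btil F x $ i) x * btil F x $ j + btil F x $ i * pd n (\<lambda>x. btil F x $ j) x
      + (pd n (\<lambda>x. ncov F x $ i) x * ncov F x $ j + ncov F x $ i * pd n (\<lambda>x. ncov F x $ j) x)"
proof -
  have X: "open X" using fin by (simp add: finsleroid_on_def)
  have "pd n (\<lambda>x. metric F x $ i $ j) x
      = pd n (\<lambda>x. btil F x $ i * btil F x $ j + ncov F x $ i * ncov F x $ j) x"
    by (rule pd_cong[OF X x metric_components[OF finsleroid_on_frame[OF fin]]])
  also have "\<dots> = pd n (\<lambda>x. btil F x $ i) x * btil F x $ j + btil F x $ i * pd n (\<lambda>x. btil F x $ j) x
      + (pd n (\<lambda>x. ncov F x $ i) x * ncov F x $ j + ncov F x $ i * pd n (\<lambda>x. ncov F x $ j) x)"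
    using DERIV_add[OF DERIV_mult[OF DERIV_frame_line(1)[of n i] DERIV_frame_line(1)[of n j]]
        DERIV_mult[OF DERIV_frame_line(2)[of n i] DERIV_frame_line(2)[of n j]]]
    by (intro pd_eqI) (simp add: ac_simps)
  finally show ?thesis .
qed

lemma lowered_christoffel:
  "btil F x $ i * (\<Sum>k\<in>UNIV. christoffel F x k n j * btil F x $ k)
     + ncov F x $ i * (\<Sum>k\<in>UNIV. christoffel F x k n j * ncov F x $ k)
   = (pd n (\<lambda>x. metric F x $ i $ j) x + pd j (\<lambda>x. metric F x $ i $ n) x - pd i (\<lambda>x. metric F x $ n $ j) x) / 2"
proof -
  define T where "T = (\<lambda>l. pd n (\<lambda>x. metric F x $ l $ j) x + pd j (\<lambda>x. metric F x $ l $ n) x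
         - pd l (\<lambda>x. metric F x $ n $ j) x)"
  have ch: "christoffel F x k n j = (matrix_inv (metric F x) *v (\<chi> l. T l / 2)) $ k" for k
    by (simp add: christoffel_def T_def matrix_vector_mult_def sum_divide_distrib)
  have "(metric F x *v (matrix_inv (metric F x) *v (\<chi> l. T l / 2))) $ i = T i / 2"
    by (simp add: matrix_vector_mul_assoc metric_inverse[OF frame_at_x])
  moreover have "(metric F x *v (matrix_inv (metric F x) *v (\<chi> l. T l / 2))) $ i
     = btil F x $ i * (\<Sum>k\<in>UNIV. christoffel F x k n j * btil F x $ k)
     + ncov F x $ i * (\<Sum>k\<in>UNIV. christoffel F x k n j * ncov F x $ k)"
    unfolding ch frame_metric[OF frame_at_x] by (simp add: inner_vec_def mult.commute)
  ultimately show ?thesis by (simp add: T_def)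
qed

text \<open>
  Writing \<open>\<nabla>a = 0\<close> with \<open>a = b-tilde b-tilde + n n\<close> shows that the derivative of an orthonormal coframe is
  skew: it is a rotation, and \<open>p\<^sub>n / c\<close> is its only component.
\<close>

lemma nabla_frame:
  "nabla F (btil F) x n h = pcov F x n / cfun F x * ncov F x $ h"
  "nabla F (ncov F) x n h = - (pcov F x n / cfun F x) * btil F x $ h"
proof -
  define D E where "D = (\<chi> h. nabla F (btil F) x n h)" and "E = (\<chi> h. nabla F (ncov F) x n h)"
  have sym: "pd l (\<lambda>x. metric F x $ i $ j) x = pd l (\<lambda>x. metric F x $ j $ i) x" for i j l
    unfolding pd_metric by (simp add: algebra_simps)
  have comp: "D $ i * btil F x $ j + btil F x $ i * D $ j + E $ i * ncov F x $ j + ncov F x $ i * E $ j = 0" for i j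
  proof -
    have "btil F x $ i * (\<Sum>k\<in>UNIV. christoffel F x k n j * btil F x $ k)
       + ncov F x $ i * (\<Sum>k\<in>UNIV. christoffel F x k n j * ncov F x $ k)
       + (btil F x $ j * (\<Sum>k\<in>UNIV. christoffel F x k n i * btil F x $ k)
       + ncov F x $ j * (\<Sum>k\<in>UNIV. christoffel F x k n i * ncov F x $ k))
      = pd n (\<lambda>x. metric F x $ i $ j) x"
      unfolding lowered_christoffel sym[of n j i] sym[of i j n] sym[of j i n] by (simp add: field_simps)
    then show ?thesis unfolding pd_metric by (simp add: D_def E_def nabla_def algebra_simps)
  qed
  have con: "(D \<bullet> v) * (btil F x \<bullet> w) + (btil F x \<bullet> v) * (D \<bullet> w)
       + (E \<bullet> v) * (ncov F x \<bullet> w) + (ncov F x \<bullet> v) * (E \<bullet> w) = 0" for v w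
  proof -
    have "(D \<bullet> v) * (btil F x \<bullet> w) + (btil F x \<bullet> v) * (D \<bullet> w)
       + (E \<bullet> v) * (ncov F x \<bullet> w) + (ncov F x \<bullet> v) * (E \<bullet> w)
      = (\<Sum>i\<in>UNIV. \<Sum>j\<in>UNIV. v $ i * w $ j *
          (D $ i * btil F x $ j + btil F x $ i * D $ j + E $ i * ncov F x $ j + ncov F x $ i * E $ j))"
      by (simp add: inner_vec_def sum_2 algebra_simps)
    then show ?thesis by (simp add: comp)
  qed
  note d = frame_dual[OF frame_at_x]
  have c: "cfun F x \<noteq> 0" using frame_at_x by (simp add: frame_at_def)
  have p: "D \<bullet> nup F x = pcov F x n / cfun F x"
    using c by (simp add: pcov_def D_def inner_vec_def mult.commute)
  have e1: "D \<bullet> btup F x = 0" using con[of "btup F x" "btup F x"] by (simp add: d)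
  have e2: "E \<bullet> nup F x = 0" using con[of "nup F x" "nup F x"] by (simp add: d)
  have e3: "E \<bullet> btup F x = - (pcov F x n / cfun F x)"
    using con[of "btup F x" "nup F x"] unfolding d p by simp
  have "D = (pcov F x n / cfun F x) *\<^sub>R ncov F x"
    using covector_decomp[OF frame_at_x, of D] by (simp add: e1 p)
  moreover have "E = (- (pcov F x n / cfun F x)) *\<^sub>R btil F x"
    using covector_decomp[OF frame_at_x, of E] by (simp add: e2 e3)
  ultimately show "nabla F (btil F) x n h = pcov F x n / cfun F x * ncov F x $ h"
    "nabla F (ncov F) x n h = - (pcov F x n / cfun F x) * btil F x $ h"
    by (simp_all add: D_def E_def vec_eq_iff)
qed

lemma frame_line_derivative:
  fixes y :: "real^2" and n :: 2
  defines "D \<equiv> pcov F x n / cfun F x"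
  shows "((\<lambda>t. btil F (x + t *\<^sub>R axis n 1) \<bullet> y) has_real_derivative
            D * (ncov F x \<bullet> y) + btil F x \<bullet> gamvec F x n y) (at 0)"
    and "((\<lambda>t. ncov F (x + t *\<^sub>R axis n 1) \<bullet> y) has_real_derivative
            - D * (btil F x \<bullet> y) + ncov F x \<bullet> gamvec F x n y) (at 0)"
proof -
  have b: "pd n (\<lambda>x. btil F x $ h) x = D * ncov F x $ h + (\<Sum>k\<in>UNIV. christoffel F x k n h * btil F x $ k)"
   and nn: "pd n (\<lambda>x. ncov F x $ h) x = - D * btil F x $ h + (\<Sum>k\<in>UNIV. christoffel F x k n h * ncov F x $ k)" for h
    using nabla_frame[of n h] by (simp_all add: nabla_def D_def algebra_simps)
  have "((\<lambda>t. \<Sum>h\<in>UNIV. btil F (x + t *\<^sub>R axis n 1) $ h * y $ h) has_real_derivative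
      (\<Sum>h\<in>UNIV. pd n (\<lambda>x. btil F x $ h) x * y $ h)) (at 0)"
    by (intro DERIV_sum DERIV_cmult_right DERIV_frame_line)
  moreover have "(\<Sum>h\<in>UNIV. pd n (\<lambda>x. btil F x $ h) x * y $ h) = D * (ncov F x \<bullet> y) + btil F x \<bullet> gamvec F x n y"
    unfolding b by (simp add: inner_vec_def sum_2 gamvec_def algebra_simps)
  ultimately show "((\<lambda>t. btil F (x + t *\<^sub>R axis n 1) \<bullet> y) has_real_derivative
            D * (ncov F x \<bullet> y) + btil F x \<bullet> gamvec F x n y) (at 0)"
    by (simp add: inner_vec_def)
  have "((\<lambda>t. \<Sum>h\<in>UNIV. ncov F (x + t *\<^sub>R axis n 1) $ h * y $ h) has_real_derivative
      (\<Sum>h\<in>UNIV. pd n (\<lambda>x. ncov F x $ h) x * y $ h)) (at 0)"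
    by (intro DERIV_sum DERIV_cmult_right DERIV_frame_line)
  moreover have "(\<Sum>h\<in>UNIV. pd n (\<lambda>x. ncov F x $ h) x * y $ h) = - D * (btil F x \<bullet> y) + ncov F x \<bullet> gamvec F x n y"
    unfolding nn by (simp add: inner_vec_def sum_2 gamvec_def algebra_simps)
  ultimately show "((\<lambda>t. ncov F (x + t *\<^sub>R axis n 1) \<bullet> y) has_real_derivative
            - D * (btil F x \<bullet> y) + ncov F x \<bullet> gamvec F x n y) (at 0)"
    by (simp add: inner_vec_def)
qed

text \<open>
  In the complex coordinate the derivative of the coframe reads \<open>z' = - i D z + z(\<Gamma>)\<close>; divided by \<open>z\<close>, its
  real and imaginary parts are the changes of \<open>ln r\<close> and \<open>\<phi>\<close>.
\<close>

lemma DERIV_polar_base: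
  fixes y :: "real^2" and n :: 2
  assumes y: "y \<in> sector F x \<phi>\<^sub>0"
  defines "D \<equiv> pcov F x n / cfun F x" and "\<phi> \<equiv> lifted_arg \<phi>\<^sub>0 (frame_coord F x y)"
  shows "((\<lambda>t. cmod (frame_coord F (x + t *\<^sub>R axis n 1) y)) has_real_derivative
            ecov F x \<phi> \<bullet> gamvec F x n y) (at 0)"
    and "((\<lambda>t. lifted_arg \<phi>\<^sub>0 (frame_coord F (x + t *\<^sub>R axis n 1) y)) has_real_derivative
            - D + (ecov' F x \<phi> \<bullet> gamvec F x n y) / cmod (frame_coord F x y)) (at 0)"
proof -
  note pol = sector_polar[OF y, folded \<phi>_def]
  define z' where "z' = - of_real D * \<i> * frame_coord F x y + frame_coord F x (gamvec F x n y)"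
  have "((\<lambda>t. frame_coord F (x + t *\<^sub>R axis n 1) y) has_vector_derivative z') (at 0)"
  proof -
    have "((\<lambda>t. complex_of_real (btil F (x + t *\<^sub>R axis n 1) \<bullet> y) + \<i> * complex_of_real (ncov F (x + t *\<^sub>R axis n 1) \<bullet> y))
      has_vector_derivative of_real (D * (ncov F x \<bullet> y) + btil F x \<bullet> gamvec F x n y)
        + \<i> * of_real (- D * (btil F x \<bullet> y) + ncov F x \<bullet> gamvec F x n y)) (at 0)"
      using frame_line_derivative[of n y, folded D_def]
      by (intro has_vector_derivative_add has_vector_derivative_mult_right has_vector_derivative_of_real)
         (simp_all add: has_real_derivative_iff_has_vector_derivative)
    moreover have "of_real (D * (ncov F x \<bullet> y) + btil F x \<bullet> gamvec F x n y)
        + \<i> * of_real (- D * (btil F x \<bullet> y) + ncov F x \<bullet> gamvec F x n y) = z'"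
      by (simp add: z'_def frame_coord_def complex_eq_iff)
    ultimately show ?thesis by (simp add: frame_coord_def Complex_eq)
  qed
  then have z: "((\<lambda>t. frame_coord F (x + t *\<^sub>R axis n 1) y) has_vector_derivative z') (at 0)" .
  have s: "Re (frame_coord F (x + 0 *\<^sub>R axis n 1) y * cis (- \<phi>\<^sub>0)) > 0" using y by (simp add: sector_def)
  have q: "z' / frame_coord F x y = - of_real D * \<i> + frame_coord F x (gamvec F x n y) / frame_coord F x y"
    using pol(2) by (simp add: z'_def diff_divide_distrib)
  show "((\<lambda>t. cmod (frame_coord F (x + t *\<^sub>R axis n 1) y)) has_real_derivative
            ecov F x \<phi> \<bullet> gamvec F x n y) (at 0)"
    using DERIV_cmod[OF z s] Re_div_polar[OF pol, of F x "gamvec F x n y"] pol(2) by (simp add: q)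
  show "((\<lambda>t. lifted_arg \<phi>\<^sub>0 (frame_coord F (x + t *\<^sub>R axis n 1) y)) has_real_derivative
            - D + (ecov' F x \<phi> \<bullet> gamvec F x n y) / cmod (frame_coord F x y)) (at 0)"
    using DERIV_lifted_arg[OF z s] Im_div_polar[OF pol, of F x "gamvec F x n y"] by (simp add: q)
qed

end

section \<open>The connection coefficients in polar form\<close>

lemma DERIV_dlnPhi:
  assumes "0 < c" "c < 1" "\<bar>s\<bar> < 2"
  shows "(dlnPhi c s has_real_derivative deriv (dlnPhi c s) \<phi>) (at \<phi>)"
    and "(dlnPhi_s c s has_real_derivative deriv (dlnPhi_s c s) \<phi>) (at \<phi>)"
proof -
  note pos = unit_nu_pos[OF assms, of \<phi>] unit_q_pos[OF assms(1,2), of \<phi>] unit_B_pos[OF assms, of \<phi>]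
  note d = DERIV_unit_q[OF assms(1,2), of \<phi>] DERIV_unit_B[OF assms(1,2), of s \<phi>] DERIV_unit_nu[OF assms(1,2), of s \<phi>]
  have "\<exists>D. (unit_q' c has_real_derivative D) (at \<phi>)"
    unfolding unit_q'_def[abs_def]
    by (rule exI) (rule d derivative_eq_intros refl | (use pos in \<open>simp; fail\<close>))+
  then obtain q2 where q2: "(unit_q' c has_real_derivative q2) (at \<phi>)" by blast
  have "\<exists>D. (unit_B' c s has_real_derivative D) (at \<phi>)"
    unfolding unit_B'_def[abs_def]
    by (rule exI) (rule d q2 derivative_eq_intros refl | (use pos in \<open>simp; fail\<close>))+
  then obtain B2 where B2: "(unit_B' c s has_real_derivative B2) (at \<phi>)" by blast
  have "\<exists>D. (unit_nu' c s has_real_derivative D) (at \<phi>)"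
    unfolding unit_nu'_def[abs_def]
    by (rule exI) (rule d q2 derivative_eq_intros refl | (use pos in \<open>simp; fail\<close>))+
  then obtain n2 where n2: "(unit_nu' c s has_real_derivative n2) (at \<phi>)" by blast
  have "\<exists>D. (dlnPhi c s has_real_derivative D) (at \<phi>)"
    unfolding dlnPhi_def[abs_def]
    by (rule exI) (rule d q2 B2 n2 derivative_eq_intros refl | (use pos in \<open>simp; fail\<close>))+
  then show "(dlnPhi c s has_real_derivative deriv (dlnPhi c s) \<phi>) (at \<phi>)"
    by (metis DERIV_imp_deriv)
  have "\<exists>D. (dlnPhi_s c s has_real_derivative D) (at \<phi>)"
    unfolding dlnPhi_s_def[abs_def]
    by (rule exI) (rule d derivative_eq_intros refl | (use pos in \<open>simp; fail\<close>))+
  then show "(dlnPhi_s c s has_real_derivative deriv (dlnPhi_s c s) \<phi>) (at \<phi>)"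
    by (metis DERIV_imp_deriv)
qed

text \<open>
  In \<open>N\<close> the vector \<open>K m\<^sup>k\<close> has the factor \<open>- (C\<^sub>1 p\<^sub>n + \<partial>\<^sup>*\<^sub>n \<theta>)\<close>, a rate of change of \<open>\<theta>\<close>; dividing by
  \<open>\<Phi> = d\<theta>/d\<phi>\<close> converts it into an angular speed.
\<close>

definition turning :: "finsleroid \<Rightarrow> real^2 \<Rightarrow> 2 \<Rightarrow> real \<Rightarrow> real" where
  "turning F x n \<phi> =
     (C1 F x * pcov F x n + pd n (gfun F) x * Psi_s (cfun F x) (gfun F x) \<phi>) / Phi (cfun F x) (gfun F x) \<phi>"

text \<open>
  An open set of \<open>(x, y)\<close> on which one sector of angles around \<open>\<phi>\<^sub>0\<close> describes the branch of \<open>\<theta>\<close>. The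
  assumption on \<open>\<theta>\<close> is made for every field \<open>g'\<close>, since \<open>\<partial>\<^sup>*\<close> replaces \<open>g\<close> by constants.
\<close>

locale polar_branch =
  fixes F :: finsleroid and X :: "(real^2) set" and V :: "((real^2) \<times> (real^2)) set"
    and \<gamma> :: "real^2 \<Rightarrow> real^2 \<Rightarrow> real \<Rightarrow> real^2" and \<phi>\<^sub>0 :: real and c :: real
  assumes fin: "finsleroid_on X F" and cc: "\<And>x. x \<in> X \<Longrightarrow> cfun F x = c"
    and V: "open V" "V \<subseteq> X \<times> UNIV"
    and Vsec: "\<And>x y. (x, y) \<in> V \<Longrightarrow> y \<in> sector F x \<phi>\<^sub>0"
    and th: "\<And>x y g'. (x, y) \<in> V \<Longrightarrow> \<bar>g' x\<bar> < 2 \<Longrightarrow>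
           theta \<gamma> (F\<lparr>gfun := g'\<rparr>) x y = Psi c (g' x) (lifted_arg \<phi>\<^sub>0 (frame_coord F x y))"
begin

lemma V_frame:
  assumes "(x, y) \<in> V"
  shows "x \<in> X" "frame_at F x" "cfun F x = c" "0 < c" "c < 1" "\<bar>gfun F x\<bar> < 2"
proof -
  show x: "x \<in> X" using assms V by auto
  show fr: "frame_at F x" by (rule finsleroid_on_frame[OF fin x])
  show c: "cfun F x = c" by (rule cc[OF x])
  show "0 < c" "c < 1" "\<bar>gfun F x\<bar> < 2" using fr c by (auto simp: frame_at_def)
qed

lemma theta_V: "(x, y) \<in> V \<Longrightarrow> theta \<gamma> F x y = Psi c (gfun F x) (lifted_arg \<phi>\<^sub>0 (frame_coord F x y))"
  using th[of x y "gfun F"] V_frame(6)[of x y] by simp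

lemma Kval_V:
  "(x, y) \<in> V \<Longrightarrow> Kval F x y = cmod (frame_coord F x y) * exp (lnrho c (gfun F x) (lifted_arg \<phi>\<^sub>0 (frame_coord F x y)))"
  using Kval_sector[OF V_frame(2) Vsec] V_frame(3) by simp

lemma dstar_Kval:
  assumes xy: "(x, y) \<in> V"
  defines "\<phi> \<equiv> lifted_arg \<phi>\<^sub>0 (frame_coord F x y)" and "s \<equiv> gfun F x"
  shows "dstar n Kval F x y = pd n (gfun F) x * (Kval F x y * lnrho_s c s \<phi>)"
proof -
  note fr = V_frame[OF xy]
  have ev: "\<forall>\<^sub>F s' in nhds s. \<bar>s'\<bar> < 2"
    using eventually_nhds_in_open[of "{-2<..<2}" s] fr(6)
    by (auto simp: s_def abs_less_iff elim!: eventually_mono)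
  have eq: "Kval (F\<lparr>gfun := (\<lambda>_. s')\<rparr>) x y = cmod (frame_coord F x y) * exp (lnrho c s' \<phi>)" if "\<bar>s'\<bar> < 2" for s'
    using Kval_sector[of "F\<lparr>gfun := (\<lambda>_. s')\<rparr>" x y \<phi>\<^sub>0] frame_at_gfun_update[OF fr(2), of "\<lambda>_. s'"]
      Vsec[OF xy] that fr(3) by (simp add: sector_def \<phi>_def)
  have "((\<lambda>s'. lnrho c s' \<phi>) has_real_derivative lnrho_s c s \<phi>) (at s)"
    using DERIV_lnrho_total[OF fr(4,5), of "\<lambda>s. s" s 1 "\<lambda>_. \<phi>" 0] fr(6) by (simp add: s_def)
  then have "((\<lambda>s'. cmod (frame_coord F x y) * exp (lnrho c s' \<phi>)) has_real_derivative
      cmod (frame_coord F x y) * (exp (lnrho c s \<phi>) * lnrho_s c s \<phi>)) (at s)"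
    by (intro DERIV_cmult DERIV_chain2[OF DERIV_exp])
  then have "deriv (\<lambda>s'. cmod (frame_coord F x y) * exp (lnrho c s' \<phi>)) s
      = cmod (frame_coord F x y) * (exp (lnrho c s \<phi>) * lnrho_s c s \<phi>)" by (rule DERIV_imp_deriv)
  moreover have "deriv (\<lambda>s'. Kval (F\<lparr>gfun := (\<lambda>_. s')\<rparr>) x y) s
      = deriv (\<lambda>s'. cmod (frame_coord F x y) * exp (lnrho c s' \<phi>)) s"
    by (rule deriv_cong_ev[OF eventually_mono[OF ev eq] refl])
  ultimately show ?thesis using Kval_V[OF xy] by (simp add: dstar_def s_def \<phi>_def)
qed

lemma dstar_theta:
  assumes xy: "(x, y) \<in> V"
  defines "\<phi> \<equiv> lifted_arg \<phi>\<^sub>0 (frame_coord F x y)" and "s \<equiv> gfun F x"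
  shows "dstar n (theta \<gamma>) F x y = pd n (gfun F) x * Psi_s c s \<phi>"
proof -
  note fr = V_frame[OF xy]
  have ev: "\<forall>\<^sub>F s' in nhds s. \<bar>s'\<bar> < 2"
    using eventually_nhds_in_open[of "{-2<..<2}" s] fr(6)
    by (auto simp: s_def abs_less_iff elim!: eventually_mono)
  have eq: "theta \<gamma> (F\<lparr>gfun := (\<lambda>_. s')\<rparr>) x y = Psi c s' \<phi>" if "\<bar>s'\<bar> < 2" for s'
    using th[OF xy, of "\<lambda>_. s'"] that by (simp add: \<phi>_def)
  have "((\<lambda>s'. Psi c s' \<phi>) has_real_derivative Psi_s c s \<phi>) (at s)"
    using DERIV_Psi_total[OF fr(4,5), of "\<lambda>s. s" s 1 "\<lambda>_. \<phi>" 0] fr(6) by (simp add: s_def)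
  then have "deriv (\<lambda>s'. Psi c s' \<phi>) s = Psi_s c s \<phi>" by (rule DERIV_imp_deriv)
  moreover have "deriv (\<lambda>s'. theta \<gamma> (F\<lparr>gfun := (\<lambda>_. s')\<rparr>) x y) s = deriv (\<lambda>s'. Psi c s' \<phi>) s"
    by (rule deriv_cong_ev[OF eventually_mono[OF ev eq] refl])
  ultimately show ?thesis by (simp add: dstar_def s_def)
qed

lemma base_line_in_V:
  fixes x y v :: "real^2"
  assumes xy: "(x, y) \<in> V" shows "\<forall>\<^sub>F t in nhds 0. (x + t *\<^sub>R v, y) \<in> V"
proof -
  have "((\<lambda>t. (x + t *\<^sub>R v, y)) \<longlongrightarrow> (x + 0 *\<^sub>R v, y)) (nhds 0)"
    by (intro tendsto_intros filterlim_ident)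
  from topological_tendstoD[OF this V(1)] xy show ?thesis by simp
qed

lemma pd_base:
  fixes n :: 2
  assumes xy: "(x, y) \<in> V"
  defines "\<phi> \<equiv> lifted_arg \<phi>\<^sub>0 (frame_coord F x y)" and "s \<equiv> gfun F x" and "r \<equiv> cmod (frame_coord F x y)"
    and "\<Gamma> \<equiv> gamvec F x n y"
  defines "\<omega> \<equiv> (ecov' F x \<phi> \<bullet> \<Gamma>) / r - pcov F x n / c"
  shows "pd n (\<lambda>x. Kval F x y) x
      = exp (lnrho c s \<phi>) * (ecov F x \<phi> \<bullet> \<Gamma> + r * (lnrho_s c s \<phi> * pd n (gfun F) x + lam c s \<phi> * \<omega>))"
    and "pd n (\<lambda>x. theta \<gamma> F x y) x = Psi_s c s \<phi> * pd n (gfun F) x + Phi c s \<phi> * \<omega>"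
proof -
  note fr = V_frame[OF xy]
  let ?g = "\<lambda>t. gfun F (x + t *\<^sub>R axis n 1)" and ?a = "\<lambda>t. lifted_arg \<phi>\<^sub>0 (frame_coord F (x + t *\<^sub>R axis n 1) y)"
  let ?r = "\<lambda>t. cmod (frame_coord F (x + t *\<^sub>R axis n 1) y)"
  note pol = DERIV_polar_base[OF fin fr(1) Vsec[OF xy], of n, unfolded fr(3), folded \<phi>_def r_def \<Gamma>_def]
  have a: "(?a has_real_derivative \<omega>) (at 0)" using pol(2) by (simp add: \<omega>_def)
  have g: "(?g has_real_derivative pd n (gfun F) x) (at 0)" by (rule DERIV_frame_line(3)[OF fin fr(1)])
  have s2: "\<bar>?g 0\<bar> < 2" using fr by simp
  have "((\<lambda>t. lnrho c (?g t) (?a t)) has_real_derivative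
      lnrho_s c s \<phi> * pd n (gfun F) x + lam c s \<phi> * \<omega>) (at 0)"
    using DERIV_lnrho_total[OF fr(4,5) s2 g a] by (simp add: s_def \<phi>_def)
  from DERIV_mult[OF pol(1) DERIV_chain2[OF DERIV_exp this]]
  have "((\<lambda>t. ?r t * exp (lnrho c (?g t) (?a t))) has_real_derivative
      exp (lnrho c s \<phi>) * (ecov F x \<phi> \<bullet> \<Gamma> + r * (lnrho_s c s \<phi> * pd n (gfun F) x + lam c s \<phi> * \<omega>))) (at 0)"
    by (simp add: s_def \<phi>_def r_def algebra_simps)
  moreover have "\<forall>\<^sub>F t in nhds 0. Kval F (x + t *\<^sub>R axis n 1) y = ?r t * exp (lnrho c (?g t) (?a t))"
    using base_line_in_V[OF xy] by eventually_elim (rule Kval_V)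
  ultimately show "pd n (\<lambda>x. Kval F x y) x
      = exp (lnrho c s \<phi>) * (ecov F x \<phi> \<bullet> \<Gamma> + r * (lnrho_s c s \<phi> * pd n (gfun F) x + lam c s \<phi> * \<omega>))"
    by (intro pd_eqI) (subst DERIV_cong_ev[OF refl _ refl])
  have "((\<lambda>t. Psi c (?g t) (?a t)) has_real_derivative
      Psi_s c s \<phi> * pd n (gfun F) x + Phi c s \<phi> * \<omega>) (at 0)"
    using DERIV_Psi_total[OF fr(4,5) s2 g a] by (simp add: s_def \<phi>_def)
  moreover have "\<forall>\<^sub>F t in nhds 0. theta \<gamma> F (x + t *\<^sub>R axis n 1) y = Psi c (?g t) (?a t)"
    using base_line_in_V[OF xy] by eventually_elim (rule theta_V)
  ultimately show "pd n (\<lambda>x. theta \<gamma> F x y) x = Psi_s c s \<phi> * pd n (gfun F) x + Phi c s \<phi> * \<omega>"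
    by (intro pd_eqI) (subst DERIV_cong_ev[OF refl _ refl])
qed

lemma open_slice: "open {y. (x, y) \<in> V}"
proof -
  have "open ((\<lambda>y. (x, y)) -` V)" by (intro open_vimage V continuous_intros)
  then show ?thesis by (simp add: vimage_def)
qed

lemma pd_theta:
  assumes xy: "(x, y) \<in> V"
  defines "\<phi> \<equiv> lifted_arg \<phi>\<^sub>0 (frame_coord F x y)"
  shows "pd k (\<lambda>y. theta \<gamma> F x y) y = Phi c (gfun F x) \<phi> * ecov' F x \<phi> $ k / cmod (frame_coord F x y)"
proof -
  note fr = V_frame[OF xy]
  have "pd k (\<lambda>y. theta \<gamma> F x y) y = pd k (\<lambda>y. Psi c (gfun F x) (lifted_arg \<phi>\<^sub>0 (frame_coord F x y))) y"
    by (rule pd_cong[OF open_slice[of x]]) (use xy theta_V in auto)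
  also have "\<dots> = Phi c (gfun F x) \<phi> * ecov' F x \<phi> $ k / cmod (frame_coord F x y)"
    unfolding \<phi>_def by (rule pd_angular[OF Vsec[OF xy] DERIV_Psi[OF fr(4-6)]])
  finally show ?thesis .
qed

text \<open>
  The bracket in the definition of \<open>N\<close> is \<open>(r/c) u'\<close> minus the multiple \<open>U (c\<^sup>2 B\<^sub>1 n\<^sup>k - n b\<^sup>k)\<close>, and the latter
  is \<open>C\<^sub>1 K m\<^sup>k\<close>: this is the step \<open>key\<close> below, where \<open>1 / (\<Phi> B) = sqrt (q / \<nu>)\<close>.
\<close>

lemma Ncoef_polar:
  assumes xy: "(x, y) \<in> V"
  defines "\<phi> \<equiv> lifted_arg \<phi>\<^sub>0 (frame_coord F x y)" and "s \<equiv> gfun F x"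
  shows "Ncoef \<gamma> F x y k n = cmod (frame_coord F x y) *
      (pcov F x n / c * eup' F x \<phi> $ k - pd n (gfun F) x * lnrho_s c s \<phi> * eup F x \<phi> $ k
        - turning F x n \<phi> * (eup' F x \<phi> $ k - lam c s \<phi> * eup F x \<phi> $ k))
      - gamvec F x n y $ k"
proof -
  note fr = V_frame[OF xy]
  define r p g where "r = cmod (frame_coord F x y)" and "p = pcov F x n" and "g = pd n (gfun F) x"
  have z: "frame_coord F x y = of_real r * cis \<phi>" "r > 0"
    using sector_polar[OF Vsec[OF xy]] by (auto simp: r_def \<phi>_def)
  note vals = fundamental_values_polar[OF fr(2) z, unfolded fr(3), folded s_def]
  define C S q B nu where "C = cos \<phi>" and "S = sin \<phi>" and "q = unit_q c \<phi>" and "B = unit_B c s \<phi>" and "nu = unit_nu c s \<phi>"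
  have pos: "q > 0" "B > 0" "nu > 0" "Phi c s \<phi> > 0"
    using unit_q_pos unit_B_pos unit_nu_pos Phi_pos fr(4-6) by (auto simp: q_def B_def nu_def s_def)
  have CS: "C * C + S * S = 1" by (simp add: C_def S_def)
  define P where "P = Phi c s \<phi>"
  define b' n' e e' where "b' = btup F x $ k" and "n' = nup F x $ k" and "e = eup F x \<phi> $ k" and "e' = eup' F x \<phi> $ k"
  have e: "e = C * b' + S * n'" "e' = C * n' - S * b'"
    by (simp_all add: e_def e'_def eup_def eup'_def b'_def n'_def C_def S_def)
  have rt: "sqrt (q / nu) = 1 / (P * B)"
  proof -
    have "P * B = sqrt (nu / q)" using pos by (simp add: P_def Phi_def q_def B_def nu_def)
    then show ?thesis using pos by (simp add: real_sqrt_divide)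
  qed
  have U: "Uval F x y = - 1 / (c * c * (P * B))"
    using z(2) by (simp add: Uval_def C1_def vals(4,6) fr(3) q_def[symmetric] nu_def[symmetric] rt)
  have bup: "bup F x $ k = c * b'"
    by (simp add: bup_def bcov_def raise_def b'_def btup_def matrix_vector_mult_scaleR fr(3))
  have Bl: "B * lam c s \<phi> = - (c * s * S * q)"
    using pos by (simp add: lam_def B_def S_def q_def)
  have Bd: "B = 1 + s * c * C * q" by (simp add: B_def unit_B_def C_def q_def)
  have key: "(C + c * s * q) * n' - S * b' = B * (e' - lam c s \<phi> * e)"
  proof -
    have "B * (e' - lam c s \<phi> * e) = B * e' - (B * lam c s \<phi>) * e" by (simp add: algebra_simps)
    also have "\<dots> = (1 + s * c * C * q) * (C * n' - S * b') + c * s * S * q * (C * b' + S * n')"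
      unfolding Bl e Bd[symmetric] by simp
    also have "\<dots> = C * n' - S * b' + c * s * q * n' * (C * C + S * S)" by (simp add: algebra_simps)
    finally show ?thesis unfolding CS by (simp add: algebra_simps)
  qed
  have "(1 / (cfun F x)\<^sup>2 * bval F x y - Uval F x y * (cfun F x)\<^sup>2 * B1 F x y) * nup F x $ k
      + nval F x y * (Uval F x y - 1 / (cfun F x)\<^sup>2) * bup F x $ k
      = r / c * (C * n' - S * b') + r / (c * (P * B)) * ((C + c * s * q) * n' - S * b')"
    unfolding B1_def U bup fr(3) vals(2-4) C_def[symmetric] S_def[symmetric] q_def[symmetric] s_def[symmetric] n'_def[symmetric]
    using fr(4) pos unfolding P_def[symmetric] by (simp add: field_simps power2_eq_square)
  also have "\<dots> = r * (e' / c + 1 / (c * P) * (e' - lam c s \<phi> * e))"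
    unfolding key e(2)[symmetric] using fr(4) pos unfolding P_def[symmetric] by (simp add: field_simps)
  finally have br: "(1 / (cfun F x)\<^sup>2 * bval F x y - Uval F x y * (cfun F x)\<^sup>2 * B1 F x y) * nup F x $ k
      + nval F x y * (Uval F x y - 1 / (cfun F x)\<^sup>2) * bup F x $ k
      = r * (e' / c + 1 / (c * P) * (e' - lam c s \<phi> * e))" .
  have K: "Kval F x y > 0" using Kval_V[OF xy] z(2) by (simp add: r_def)
  have yk: "y $ k = r * e" by (subst vals(1)) (simp add: e_def)
  have dK: "dstar n Kval F x y = g * (Kval F x y * lnrho_s c s \<phi>)"
    unfolding g_def s_def \<phi>_def by (rule dstar_Kval[OF xy])
  have l: "lup F x y $ k * dstar n Kval F x y = r * (g * lnrho_s c s \<phi> * e)"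
    unfolding dK using K by (simp add: lup_def yk)
  have "Kval F x y * mup F x y $ k = r / P * (e' - lam c s \<phi> * e)"
    using arg_cong[OF Kval_mup_polar[OF fr(2) Vsec[OF xy]], of "\<lambda>v. v $ k"]
    by (simp add: fr(3) r_def P_def s_def \<phi>_def e_def e'_def)
  then have m: "Kval F x y * mup F x y $ k * dstar n (theta \<gamma>) F x y
      = r / P * (e' - lam c s \<phi> * e) * (g * Psi_s c s \<phi>)"
    unfolding dstar_theta[OF xy] by (simp add: \<phi>_def s_def g_def)
  have C1: "C1 F x = - 1 / c" by (simp add: C1_def fr(3))
  have "Ncoef \<gamma> F x y k n = r * (e' / c + 1 / (c * P) * (e' - lam c s \<phi> * e)) * p
      - r * (g * lnrho_s c s \<phi> * e) - r / P * (e' - lam c s \<phi> * e) * (g * Psi_s c s \<phi>) - gamvec F x n y $ k"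
    unfolding Ncoef_def br l m by (simp add: gamvec_def p_def)
  also have "\<dots> = r * (p / c * e' - g * lnrho_s c s \<phi> * e - (- 1 / c * p + g * Psi_s c s \<phi>) / P * (e' - lam c s \<phi> * e))
      - gamvec F x n y $ k"
    using fr(4) pos unfolding P_def[symmetric] by (simp add: field_simps)
  finally show ?thesis
    by (simp add: r_def p_def g_def e_def e'_def P_def s_def turning_def C1 fr(3))
qed

end

section \<open>Transport equations and second derivatives\<close>

text \<open>
  For \<open>w = \<alpha> u + (D - \<beta>) u'\<close> with \<open>\<alpha> = - a + \<beta> \<lambda>\<close>, where \<open>\<beta>\<close> is the turning speed and \<open>a = g\<^sub>n \<partial>\<^sub>g ln \<rho>\<close>, the
  pairing of \<open>w + w''\<close> with \<open>e + \<lambda> e'\<close> is the left-hand side. By the Riccati equation everything cancels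
  except \<open>2 \<Phi>\<^sup>2 (\<beta>' + \<beta> L - g\<^sub>n M)\<close>, where \<open>L\<close> and \<open>M\<close> are the derivatives
  of \<open>ln \<Phi>\<close> in \<open>\<phi>\<close> and in \<open>g\<close>, and this vanishes because \<open>\<beta> \<Phi>\<close> has the derivative \<open>g\<^sub>n \<Phi> M\<close>.
\<close>

lemma contraction_identity:
  fixes lam Phi2 g M b L b1 lam_s b2 :: real
  defines "lam1 \<equiv> Phi2 - 1 - lam\<^sup>2"
  assumes "b1 = g * M - b * L"
  shows "(- g * (2 * Phi2 * M - 2 * lam * lam_s) + (b2 * lam + 2 * b1 * lam1 + b * (2 * Phi2 * L - 2 * lam * lam1)) + 2 * b1)
      + lam * (2 * (- g * lam_s + (b1 * lam + b * lam1)) - b2) = 0"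
  unfolding lam1_def assms(2) by (simp add: algebra_simps power2_eq_square)

context polar_branch
begin

lemma Ncoef_contract:
  assumes xy: "(x, y) \<in> V"
  defines "\<phi> \<equiv> lifted_arg \<phi>\<^sub>0 (frame_coord F x y)" and "s \<equiv> gfun F x"
  shows "(\<Sum>k\<in>UNIV. Ncoef \<gamma> F x y k n * w $ k)
    = cmod (frame_coord F x y) *
      (pcov F x n / c * (w \<bullet> eup' F x \<phi>) - pd n (gfun F) x * lnrho_s c s \<phi> * (w \<bullet> eup F x \<phi>)
        - turning F x n \<phi> * (w \<bullet> eup' F x \<phi> - lam c s \<phi> * (w \<bullet> eup F x \<phi>)))
      - w \<bullet> gamvec F x n y"
  unfolding Ncoef_polar[OF xy] \<phi>_def s_def
  by (simp add: inner_vec_def sum_2 algebra_simps)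

lemma dN_Kval:
  assumes xy: "(x, y) \<in> V" shows "dN \<gamma> F n (Kval F) x y = 0"
proof -
  note fr = V_frame[OF xy]
  define \<phi> s r where "\<phi> = lifted_arg \<phi>\<^sub>0 (frame_coord F x y)" and "s = gfun F x" and "r = cmod (frame_coord F x y)"
  have r: "r > 0" using sector_polar(2)[OF Vsec[OF xy]] by (simp add: r_def)
  note dual = e_dual[OF fr(2)]
  define \<rho> l where "\<rho> = exp (lnrho c s \<phi>)" and "l = lam c s \<phi>"
  define w where "w = \<rho> *\<^sub>R (ecov F x \<phi> + l *\<^sub>R ecov' F x \<phi>)"
  have "pd k (\<lambda>y. Kval F x y) y = w $ k" for k
    using pd_Kval[OF fr(2) Vsec[OF xy]] fr(3) by (simp add: w_def \<rho>_def l_def s_def \<phi>_def)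
  then have "dN \<gamma> F n (Kval F) x y = pd n (\<lambda>x. Kval F x y) x + (\<Sum>k\<in>UNIV. Ncoef \<gamma> F x y k n * w $ k)"
    by (simp add: dN_def)
  also have "\<dots> = 0"
    unfolding pd_base(1)[OF xy] Ncoef_contract[OF xy]
      \<phi>_def[symmetric] s_def[symmetric] r_def[symmetric] \<rho>_def[symmetric] l_def[symmetric]
    using r by (simp add: w_def inner_add_left dual algebra_simps)
  finally show ?thesis .
qed

lemma dN_theta:
  assumes xy: "(x, y) \<in> V" shows "dN \<gamma> F n (theta \<gamma> F) x y = - C1 F x * pcov F x n"
proof -
  note fr = V_frame[OF xy]
  define \<phi> s r where "\<phi> = lifted_arg \<phi>\<^sub>0 (frame_coord F x y)" and "s = gfun F x" and "r = cmod (frame_coord F x y)"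
  have r: "r > 0" using sector_polar(2)[OF Vsec[OF xy]] by (simp add: r_def)
  note dual = e_dual[OF fr(2)]
  define l P where "l = lam c s \<phi>" and "P = Phi c s \<phi>"
  have P: "P > 0" using Phi_pos fr(4-6) by (simp add: P_def s_def)
  define w where "w = (P / r) *\<^sub>R ecov' F x \<phi>"
  have "pd k (\<lambda>y. theta \<gamma> F x y) y = w $ k" for k
    using pd_theta[OF xy] by (simp add: w_def P_def s_def \<phi>_def r_def)
  then have "dN \<gamma> F n (theta \<gamma> F) x y = pd n (\<lambda>x. theta \<gamma> F x y) x + (\<Sum>k\<in>UNIV. Ncoef \<gamma> F x y k n * w $ k)"
    by (simp add: dN_def)
  also have "\<dots> = - C1 F x * pcov F x n"
    unfolding pd_base(2)[OF xy] Ncoef_contract[OF xy] turning_def fr(3)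
      \<phi>_def[symmetric] s_def[symmetric] r_def[symmetric] l_def[symmetric] P_def[symmetric]
    using r P by (simp add: w_def dual field_simps)
  finally show ?thesis .
qed

lemma Ncoef_representation:
  assumes xy: "(x, y) \<in> V"
  shows "Ncoef \<gamma> F x y k n =
              - lup F x y $ k * pd n (\<lambda>x. Kval F x y) x
              - Kval F x y * mup F x y $ k
                * (pd n (\<lambda>x. theta \<gamma> F x y) x + C1 F x * pcov F x n)"
proof -
  note fr = V_frame[OF xy]
  define \<phi> s r where "\<phi> = lifted_arg \<phi>\<^sub>0 (frame_coord F x y)" and "s = gfun F x" and "r = cmod (frame_coord F x y)"
  have z: "frame_coord F x y = of_real r * cis \<phi>" "r > 0"
    using sector_polar[OF Vsec[OF xy]] by (auto simp: r_def \<phi>_def)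
  define \<rho> l P where "\<rho> = exp (lnrho c s \<phi>)" and "l = lam c s \<phi>" and "P = Phi c s \<phi>"
  have P: "P > 0" using Phi_pos fr(4-6) by (simp add: P_def s_def)
  have \<rho>: "\<rho> > 0" by (simp add: \<rho>_def)
  define e e' where "e = eup F x \<phi> $ k" and "e' = eup' F x \<phi> $ k"
  define G1 G2 where "G1 = ecov F x \<phi> \<bullet> gamvec F x n y" and "G2 = ecov' F x \<phi> \<bullet> gamvec F x n y"
  have K: "Kval F x y = r * \<rho>" using Kval_V[OF xy] by (simp add: r_def \<rho>_def s_def \<phi>_def)
  have "y $ k = r * e" by (subst fundamental_values_polar(1)[OF fr(2) z]) (simp add: e_def)
  then have lu: "lup F x y $ k = e / \<rho>" using z(2) \<rho> by (simp add: lup_def K field_simps)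
  have mu: "Kval F x y * mup F x y $ k = r / P * (e' - l * e)"
    using arg_cong[OF Kval_mup_polar[OF fr(2) Vsec[OF xy]], of "\<lambda>v. v $ k"]
    by (simp add: fr(3) r_def P_def s_def \<phi>_def e_def e'_def l_def)
  have ga: "gamvec F x n y $ k = G1 * e + G2 * e'"
    using arg_cong[OF e_decomp[OF fr(2), of "gamvec F x n y" \<phi>], of "\<lambda>v. v $ k"]
    by (simp add: G1_def G2_def e_def e'_def)
  show ?thesis
    unfolding mu lu pd_base[OF xy] Ncoef_polar[OF xy] ga turning_def fr(3)
      \<phi>_def[symmetric] s_def[symmetric] r_def[symmetric] l_def[symmetric] P_def[symmetric] \<rho>_def[symmetric]
      e_def[symmetric] e'_def[symmetric] G1_def[symmetric] G2_def[symmetric]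
    using z(2) P \<rho> fr(4) by (simp add: field_simps)
qed

text \<open>
  On the fibre over \<open>x\<close>, the coefficient \<open>N\<^sup>k\<^sub>n\<close> has the form \<open>r w(\<phi>)\<close>, including its Christoffel part, which is
  linear in \<open>y\<close> and so drops out of \<open>w + w''\<close>. As \<open>y\<^sub>k\<close> is a multiple of \<open>e + \<lambda> e'\<close>, only the scalar of
  \<open>contraction_identity\<close> is left.
\<close>

lemma Ncoef_second_derivatives:
  assumes xy: "(x, y) \<in> V"
  shows "(\<Sum>k\<in>UNIV. ylow F x y $ k * pd m (\<lambda>y. pd i (\<lambda>y. Ncoef \<gamma> F x y k n) y) y) = 0"
proof -
  note fr = V_frame[OF xy]
  define s g p where "s = gfun F x" and "g = pd n (gfun F) x" and "p = C1 F x * pcov F x n"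
  define D where "D = pcov F x n / c"
  have cs: "0 < c" "c < 1" "\<bar>s\<bar> < 2" using fr by (auto simp: s_def)
  define l P L M where "l = lam c s" and "P = Phi c s" and "L = dlnPhi c s" and "M = dlnPhi_s c s"
  have P: "P \<phi> > 0" for \<phi> using Phi_pos[OF cs] by (simp add: P_def)
  define l1 where "l1 = (\<lambda>\<phi>. (P \<phi>)\<^sup>2 - 1 - (l \<phi>)\<^sup>2)"
  define l2 where "l2 = (\<lambda>\<phi>. 2 * (P \<phi>)\<^sup>2 * L \<phi> - 2 * l \<phi> * l1 \<phi>)"
  have dP: "(P has_real_derivative P \<phi> * L \<phi>) (at \<phi>)" for \<phi>
    unfolding P_def L_def by (rule DERIV_Phi[OF cs])
  have dl: "(l has_real_derivative l1 \<phi>) (at \<phi>)" for \<phi>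
    unfolding l_def l1_def P_def by (rule DERIV_lam[OF cs])
  have dl1: "(l1 has_real_derivative l2 \<phi>) (at \<phi>)" for \<phi>
  proof -
    have "((\<lambda>\<phi>. (P \<phi>)\<^sup>2 - 1 - (l \<phi>)\<^sup>2) has_real_derivative l2 \<phi>) (at \<phi>)"
      using DERIV_diff[OF DERIV_diff[OF DERIV_power[OF dP[of \<phi>], of 2] DERIV_const[of 1]] DERIV_power[OF dl[of \<phi>], of 2]]
      by (simp add: l2_def power2_eq_square algebra_simps)
    then show ?thesis by (simp add: l1_def[abs_def])
  qed
  define a ls where "a = lnrho_s c s" and "ls = lam_s c s"
  have da: "(a has_real_derivative ls \<phi>) (at \<phi>)" for \<phi>
    unfolding a_def ls_def by (rule DERIV_lnrho_s[OF cs])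
  define ls1 where "ls1 = (\<lambda>\<phi>. 2 * (P \<phi>)\<^sup>2 * M \<phi> - 2 * l \<phi> * ls \<phi>)"
  have dls: "(ls has_real_derivative ls1 \<phi>) (at \<phi>)" for \<phi>
    using DERIV_lam_s[OF cs, of \<phi>] unfolding ls_def ls1_def P_def M_def l_def
    by (simp add: power2_eq_square ac_simps)
  define b where "b = turning F x n"
  define b1 where "b1 = (\<lambda>\<phi>. g * M \<phi> - b \<phi> * L \<phi>)"
  define b2 where "b2 = (\<lambda>\<phi>. g * deriv M \<phi> - (b1 \<phi> * L \<phi> + b \<phi> * deriv L \<phi>))"
  have b_eq: "b = (\<lambda>\<phi>. (p + g * Psi_s c s \<phi>) / P \<phi>)"
    by (simp add: b_def turning_def p_def g_def s_def P_def fr(3) fun_eq_iff)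
  have db: "(b has_real_derivative b1 \<phi>) (at \<phi>)" for \<phi>
  proof -
    have "((\<lambda>\<phi>. p + g * Psi_s c s \<phi>) has_real_derivative g * (P \<phi> * M \<phi>)) (at \<phi>)"
      using DERIV_add[OF DERIV_const[of p] DERIV_cmult[OF DERIV_Psi_s[OF cs, of \<phi>], of g]]
      by (simp add: P_def M_def)
    from DERIV_divide[OF this dP[of \<phi>]] P[of \<phi>]
    have "(b has_real_derivative (g * (P \<phi> * M \<phi>) * P \<phi> - (p + g * Psi_s c s \<phi>) * (P \<phi> * L \<phi>)) / (P \<phi> * P \<phi>)) (at \<phi>)"
      unfolding b_eq by simp
    moreover have "(g * (P \<phi> * M \<phi>) * P \<phi> - (p + g * Psi_s c s \<phi>) * (P \<phi> * L \<phi>)) / (P \<phi> * P \<phi>) = b1 \<phi>"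
      unfolding b1_def b_eq using P[of \<phi>] by (simp add: diff_divide_distrib)
    ultimately show ?thesis by simp
  qed
  have db1: "(b1 has_real_derivative b2 \<phi>) (at \<phi>)" for \<phi>
  proof -
    have "((\<lambda>\<phi>. g * M \<phi> - b \<phi> * L \<phi>) has_real_derivative b2 \<phi>) (at \<phi>)"
      using DERIV_diff[OF DERIV_cmult[OF DERIV_dlnPhi(2)[OF cs, of \<phi>], of g] DERIV_mult[OF db[of \<phi>] DERIV_dlnPhi(1)[OF cs, of \<phi>]]]
      by (simp add: b2_def M_def L_def algebra_simps)
    then show ?thesis by (simp add: b1_def[abs_def])
  qed
  \<comment> \<open>the radial component of \<open>w\<close> and its derivatives; the angular one is \<open>D - b\<close>\<close>
  define \<alpha> where "\<alpha> = (\<lambda>\<phi>. - g * a \<phi> + b \<phi> * l \<phi>)"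
  define \<alpha>1 where "\<alpha>1 = (\<lambda>\<phi>. - g * ls \<phi> + (b1 \<phi> * l \<phi> + b \<phi> * l1 \<phi>))"
  define \<alpha>2 where "\<alpha>2 = (\<lambda>\<phi>. - g * ls1 \<phi> + (b2 \<phi> * l \<phi> + 2 * b1 \<phi> * l1 \<phi> + b \<phi> * l2 \<phi>))"
  have d\<alpha>: "(\<alpha> has_real_derivative \<alpha>1 \<phi>) (at \<phi>)" for \<phi>
    unfolding \<alpha>_def \<alpha>1_def
    using DERIV_add[OF DERIV_cmult[OF da[of \<phi>], of "- g"] DERIV_mult[OF db[of \<phi>] dl[of \<phi>]]]
    by (simp add: algebra_simps)
  have d\<alpha>1: "(\<alpha>1 has_real_derivative \<alpha>2 \<phi>) (at \<phi>)" for \<phi>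
    unfolding \<alpha>1_def \<alpha>2_def
    using DERIV_add[OF DERIV_cmult[OF dls[of \<phi>], of "- g"]
        DERIV_add[OF DERIV_mult[OF db1[of \<phi>] dl[of \<phi>]] DERIV_mult[OF db[of \<phi>] dl1[of \<phi>]]]]
    by (simp add: algebra_simps)
  define w0 w0' where "w0 = (\<lambda>k \<phi>. gamvec F x n (eup F x \<phi>) $ k)" and "w0' = (\<lambda>k \<phi>. gamvec F x n (eup' F x \<phi>) $ k)"
  have dw0: "(w0 k has_real_derivative w0' k \<phi>) (at \<phi>)" and dw0': "(w0' k has_real_derivative - w0 k \<phi>) (at \<phi>)" for k \<phi>
  proof -
    have "((\<lambda>\<phi>. \<Sum>j\<in>UNIV. christoffel F x k n j * eup F x \<phi> $ j) has_real_derivative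
        (\<Sum>j\<in>UNIV. christoffel F x k n j * eup' F x \<phi> $ j)) (at \<phi>)"
      by (intro DERIV_sum DERIV_cmult DERIV_eup)
    then show "(w0 k has_real_derivative w0' k \<phi>) (at \<phi>)" by (simp add: w0_def w0'_def gamvec_def)
    have "((\<lambda>\<phi>. \<Sum>j\<in>UNIV. christoffel F x k n j * eup' F x \<phi> $ j) has_real_derivative
        (\<Sum>j\<in>UNIV. christoffel F x k n j * - eup F x \<phi> $ j)) (at \<phi>)"
      by (intro DERIV_sum DERIV_cmult DERIV_eup')
    then show "(w0' k has_real_derivative - w0 k \<phi>) (at \<phi>)" by (simp add: w0_def w0'_def gamvec_def sum_negf)
  qed
  define w where "w = (\<lambda>k \<phi>. \<alpha> \<phi> * eup F x \<phi> $ k + (D - b \<phi>) * eup' F x \<phi> $ k - w0 k \<phi>)"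
  define w1 where "w1 = (\<lambda>k \<phi>. (\<alpha>1 \<phi> - (D - b \<phi>)) * eup F x \<phi> $ k + (\<alpha> \<phi> - b1 \<phi>) * eup' F x \<phi> $ k - w0' k \<phi>)"
  define w2 where "w2 = (\<lambda>k \<phi>. (\<alpha>2 \<phi> + 2 * b1 \<phi> - \<alpha> \<phi>) * eup F x \<phi> $ k + (2 * \<alpha>1 \<phi> - b2 \<phi> - (D - b \<phi>)) * eup' F x \<phi> $ k + w0 k \<phi>)"
  have dw: "(w k has_real_derivative w1 k \<phi>) (at \<phi>)" for k \<phi>
    unfolding w_def w1_def
    using DERIV_diff[OF DERIV_add[OF DERIV_mult[OF d\<alpha>[of \<phi>] DERIV_eup[of F x k \<phi>]]
        DERIV_mult[OF DERIV_diff[OF DERIV_const[of D] db[of \<phi>]] DERIV_eup'[of F x k \<phi>]]] dw0[of k \<phi>]]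
    by (simp add: algebra_simps)
  have dw1: "(w1 k has_real_derivative w2 k \<phi>) (at \<phi>)" for k \<phi>
    unfolding w1_def w2_def
    using DERIV_diff[OF DERIV_add[OF DERIV_mult[OF DERIV_diff[OF d\<alpha>1[of \<phi>] DERIV_diff[OF DERIV_const[of D] db[of \<phi>]]] DERIV_eup[of F x k \<phi>]]
        DERIV_mult[OF DERIV_diff[OF d\<alpha>[of \<phi>] db1[of \<phi>]] DERIV_eup'[of F x k \<phi>]]] dw0'[of k \<phi>]]
    by (simp add: algebra_simps)
  define U where "U = {y. (x, y) \<in> V}"
  have U: "open U" "y \<in> U" "U \<subseteq> sector F x \<phi>\<^sub>0"
    using open_slice xy Vsec by (auto simp: U_def)
  have N: "Ncoef \<gamma> F x y' k n = cmod (frame_coord F x y') * w k (lifted_arg \<phi>\<^sub>0 (frame_coord F x y'))" if "y' \<in> U" for y' k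
  proof -
    have xy': "(x, y') \<in> V" using that by (simp add: U_def)
    note pol = sector_polar[OF Vsec[OF xy']]
    have "gamvec F x n y' $ k = cmod (frame_coord F x y') * w0 k (lifted_arg \<phi>\<^sub>0 (frame_coord F x y'))"
      by (subst fundamental_values_polar(1)[OF fr(2) pol]) (simp add: gamvec_def w0_def sum_distrib_left ac_simps)
    then show ?thesis
      unfolding Ncoef_polar[OF xy'] w_def \<alpha>_def
      by (simp add: D_def g_def s_def[symmetric] a_def l_def b_def algebra_simps)
  qed
  define \<phi> r where "\<phi> = lifted_arg \<phi>\<^sub>0 (frame_coord F x y)" and "r = cmod (frame_coord F x y)"
  have pdN: "pd m (\<lambda>y. pd i (\<lambda>y. Ncoef \<gamma> F x y k n) y) y
      = (w k \<phi> + w2 k \<phi>) * (ecov' F x \<phi> $ i * ecov' F x \<phi> $ m) / r" for k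
    unfolding \<phi>_def r_def by (rule pd_pd_radial[OF U N dw dw1])
  have ww: "w k \<phi> + w2 k \<phi> = ((\<alpha>2 \<phi> + 2 * b1 \<phi>) *\<^sub>R eup F x \<phi> + (2 * \<alpha>1 \<phi> - b2 \<phi>) *\<^sub>R eup' F x \<phi>) $ k" for k
    by (simp add: w_def w2_def algebra_simps)
  define lc where "lc = ecov F x \<phi> + l \<phi> *\<^sub>R ecov' F x \<phi>"
  have yl: "ylow F x y $ k = r * (exp (lnrho c s \<phi>))\<^sup>2 * lc $ k" for k
    unfolding ylow_polar[OF fr(2) Vsec[OF xy]] by (simp add: lc_def r_def \<phi>_def s_def l_def fr(3))
  define E where "E = r * (exp (lnrho c s \<phi>))\<^sup>2 * (ecov' F x \<phi> $ i * ecov' F x \<phi> $ m) / r"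
  have "(\<Sum>k\<in>UNIV. ylow F x y $ k * pd m (\<lambda>y. pd i (\<lambda>y. Ncoef \<gamma> F x y k n) y) y)
      = E * (lc \<bullet> ((\<alpha>2 \<phi> + 2 * b1 \<phi>) *\<^sub>R eup F x \<phi> + (2 * \<alpha>1 \<phi> - b2 \<phi>) *\<^sub>R eup' F x \<phi>))"
    unfolding pdN ww yl E_def inner_vec_def sum_distrib_left by (intro sum.cong refl) (simp add: ac_simps)
  also have "lc \<bullet> ((\<alpha>2 \<phi> + 2 * b1 \<phi>) *\<^sub>R eup F x \<phi> + (2 * \<alpha>1 \<phi> - b2 \<phi>) *\<^sub>R eup' F x \<phi>)
      = (\<alpha>2 \<phi> + 2 * b1 \<phi>) + l \<phi> * (2 * \<alpha>1 \<phi> - b2 \<phi>)"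
    by (simp add: lc_def inner_add_left inner_add_right e_dual[OF fr(2)] algebra_simps)
  also have "\<dots> = 0"
    using contraction_identity[of "b1 \<phi>" g "M \<phi>" "b \<phi>" "L \<phi>" "(P \<phi>)\<^sup>2" "l \<phi>" "ls \<phi>" "b2 \<phi>"]
    by (simp add: \<alpha>1_def \<alpha>2_def ls1_def l2_def l1_def b1_def)
  finally show ?thesis by simp
qed

end

theorem mainTheorem9:
  fixes F :: finsleroid
    and X :: "(real^2) set"
    and W :: "((real^2) \<times> (real^2)) set"
    and \<gamma> :: "real^2 \<Rightarrow> real^2 \<Rightarrow> real \<Rightarrow> real^2"
    and x y :: "real^2"
  assumes "finsleroid_on X F"
    and "cfun F constant_on X"
    and "branch_paths X F W \<gamma>"
    and "(x, y) \<in> W"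
  shows "(\<forall>n. dN \<gamma> F n (Kval F) x y = 0)
       \<and> (\<forall>n. dN \<gamma> F n (theta \<gamma> F) x y = - C1 F x * pcov F x n)
       \<and> (\<forall>n m i. (\<Sum>k\<in>UNIV. ylow F x y $ k
                     * pd m (\<lambda>y. pd i (\<lambda>y. Ncoef \<gamma> F x y k n) y) y) = 0)
       \<and> (\<forall>k n. Ncoef \<gamma> F x y k n =
              - lup F x y $ k * pd n (\<lambda>x. Kval F x y) x
              - Kval F x y * mup F x y $ k
                * (pd n (\<lambda>x. theta \<gamma> F x y) x + C1 F x * pcov F x n))"
proof -
  obtain c where cc: "\<And>x. x \<in> X \<Longrightarrow> cfun F x = c"
    using assms(2) unfolding constant_on_def by blast
  have W: "W \<subseteq> X \<times> UNIV" using assms(3) unfolding branch_paths_def by auto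
  obtain \<phi>\<^sub>0 V where V: "open V" "(x, y) \<in> V" "V \<subseteq> W"
    and sec: "\<And>x y. (x, y) \<in> V \<Longrightarrow> Re (frame_coord F x y * cis (- \<phi>\<^sub>0)) > 0"
    and th: "\<And>x y g'. (x, y) \<in> V \<Longrightarrow> \<bar>g' x\<bar> < 2 \<Longrightarrow>
           theta \<gamma> (F\<lparr>gfun := g'\<rparr>) x y = Psi (cfun F x) (g' x) (lifted_arg \<phi>\<^sub>0 (frame_coord F x y))"
    by (rule theta_local[OF assms(1,3,4)]) (rule that, assumption+)
  have VX: "V \<subseteq> X \<times> UNIV" using V(3) W by blast
  have sec': "\<And>x y. (x, y) \<in> V \<Longrightarrow> y \<in> sector F x \<phi>\<^sub>0" using sec by (simp add: sector_def)
  have th': "theta \<gamma> (F\<lparr>gfun := g'\<rparr>) x y = Psi c (g' x) (lifted_arg \<phi>\<^sub>0 (frame_coord F x y))"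
    if "(x, y) \<in> V" "\<bar>g' x\<bar> < 2" for x y g'
    using th[of x y g'] cc[of x] VX that by auto
  interpret pb: polar_branch F X V \<gamma> \<phi>\<^sub>0 c
    by unfold_locales (fact assms(1) cc V(1) VX sec' th')+
  show ?thesis
    using pb.dN_Kval[OF V(2)] pb.dN_theta[OF V(2)] pb.Ncoef_second_derivatives[OF V(2)]
      pb.Ncoef_representation[OF V(2)]
    by blast
qed

end
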